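(* Let $n\ge 3$ and let $\mathbb{S}^n_+$ be the open upper unit hemisphere of $\mathbb{S}^n\subset\mathbb{R}^{n+1}$ with the standard round metric $g$, $\Delta_g$ its Laplace–Beltrami operator, and $\nu$ the unit outward normal along the boundary $\partial\mathbb{S}^n_+$ (the equator). Let $f:[0,+\infty)\to\mathbb{R}$ and $b:[0,+\infty)\to\mathbb{R}$ be continuous and consider $$-\Delta_g u=f(u)\ \text{ on }\mathbb{S}^n_+,\qquad \frac{\partial u}{\partial\nu}=b(u)\ \text{ on }\partial\mathbb{S}^n_+ .\qquad (\ast)$$ Suppose that $h_1(t):=t^{-\frac{n+2}{n-2}}\left(f(t)+\frac{n(n-2)}{4}t\right)$ is decreasing on $(0,+\infty)$, and $k_1(t):=t^{-\frac{n}{n-2}}b(t)$ is nonincreasing and nonnegative on $(0,+\infty)$. Then: (i) any positive solution $u$ of $(\ast)$ which is continuous on $\overline{\mathbb{S}^n_+}$ is constant on each set $A_r=\{\omega\in\overline{\mathbb{S}^n_+}:\ \operatorname{dist}_{\mathbb{S}^n}(\omega,\partial\mathbb{S}^n_+)=r\}$, $r\in[0,\pi/2]$ (i.e. on each "circle parallel to the equator"). Moreover, if $b(u(\zeta_0))=0$ for some $\zeta_0\in\partial\mathbb{S}^n_+$, then $u$ is constant on $\mathbb{S}^n_+$. (ii) If $h_1(t)t^{\frac{n+2}{n-2}}$ (that is, $f(t)+\frac{n(n-2)}{4}t$) is nonnegative for $t\ge 0$, then any nonnegative continuous solution of $(\ast)$ is either identically zero or positive on $\overline{\mathbb{S}^n_+}$,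 so the conclusions of (i) hold for it when it is nonzero. Moreover, if $b(t)\ge \frac{n-2}{2}t$ for all $t>0$, then $(\ast)$ has no positive solutions.
   Context: $\operatorname{dist}_{\mathbb{S}^n}$ denotes the geodesic distance on the round sphere $\mathbb{S}^n$. Solutions are classical solutions of the boundary value problem. *)

theory Defs
  imports "HOL-Analysis.Analysis"
begin

text \<open>The round sphere S^n is the unit sphere of real^'m, CARD('m) = n+1.
  The upper hemisphere is taken with respect to the coordinate axis e.\<close>

definition hemi :: "'m::finite \<Rightarrow> (real^'m) set" where
  "hemi e = {x. norm x = 1 \<and> x $ e > 0}"

definition chemi :: "'m::finite \<Rightarrow> (real^'m) set" where
  "chemi e = {x. norm x = 1 \<and> x $ e \<ge> 0}"

definition equator :: "'m::finite \<Rightarrow> (real^'m) set" where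
  "equator e = {x. norm x = 1 \<and> x $ e = 0}"

definition sdist :: "real^'m::finite \<Rightarrow> real^'m \<Rightarrow> real" where
  "sdist x y = arccos (x \<bullet> y)"

definition dist_bdry :: "'m::finite \<Rightarrow> real^'m \<Rightarrow> real" where
  "dist_bdry e w = Inf (sdist w ` equator e)"

definition parallel_set :: "'m::finite \<Rightarrow> real \<Rightarrow> (real^'m) set" where
  "parallel_set e r = {w \<in> chemi e. dist_bdry e w = r}"

definition hom0 :: "(real^'m::finite \<Rightarrow> real) \<Rightarrow> real^'m \<Rightarrow> real" where
  "hom0 u x = u (x /\<^sub>R norm x)"

definition cone_up :: "'m::finite \<Rightarrow> (real^'m) set" where
  "cone_up e = {x. x $ e > 0}"

definition pd :: "'m::finite \<Rightarrow> (real^'m \<Rightarrow> real) \<Rightarrow> real^'m \<Rightarrow> real" where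
  "pd i F x = deriv (\<lambda>t. F (x + t *\<^sub>R axis i 1)) 0"

definition eucl_lap :: "(real^'m::finite \<Rightarrow> real) \<Rightarrow> real^'m \<Rightarrow> real" where
  "eucl_lap F x = (\<Sum>i\<in>UNIV. pd i (pd i F) x)"

definition C2_on :: "(real^'m::finite) set \<Rightarrow> (real^'m \<Rightarrow> real) \<Rightarrow> bool" where
  "C2_on S F \<longleftrightarrow> F differentiable_on S \<and> (\<forall>i. pd i F differentiable_on S)
     \<and> (\<forall>i j. continuous_on S (pd j (pd i F)))"

text \<open>Laplace-Beltrami operator of the round sphere: Euclidean Laplacian of
  the 0-homogeneous extension, evaluated on the sphere.\<close>
definition lap_sphere :: "(real^'m::finite \<Rightarrow> real) \<Rightarrow> real^'m \<Rightarrow> real" where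
  "lap_sphere u x = eucl_lap (hom0 u) x"

text \<open>Classical solution of  -Lap u = f(u) in the open hemisphere,
  du/dnu = b(u) on the equator (nu = outward normal = -e_e; the derivative
  along the meridian entering the hemisphere is -du/dnu).\<close>
definition is_solution ::
  "(real \<Rightarrow> real) \<Rightarrow> (real \<Rightarrow> real) \<Rightarrow> 'm::finite \<Rightarrow> (real^'m \<Rightarrow> real) \<Rightarrow> bool" where
  "is_solution f b e u \<longleftrightarrow>
     continuous_on (chemi e) u \<and>
     C2_on (cone_up e) (hom0 u) \<and>
     (\<forall>x\<in>hemi e. - lap_sphere u x = f (u x)) \<and>
     (\<forall>z\<in>equator e.
        ((\<lambda>\<theta>. u (cos \<theta> *\<^sub>R z + sin \<theta> *\<^sub>R axis e 1)) has_real_derivative (- b (u z)))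
          (at_right 0))"

end

theory Submission
  imports Defs
begin

text \<open>
  Let \<open>\<gamma> = (n - 2) / 2\<close> and extend \<open>u\<close> from the hemisphere to the half space as the function \<open>U\<close> that is
  homogeneous of degree \<open>-\<gamma>\<close>. Then the conformal Laplacian of the sphere becomes the Euclidean Laplacian of
  \<open>U\<close>, and conformal reflections of the sphere act linearly on the light cone, so that \<open>U\<close> composed with such
  a reflection solves an equation of the same form. The caps centred at an equatorial point \<open>p\<close> are
  enlarged from a point to a half sphere (moving spheres); the strict monotonicity of \<open>h\<^sub>1\<close> and Hopf's lemma
  on the equator exclude a first contact, barriers in narrow regions start and continue the process. In the limit
  \<open>u\<close> is symmetric under all reflections that fix the pole, which is the first claim.

  If the boundary term vanishes, the latitude profile of \<open>u\<close> solves an ordinary differential equation with a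
  Neumann condition. Its Pohozaev energy vanishes at the pole, is monotone where the profile lies on one side
  of a critical value, and at a critical point has the sign of \<open>f\<close>. Applied at a minimum and at a maximum this
  shows that both are attained at the pole.

  For the second part, \<open>U\<close> is superharmonic and the strong minimum principle and Hopf's lemma apply to \<open>U\<close> itself
  and to its difference with the harmonic function \<open>(|x| + x\<^sub>e)\<close> to the power \<open>-\<gamma>\<close>.
\<close>

section \<open>Laplacians at a point\<close>

text \<open>Two obstacles shape the development. Reflection of a cap point of the unit sphere only
  multiplies the argument of \<open>h\<close> by a factor at most 1, so monotonicity yields a linear
  bound exactly where \<open>U\<close> exceeds its reflection; and the energy of the profile
  differentiates an antiderivative of the nonlinearity, never \<open>f\<close> itself. Second,
  \<open>u\<close> is only continuous up to the equator, with one one-sided derivative along each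
  meridian. A reflection bends the normal line, so the normal derivative of the reflected function
  could involve tangential derivatives that need not exist. A comparison in small interior balls
  shows that a tangential displacement of order s^2 at height s changes \<open>U\<close> by o(s)
  only. The exponent -\<gamma> is the degree of homogeneity for which composition with a cap
  reflection preserves the Laplacian without any conformal weight. Working in the ambient space
  makes every comparison an ordinary Euclidean one: an inequality on the sphere spreads radially to
  a full neighbourhood.\<close>

definition twice_diff_at ::
  "('a::euclidean_space \<Rightarrow> real) \<Rightarrow> ('a \<Rightarrow> 'a) \<Rightarrow> ('a \<Rightarrow> 'a) \<Rightarrow> 'a \<Rightarrow> bool" where
  "twice_diff_at F G A x \<longleftrightarrow>
     (\<forall>\<^sub>F y in nhds x. (F has_derivative (\<lambda>h. G y \<bullet> h)) (at y)) \<and> (G has_derivative A) (at x)"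

text \<open>Only the gradient and the trace of the Hessian are recorded, because the product and
  chain rules for the Laplacian consume exactly these. The gradient field near \<open>x\<close>
  stays existential, so that witnesses never have to be matched when rules are combined.\<close>

definition lap_at :: "('a::euclidean_space \<Rightarrow> real) \<Rightarrow> 'a \<Rightarrow> 'a \<Rightarrow> real \<Rightarrow> bool" where
  "lap_at F x g L \<longleftrightarrow>
     (\<exists>G A. twice_diff_at F G A x \<and> G x = g \<and> (\<Sum>i\<in>Basis. A i \<bullet> i) = L)"

lemma lap_at_twice_diff:
  "twice_diff_at F G A x \<Longrightarrow> lap_at F x (G x) (\<Sum>i\<in>Basis. A i \<bullet> i)"
  unfolding lap_at_def by blast

lemma sum_Basis_inner_mult:
  fixes a b :: "'a::euclidean_space"
  shows "(\<Sum>i\<in>Basis. (a \<bullet> i) * (b \<bullet> i)) = a \<bullet> b"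
  by (simp add: euclidean_inner[symmetric])

lemma twice_diff_at_const: "twice_diff_at (\<lambda>x::'a::euclidean_space. c) (\<lambda>x. 0) (\<lambda>h. 0) x"
proof -
  have "(\<bullet>) (0::'a) = (\<lambda>h. 0)" by auto
  then show ?thesis unfolding twice_diff_at_def by (auto intro!: always_eventually)
qed

lemma lap_at_const: "lap_at (\<lambda>x. c) x 0 0"
  using lap_at_twice_diff[OF twice_diff_at_const, of c x] by simp

lemma lap_at_inner: "lap_at (\<lambda>x. x \<bullet> a) x a 0"
proof -
  have "twice_diff_at (\<lambda>x. x \<bullet> a) (\<lambda>x. a) (\<lambda>h. 0) x"
    unfolding twice_diff_at_def
    by (auto intro!: always_eventually derivative_eq_intros simp: inner_commute)
  from lap_at_twice_diff[OF this] show ?thesis by simp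
qed

lemma lap_at_dist2:
  fixes a x :: "'a::euclidean_space"
  shows "lap_at (\<lambda>x. (x - a) \<bullet> (x - a)) x (2 *\<^sub>R (x - a)) (2 * real DIM('a))"
proof -
  have "twice_diff_at (\<lambda>x. (x - a) \<bullet> (x - a)) (\<lambda>x. 2 *\<^sub>R (x - a)) (\<lambda>h. 2 *\<^sub>R h) x"
    unfolding twice_diff_at_def
    by (auto intro!: always_eventually derivative_eq_intros simp: inner_commute algebra_simps)
  from lap_at_twice_diff[OF this] show ?thesis by (simp add: mult.commute)
qed

lemma lap_at_add:
  assumes "lap_at F x g L" "lap_at F' x g' L'"
  shows "lap_at (\<lambda>x. F x + F' x) x (g + g') (L + L')"
proof -
  obtain G A where 1: "twice_diff_at F G A x" "G x = g" "(\<Sum>i\<in>Basis. A i \<bullet> i) = L"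
    using assms(1) unfolding lap_at_def by blast
  obtain G' A' where 2: "twice_diff_at F' G' A' x" "G' x = g'" "(\<Sum>i\<in>Basis. A' i \<bullet> i) = L'"
    using assms(2) unfolding lap_at_def by blast
  have "twice_diff_at (\<lambda>x. F x + F' x) (\<lambda>x. G x + G' x) (\<lambda>h. A h + A' h) x"
    unfolding twice_diff_at_def
  proof
    show "\<forall>\<^sub>F y in nhds x. ((\<lambda>x. F x + F' x) has_derivative (\<lambda>h. (G y + G' y) \<bullet> h)) (at y)"
      using 1(1)[unfolded twice_diff_at_def, THEN conjunct1] 2(1)[unfolded twice_diff_at_def, THEN conjunct1]
      by eventually_elim (auto intro!: derivative_eq_intros simp: inner_add_left)
    show "((\<lambda>x. G x + G' x) has_derivative (\<lambda>h. A h + A' h)) (at x)"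
      using 1(1) 2(1) unfolding twice_diff_at_def by (auto intro!: derivative_eq_intros)
  qed
  from lap_at_twice_diff[OF this] show ?thesis
    by (simp add: inner_add_left sum.distrib 1(2,3) 2(2,3))
qed

lemma lap_at_mult:
  assumes "lap_at F x g L" "lap_at F' x g' L'"
  shows "lap_at (\<lambda>x. F x * F' x) x (F x *\<^sub>R g' + F' x *\<^sub>R g) (F x * L' + 2 * (g \<bullet> g') + F' x * L)"
proof -
  obtain G A where 1: "twice_diff_at F G A x" "G x = g" "(\<Sum>i\<in>Basis. A i \<bullet> i) = L"
    using assms(1) unfolding lap_at_def by blast
  obtain G' A' where 2: "twice_diff_at F' G' A' x" "G' x = g'" "(\<Sum>i\<in>Basis. A' i \<bullet> i) = L'"
    using assms(2) unfolding lap_at_def by blast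
  have d: "(F has_derivative (\<lambda>h. g \<bullet> h)) (at x)" "(F' has_derivative (\<lambda>h. g' \<bullet> h)) (at x)"
    using 1(1,2) 2(1,2) unfolding twice_diff_at_def by (auto dest: eventually_nhds_x_imp_x)
  have "twice_diff_at (\<lambda>x. F x * F' x) (\<lambda>x. F x *\<^sub>R G' x + F' x *\<^sub>R G x)
     (\<lambda>h. F x *\<^sub>R A' h + (g \<bullet> h) *\<^sub>R g' + (F' x *\<^sub>R A h + (g' \<bullet> h) *\<^sub>R g)) x"
    unfolding twice_diff_at_def
  proof
    show "\<forall>\<^sub>F y in nhds x. ((\<lambda>x. F x * F' x) has_derivative
            (\<lambda>h. (F y *\<^sub>R G' y + F' y *\<^sub>R G y) \<bullet> h)) (at y)"
      using 1(1)[unfolded twice_diff_at_def, THEN conjunct1] 2(1)[unfolded twice_diff_at_def, THEN conjunct1]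
      by eventually_elim (auto intro!: derivative_eq_intros simp: algebra_simps)
    show "((\<lambda>x. F x *\<^sub>R G' x + F' x *\<^sub>R G x) has_derivative
        (\<lambda>h. F x *\<^sub>R A' h + (g \<bullet> h) *\<^sub>R g' + (F' x *\<^sub>R A h + (g' \<bullet> h) *\<^sub>R g))) (at x)"
      using 1 2 d unfolding twice_diff_at_def
      by (auto intro!: derivative_eq_intros)
  qed
  from lap_at_twice_diff[OF this] show ?thesis
    by (simp add: inner_add_left sum.distrib 1(2,3) 2(2,3) sum_Basis_inner_mult
       inner_commute[of g' g] sum_distrib_left[symmetric] add_ac)
qed

lemma lap_at_cmult:
  assumes "lap_at F x g L"
  shows "lap_at (\<lambda>x. c * F x) x (c *\<^sub>R g) (c * L)"
  using lap_at_mult[OF lap_at_const[of c] assms] by simp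

lemma lap_at_uminus:
  assumes "lap_at F x g L"
  shows "lap_at (\<lambda>x. - F x) x (- g) (- L)"
  using lap_at_cmult[OF assms, of "-1"] by simp

lemma lap_at_diff:
  assumes "lap_at F x g L" "lap_at F' x g' L'"
  shows "lap_at (\<lambda>x. F x - F' x) x (g - g') (L - L')"
  using lap_at_add[OF assms(1) lap_at_uminus[OF assms(2)]] by simp

lemma lap_at_compose:
  assumes "lap_at F x g L"
    and \<phi>: "\<forall>\<^sub>F s in nhds (F x). (\<phi> has_real_derivative \<phi>' s) (at s)"
    and \<phi>': "(\<phi>' has_real_derivative \<phi>'') (at (F x))"
  shows "lap_at (\<lambda>x. \<phi> (F x)) x (\<phi>' (F x) *\<^sub>R g) (\<phi>'' * (g \<bullet> g) + \<phi>' (F x) * L)"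
proof -
  obtain G A where 1: "twice_diff_at F G A x" "G x = g" "(\<Sum>i\<in>Basis. A i \<bullet> i) = L"
    using assms(1) unfolding lap_at_def by blast
  have d: "(F has_derivative (\<lambda>h. g \<bullet> h)) (at x)"
    using 1(1,2) unfolding twice_diff_at_def by (auto dest: eventually_nhds_x_imp_x)
  have "isCont F x" using d has_derivative_continuous by blast
  then have "filterlim F (nhds (F x)) (nhds x)"
    by (simp add: isCont_def tendsto_nhds_iff)
  then have ev: "\<forall>\<^sub>F y in nhds x. (\<phi> has_real_derivative \<phi>' (F y)) (at (F y))"
    using \<phi> unfolding filterlim_iff by blast
  have d2: "((\<lambda>x. \<phi>' (F x)) has_derivative (\<lambda>h. (g \<bullet> h) * \<phi>'')) (at x)"
    using \<phi>' d by (rule DERIV_compose_FDERIV)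
  have "twice_diff_at (\<lambda>x. \<phi> (F x)) (\<lambda>x. \<phi>' (F x) *\<^sub>R G x)
     (\<lambda>h. \<phi>' (F x) *\<^sub>R A h + ((g \<bullet> h) * \<phi>'') *\<^sub>R g) x"
    unfolding twice_diff_at_def
  proof
    have "\<forall>\<^sub>F y in nhds x. (F has_derivative (\<lambda>h. G y \<bullet> h)) (at y)"
      using 1 unfolding twice_diff_at_def by blast
    then show "\<forall>\<^sub>F y in nhds x. ((\<lambda>x. \<phi> (F x)) has_derivative
            (\<lambda>h. (\<phi>' (F y) *\<^sub>R G y) \<bullet> h)) (at y)"
      using ev
    proof eventually_elim
      case (elim y)
      show ?case using DERIV_compose_FDERIV[OF elim(2,1)] by (simp add: mult.commute)
    qed
    show "((\<lambda>x. \<phi>' (F x) *\<^sub>R G x) has_derivative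
        (\<lambda>h. \<phi>' (F x) *\<^sub>R A h + ((g \<bullet> h) * \<phi>'') *\<^sub>R g)) (at x)"
      using 1 d2 unfolding twice_diff_at_def
      by (auto intro!: derivative_eq_intros)
  qed
  from lap_at_twice_diff[OF this] show ?thesis
    by (simp add: inner_add_left sum.distrib 1(2,3) sum_Basis_inner_mult
       sum_distrib_left[symmetric] mult.commute[of _ \<phi>''] mult.assoc add.commute)
qed

lemma lap_at_cong:
  assumes "lap_at F x g L" "\<forall>\<^sub>F y in nhds x. F' y = F y"
  shows "lap_at F' x g L"
proof -
  obtain G A where 1: "twice_diff_at F G A x" "G x = g" "(\<Sum>i\<in>Basis. A i \<bullet> i) = L"
    using assms(1) unfolding lap_at_def by blast
  have "\<forall>\<^sub>F y in nhds x. (F' has_derivative (\<lambda>h. G y \<bullet> h)) (at y)"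
    using 1(1)[unfolded twice_diff_at_def, THEN conjunct1]
      eventually_eventually[THEN iffD2, OF assms(2)]
  proof eventually_elim
    case (elim y)
    from elim(2) have "F' y = F y" by (rule eventually_nhds_x_imp_x)
    with elim show ?case
      by (intro has_derivative_transform_eventually[OF elim(1), of F'])
         (auto simp: eventually_at_filter elim: eventually_mono)
  qed
  then have "twice_diff_at F' G A x" using 1 unfolding twice_diff_at_def by blast
  then show ?thesis using 1(2,3) unfolding lap_at_def by blast
qed

lemma lap_at_isCont: "lap_at F x g L \<Longrightarrow> isCont F x"
  unfolding lap_at_def twice_diff_at_def
  using eventually_nhds_x_imp_x has_derivative_continuous by blast

text \<open>If \<open>c\<close> were positive, \<open>g'\<close> would be positive just to the right
  of the critical point 0, and the mean value theorem would lift \<open>g\<close> above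
  \<open>g 0\<close>.\<close>

lemma second_derivative_nonpos:
  fixes g g' :: "real \<Rightarrow> real"
  assumes d1: "\<forall>\<^sub>F t in nhds 0. (g has_real_derivative g' t) (at t)"
    and d2: "(g' has_real_derivative c) (at 0)"
    and max: "\<forall>\<^sub>F t in nhds 0. g t \<le> g 0"
  shows "c \<le> 0"
proof (rule ccontr)
  assume "\<not> c \<le> 0"
  then have c: "c > 0" by simp
  obtain r1 where r1: "r1 > 0" "\<And>t. \<bar>t\<bar> < r1 \<Longrightarrow> (g has_real_derivative g' t) (at t) \<and> g t \<le> g 0"
    using eventually_conj[OF d1 max] unfolding eventually_nhds_metric dist_real_def by auto
  have g0: "g' 0 = 0"
    using DERIV_local_max[of g "g' 0" 0 r1] r1 by auto
  obtain r2 where r2: "r2 > 0" "\<And>t. 0 < t \<Longrightarrow> t < r2 \<Longrightarrow> g' 0 < g' (0 + t)"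
    using DERIV_pos_inc_right[OF d2 c] by auto
  define t where "t = min r1 r2 / 2"
  have t: "0 < t" "t < r1" "t < r2" using r1(1) r2(1) unfolding t_def by auto
  have "\<exists>z. z > 0 \<and> z < t \<and> g t - g 0 = (t - 0) * g' z"
    by (rule MVT2[OF t(1)]) (use r1 t in auto)
  then obtain z where z: "0 < z" "z < t" "g t - g 0 = t * g' z" by auto
  have "g' z > 0" using r2(2)[of z] z t g0 by auto
  then have "g t > g 0" using z t by (smt (verit) mult_pos_pos)
  then show False using r1(2)[of t] t by auto
qed

text \<open>At a maximum the second derivative along every coordinate line is nonpositive. The
  comparison arguments below all rest on this pointwise form of the maximum principle.\<close>

lemma lap_at_local_max:
  assumes "lap_at F x g L" "\<forall>\<^sub>F y in nhds x. F y \<le> F x"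
  shows "L \<le> 0"
proof -
  obtain G A where 1: "twice_diff_at F G A x" "G x = g" "(\<Sum>i\<in>Basis. A i \<bullet> i) = L"
    using assms(1) unfolding lap_at_def by blast
  have "A i \<bullet> i \<le> 0" for i
  proof (rule second_derivative_nonpos)
    let ?l = "\<lambda>t. x + t *\<^sub>R i"
    have lim: "filterlim ?l (nhds x) (nhds 0)"
    proof -
      have "isCont ?l 0" by (intro continuous_intros)
      then show ?thesis by (simp add: isCont_def tendsto_nhds_iff)
    qed
    have "\<forall>\<^sub>F t in nhds 0. (F has_derivative (\<lambda>h. G (?l t) \<bullet> h)) (at (?l t))"
      using 1(1) lim unfolding twice_diff_at_def filterlim_iff by auto
    then show "\<forall>\<^sub>F t in nhds 0. ((\<lambda>t. F (?l t)) has_real_derivative G (?l t) \<bullet> i) (at t)"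
    proof eventually_elim
      case (elim t)
      have "(?l has_derivative (\<lambda>h. h *\<^sub>R i)) (at t)" by (auto intro!: derivative_eq_intros)
      from has_derivative_compose[OF this elim] show ?case
        by (rule has_derivative_imp_has_field_derivative) simp
    qed
    have "(?l has_derivative (\<lambda>h. h *\<^sub>R i)) (at 0)" by (auto intro!: derivative_eq_intros)
    moreover have "(G has_derivative A) (at (?l 0))" using 1(1) unfolding twice_diff_at_def by simp
    ultimately have "((\<lambda>t. G (?l t)) has_derivative (\<lambda>h. A (h *\<^sub>R i))) (at 0)"
      by (rule has_derivative_compose)
    then have "((\<lambda>t. G (?l t) \<bullet> i) has_derivative (\<lambda>h. A (h *\<^sub>R i) \<bullet> i)) (at 0)"
      by (auto intro!: derivative_eq_intros)
    moreover have "linear A" using 1(1) unfolding twice_diff_at_def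
      by (auto dest: has_derivative_linear)
    ultimately show "((\<lambda>t. G (?l t) \<bullet> i) has_real_derivative A i \<bullet> i) (at 0)"
      by (intro has_derivative_imp_has_field_derivative) (auto simp: linear_cmul)
    show "\<forall>\<^sub>F t in nhds 0. F (?l t) \<le> F (?l 0)"
      using assms(2) lim unfolding filterlim_iff by auto
  qed
  then show ?thesis using 1(3) sum_nonpos[of Basis "\<lambda>i. A i \<bullet> i"] by auto
qed

text \<open>Euclidean reflections and cap reflections both displace points along a fixed direction
  \<open>p\<close> by a scalar amount, so one chain rule serves both. The two mixed terms
  \<open>A v \<bullet> p\<close> and \<open>A p \<bullet> v\<close> stay separate because symmetry
  of the Hessian is never established.\<close>

lemma lap_at_shift_along:
  fixes p x :: "'a::euclidean_space"
  assumes lap_l: "lap_at l x v L" and U: "twice_diff_at U G A (x + l x *\<^sub>R p)"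
  shows "lap_at (\<lambda>x. U (x + l x *\<^sub>R p)) x
     (G (x + l x *\<^sub>R p) + (G (x + l x *\<^sub>R p) \<bullet> p) *\<^sub>R v)
     ((\<Sum>i\<in>Basis. A i \<bullet> i) + A v \<bullet> p + A p \<bullet> v + (v \<bullet> v) * (A p \<bullet> p) + L * (G (x + l x *\<^sub>R p) \<bullet> p))"
proof -
  obtain g B where 1: "twice_diff_at l g B x" "g x = v" "(\<Sum>i\<in>Basis. B i \<bullet> i) = L"
    using lap_l unfolding lap_at_def by blast
  let ?X = "\<lambda>x. x + l x *\<^sub>R p"
  let ?W = "\<lambda>x. G (?X x) + (G (?X x) \<bullet> p) *\<^sub>R g x"
  have dl: "(l has_derivative (\<lambda>h. v \<bullet> h)) (at x)"
    using 1(1,2) unfolding twice_diff_at_def by (auto dest: eventually_nhds_x_imp_x)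
  have dX: "(?X has_derivative (\<lambda>h. h + (g y \<bullet> h) *\<^sub>R p)) (at y)"
    if "(l has_derivative (\<lambda>h. g y \<bullet> h)) (at y)" for y
    using that by (auto intro!: derivative_eq_intros)
  have dXx: "(?X has_derivative (\<lambda>h. h + (v \<bullet> h) *\<^sub>R p)) (at x)"
    using dX[of x] dl 1(2) by simp
  have "isCont ?X x" using dXx has_derivative_continuous by blast
  then have lim: "filterlim ?X (nhds (?X x)) (nhds x)"
    by (simp add: isCont_def tendsto_nhds_iff)
  have linA: "linear A" using U unfolding twice_diff_at_def by (auto dest: has_derivative_linear)
  have dG: "((\<lambda>x. G (?X x)) has_derivative (\<lambda>h. A (h + (v \<bullet> h) *\<^sub>R p))) (at x)"
    using has_derivative_compose[OF dXx] U unfolding twice_diff_at_def by blast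
  have dg: "(g has_derivative B) (at x)" using 1 unfolding twice_diff_at_def by blast
  have "twice_diff_at (\<lambda>x. U (?X x)) ?W
     (\<lambda>h. A (h + (v \<bullet> h) *\<^sub>R p) + ((G (?X x) \<bullet> p) *\<^sub>R B h + (A (h + (v \<bullet> h) *\<^sub>R p) \<bullet> p) *\<^sub>R v)) x"
    unfolding twice_diff_at_def
  proof
    have "\<forall>\<^sub>F y in nhds x. (U has_derivative (\<lambda>h. G (?X y) \<bullet> h)) (at (?X y))"
      using U lim unfolding twice_diff_at_def filterlim_iff by auto
    moreover have "\<forall>\<^sub>F y in nhds x. (l has_derivative (\<lambda>h. g y \<bullet> h)) (at y)"
      using 1 unfolding twice_diff_at_def by blast
    ultimately show "\<forall>\<^sub>F y in nhds x. ((\<lambda>x. U (?X x)) has_derivative (\<lambda>h. ?W y \<bullet> h)) (at y)"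
    proof eventually_elim
      case (elim y)
      show ?case using has_derivative_compose[OF dX[OF elim(2)] elim(1)]
        by (simp add: inner_add_right inner_add_left mult.commute)
    qed
    show "(?W has_derivative (\<lambda>h. A (h + (v \<bullet> h) *\<^sub>R p) +
        ((G (?X x) \<bullet> p) *\<^sub>R B h + (A (h + (v \<bullet> h) *\<^sub>R p) \<bullet> p) *\<^sub>R v))) (at x)"
      using dG dg 1(2) by (auto intro!: derivative_eq_intros)
  qed
  from lap_at_twice_diff[OF this] have lap: "lap_at (\<lambda>x. U (?X x)) x (?W x)
    (\<Sum>i\<in>Basis. (A (i + (v \<bullet> i) *\<^sub>R p) + ((G (?X x) \<bullet> p) *\<^sub>R B i + (A (i + (v \<bullet> i) *\<^sub>R p) \<bullet> p) *\<^sub>R v)) \<bullet> i)" .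
  have expand: "(A (i + (v \<bullet> i) *\<^sub>R p) + ((G (?X x) \<bullet> p) *\<^sub>R B i + (A (i + (v \<bullet> i) *\<^sub>R p) \<bullet> p) *\<^sub>R v)) \<bullet> i
     = A i \<bullet> i + (v \<bullet> i) * (A p \<bullet> i) + (G (?X x) \<bullet> p) * (B i \<bullet> i) + (v \<bullet> i) * (A i \<bullet> p)
       + (A p \<bullet> p) * ((v \<bullet> i) * (v \<bullet> i))" for i
    by (simp add: linear_add[OF linA] linear_cmul[OF linA] inner_add_left algebra_simps)
  have Av: "(\<Sum>i\<in>Basis. (v \<bullet> i) * (A i \<bullet> p)) = A v \<bullet> p"
  proof -
    have "A v = A (\<Sum>i\<in>Basis. (v \<bullet> i) *\<^sub>R i)" by (simp add: euclidean_representation)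
    also have "\<dots> = (\<Sum>i\<in>Basis. (v \<bullet> i) *\<^sub>R A i)"
      by (simp add: linear_sum[OF linA] linear_cmul[OF linA])
    finally show ?thesis by (simp add: inner_sum_left)
  qed
  show ?thesis
    using lap unfolding expand sum.distrib sum_Basis_inner_mult Av sum_distrib_left[symmetric] 1(2,3)
    by (simp add: inner_commute[of v "A p"] algebra_simps)
qed

section \<open>Hopf lemma and strong minimum principle\<close>

definition superharmonic_on :: "('a::euclidean_space) set \<Rightarrow> ('a \<Rightarrow> real) \<Rightarrow> bool" where
  "superharmonic_on S Q \<longleftrightarrow> (\<forall>x\<in>S. \<exists>g L. lap_at Q x g L \<and> L \<le> 0)"

lemma superharmonic_on_subset:
  "superharmonic_on S Q \<Longrightarrow> T \<subseteq> S \<Longrightarrow> superharmonic_on T Q"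
  unfolding superharmonic_on_def by blast

lemma superharmonic_on_continuous: "superharmonic_on S Q \<Longrightarrow> continuous_on S Q"
  unfolding superharmonic_on_def
  by (meson continuous_at_imp_continuous_on lap_at_isCont)

lemma lap_at_gaussian:
  fixes a x :: "'a::euclidean_space"
  shows "lap_at (\<lambda>x. exp (- k * ((x - a) \<bullet> (x - a)))) x
     ((- k * exp (- k * ((x - a) \<bullet> (x - a)))) *\<^sub>R (2 *\<^sub>R (x - a)))
     (exp (- k * ((x - a) \<bullet> (x - a))) * (4 * k\<^sup>2 * ((x - a) \<bullet> (x - a)) - 2 * k * real DIM('a)))"
proof -
  have "lap_at (\<lambda>x. exp (- k * ((x - a) \<bullet> (x - a)))) x
     ((- k * exp (- k * ((x - a) \<bullet> (x - a)))) *\<^sub>R (2 *\<^sub>R (x - a)))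
     ((- k * (- k * exp (- k * ((x - a) \<bullet> (x - a))))) * ((2 *\<^sub>R (x - a)) \<bullet> (2 *\<^sub>R (x - a)))
       + (- k * exp (- k * ((x - a) \<bullet> (x - a)))) * (2 * real DIM('a)))"
    by (rule lap_at_compose[OF lap_at_dist2, where \<phi> = "\<lambda>s. exp (- k * s)"])
       (auto intro!: always_eventually derivative_eq_intros)
  then show ?thesis by (simp add: algebra_simps power2_eq_square)
qed

text \<open>This is Hopf's barrier: a Gaussian normalised to vanish on the outer sphere, strictly
  subharmonic outside the inner ball, and scaled to lie below \<open>Q\<close> on the inner
  sphere.\<close>

lemma annulus_barrier:
  fixes a :: "'a::euclidean_space"
  assumes r: "0 < r" "r < R"
    and cont: "continuous_on (cball a R) Q"
    and nonneg: "\<And>x. x \<in> cball a R \<Longrightarrow> 0 \<le> Q x"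
    and super: "superharmonic_on (ball a R) Q"
    and pos: "\<And>x. x \<in> cball a r \<Longrightarrow> 0 < Q x"
  obtains c k where "c > 0" "k > 0"
    "\<And>x. x \<in> cball a R \<Longrightarrow> x \<notin> ball a r \<Longrightarrow>
       c * (exp (- k * ((x - a) \<bullet> (x - a))) - exp (- k * R\<^sup>2)) \<le> Q x"
proof -
  \<comment> \<open>The Laplacian of the Gaussian has the sign of
    \<open>2 * k * \<bar>x - a\<bar>^2 - DIM('a)\<close>. This choice gives
    \<open>k * \<bar>x - a\<bar>^2 > DIM('a)\<close> outside the inner ball.\<close>
  define k where "k = real DIM('a) / r\<^sup>2"
  have k: "k > 0" using r by (simp add: k_def)
  have "\<exists>y\<in>cball a r. \<forall>x\<in>cball a r. Q y \<le> Q x"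
    by (rule continuous_attains_inf) (use r in \<open>auto intro: continuous_on_subset[OF cont]\<close>)
  then obtain y where y: "y \<in> cball a r" "\<And>x. x \<in> cball a r \<Longrightarrow> Q y \<le> Q x" by blast
  define c where "c = Q y"
  have c: "c > 0" using pos y unfolding c_def by blast
  define \<Gamma> where "\<Gamma> = (\<lambda>x. exp (- k * ((x - a) \<bullet> (x - a))) - exp (- k * R\<^sup>2))"
  have sq: "(x - a) \<bullet> (x - a) = (dist a x)\<^sup>2" for x
    by (simp add: dist_norm norm_minus_commute power2_norm_eq_inner[symmetric])
  have \<Gamma>1: "\<Gamma> x \<le> 1" for x
  proof -
    have "exp (- k * ((x - a) \<bullet> (x - a))) \<le> 1" using k by simp
    then show ?thesis unfolding \<Gamma>_def by (smt (verit) exp_ge_zero)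
  qed
  let ?N = "cball a R - ball a r"
  \<comment> \<open>A negative minimum of \<open>Q - c * \<Gamma>\<close> cannot lie on the inner
    sphere, where \<open>Q \<ge> c \<ge> c * \<Gamma>\<close>, nor on the outer one, where
    \<open>\<Gamma> = 0\<close>. In between, strict subharmonicity of \<open>\<Gamma>\<close>
    excludes it.\<close>
  have "\<exists>y\<in>?N. \<forall>x\<in>?N. Q y - c * \<Gamma> y \<le> Q x - c * \<Gamma> x"
  proof (rule continuous_attains_inf)
    show "compact ?N" by (intro compact_diff) auto
    obtain b :: 'a where "norm b = r" using vector_choose_size[of r] r by auto
    then have "a + b \<in> ?N" using r by (auto simp: dist_norm)
    then show "?N \<noteq> {}" by blast
    show "continuous_on ?N (\<lambda>x. Q x - c * \<Gamma> x)" unfolding \<Gamma>_def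
      by (intro continuous_intros continuous_on_subset[OF cont]) auto
  qed
  then obtain x0 where x0: "x0 \<in> ?N" "\<And>x. x \<in> ?N \<Longrightarrow> Q x0 - c * \<Gamma> x0 \<le> Q x - c * \<Gamma> x"
    by blast
  have "Q x0 - c * \<Gamma> x0 \<ge> 0"
  proof (rule ccontr)
    assume neg: "\<not> ?thesis"
    have "dist a x0 \<noteq> r"
    proof
      assume "dist a x0 = r"
      then have "Q x0 \<ge> c" using y unfolding c_def by auto
      then show False using neg \<Gamma>1[of x0] c
        by (smt (verit) mult_left_le)
    qed
    moreover have "dist a x0 \<noteq> R"
    proof
      assume "dist a x0 = R"
      then have "\<Gamma> x0 = 0" unfolding \<Gamma>_def sq by simp
      then show False using neg nonneg x0(1) by auto
    qed
    ultimately have d: "r < dist a x0" "dist a x0 < R" using x0(1) by auto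
    let ?q = "(x0 - a) \<bullet> (x0 - a)"
    have lapG: "lap_at \<Gamma> x0 ((- k * exp (- k * ?q)) *\<^sub>R (2 *\<^sub>R (x0 - a)) - 0)
       (exp (- k * ?q) * (4 * k\<^sup>2 * ?q - 2 * k * real DIM('a)) - 0)"
      unfolding \<Gamma>_def by (intro lap_at_diff lap_at_gaussian lap_at_const)
    obtain g L where Q: "lap_at Q x0 g L" "L \<le> 0"
      using super d unfolding superharmonic_on_def by (metis mem_ball)
    note lap = lap_at_diff[OF lap_at_cmult[OF lapG, of c] Q(1)]
    have "open (ball a R - cball a r)" by auto
    moreover have "x0 \<in> ball a R - cball a r" using d by auto
    ultimately have "\<forall>\<^sub>F x in nhds x0. x \<in> ball a R - cball a r"
      by (rule eventually_nhds_in_open)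
    then have "\<forall>\<^sub>F x in nhds x0. c * \<Gamma> x - Q x \<le> c * \<Gamma> x0 - Q x0"
    proof eventually_elim
      case (elim x)
      then show ?case using x0(2)[of x] by force
    qed
    from lap_at_local_max[OF lap this]
    have "c * (exp (- k * ?q) * (4 * k\<^sup>2 * ?q - 2 * k * real DIM('a))) \<le> 0" using Q(2) by simp
    moreover have "real DIM('a) < k * ?q"
    proof -
      have "r\<^sup>2 < ?q" unfolding sq using d r by (simp add: power_strict_mono)
      then have "k * r\<^sup>2 < k * ?q" using k by simp
      then show ?thesis using r by (simp add: k_def)
    qed
    then have "4 * k\<^sup>2 * ?q - 2 * k * real DIM('a) > 0"
    proof -
      assume "real DIM('a) < k * ?q"
      then have "k * (2 * real DIM('a)) < k * (4 * (k * ?q))" using k 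
        by (intro mult_strict_left_mono) auto
      then show ?thesis by (simp add: power2_eq_square algebra_simps)
    qed
    ultimately show False using c
      by (meson exp_gt_zero leD mult_pos_pos)
  qed
  then show ?thesis
    using that[OF c k] x0(2) unfolding \<Gamma>_def by force
qed

text \<open>The ball touches the bounding hyperplane from inside at \<open>z\<close>. It avoids the
  origin, where homogeneous functions are singular, because its centre has squared norm
  \<bar>z\<bar>^2 + R^2.\<close>

lemma tangent_ball:
  fixes e z :: "'a::euclidean_space"
  assumes e: "norm e = 1" and z: "z \<bullet> e = 0" and R: "R > 0"
  shows "x \<in> ball (z + R *\<^sub>R e) R \<Longrightarrow> 0 < x \<bullet> e"
    and "x \<in> cball (z + R *\<^sub>R e) R \<Longrightarrow> 0 \<le> x \<bullet> e"
    and "x \<in> cball (z + R *\<^sub>R e) R \<Longrightarrow> z \<noteq> 0 \<Longrightarrow> x \<noteq> 0"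
proof -
  have ee: "e \<bullet> e = 1" using e by (simp add: norm_eq_1)
  have "\<bar>x \<bullet> e - R\<bar> \<le> norm (x - (z + R *\<^sub>R e))"
    using Cauchy_Schwarz_ineq2[of "x - (z + R *\<^sub>R e)" e] z ee e
    by (simp add: inner_diff_left inner_add_left)
  then show "x \<in> ball (z + R *\<^sub>R e) R \<Longrightarrow> 0 < x \<bullet> e" "x \<in> cball (z + R *\<^sub>R e) R \<Longrightarrow> 0 \<le> x \<bullet> e"
    by (auto simp: dist_norm norm_minus_commute abs_le_iff)
  show "x \<noteq> 0" if "x \<in> cball (z + R *\<^sub>R e) R" "z \<noteq> 0"
  proof
    assume "x = 0"
    then have "(norm (z + R *\<^sub>R e))\<^sup>2 \<le> R\<^sup>2" using that(1) R by (intro power_mono) auto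
    moreover have "(norm (z + R *\<^sub>R e))\<^sup>2 = z \<bullet> z + R\<^sup>2"
      unfolding power2_norm_eq_inner using z ee
      by (simp add: inner_add_left inner_add_right inner_commute[of e z] power2_eq_square)
    ultimately show False using that(2) by (simp add: inner_gt_zero_iff[symmetric] del: inner_gt_zero_iff)
  qed
qed

text \<open>Near \<open>z\<close> the function \<open>Q\<close> dominates a barrier that also
  vanishes at \<open>z\<close> and has slope \<open>2 * c * k * R * exp (- k * R\<^sup>2)\<close> in
  direction \<open>e\<close>. The difference quotients of \<open>Q\<close> along this one line
  inherit the bound.\<close>

lemma hopf_boundary_derivative:
  fixes e z :: "'a::euclidean_space"
  assumes e: "norm e = 1" and R: "R > 0"
    and cont: "continuous_on (cball (z + R *\<^sub>R e) R) Q"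
    and super: "superharmonic_on (ball (z + R *\<^sub>R e) R) Q"
    and pos: "\<And>x. x \<in> ball (z + R *\<^sub>R e) R \<Longrightarrow> 0 < Q x"
    and Qz: "Q z = 0"
    and der: "((\<lambda>s. Q (z + s *\<^sub>R e)) has_real_derivative d) (at_right 0)"
  shows "d > 0"
proof -
  let ?a = "z + R *\<^sub>R e"
  have nonneg: "0 \<le> Q x" if "x \<in> cball ?a R" for x
  proof (rule continuous_ge_on_closure[of "ball ?a R" Q x 0])
    show "continuous_on (closure (ball ?a R)) Q" using cont R by simp
    show "x \<in> closure (ball ?a R)" using that R by simp
    show "0 \<le> Q y" if "y \<in> ball ?a R" for y using pos[OF that] by simp
  qed
  obtain c k where ck: "c > 0" "k > 0"
    "\<And>x. x \<in> cball ?a R \<Longrightarrow> x \<notin> ball ?a (R/2) \<Longrightarrow>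
       c * (exp (- k * ((x - ?a) \<bullet> (x - ?a))) - exp (- k * R\<^sup>2)) \<le> Q x"
    by (rule annulus_barrier[of "R/2" R ?a Q]) (use R cont nonneg super pos in auto)
  define \<Gamma> where "\<Gamma> = (\<lambda>s. c * (exp (- k * (R - s)\<^sup>2) - exp (- k * R\<^sup>2)))"
  have ee: "e \<bullet> e = 1" using e by (simp add: norm_eq_1)
  have low: "\<Gamma> s \<le> Q (z + s *\<^sub>R e)" if s: "0 \<le> s" "s \<le> R/2" for s
  proof -
    have eq: "z + s *\<^sub>R e - ?a = (s - R) *\<^sub>R e" by (simp add: algebra_simps)
    have "dist ?a (z + s *\<^sub>R e) = R - s"
      using s R e eq by (metis abs_minus_commute abs_of_nonneg diff_ge_0_iff_ge dist_commute
         dist_norm field_sum_of_halves mult.right_neutral norm_scaleR order_trans le_add_same_cancel1 less_eq_real_def half_gt_zero)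
    then have "z + s *\<^sub>R e \<in> cball ?a R" "z + s *\<^sub>R e \<notin> ball ?a (R/2)" using s by auto
    from ck(3)[OF this] show ?thesis unfolding \<Gamma>_def eq
      by (simp add: ee power2_eq_square[symmetric] power2_commute)
  qed
  have dG: "(\<Gamma> has_real_derivative c * (exp (- k * R\<^sup>2) * (2 * k * R))) (at_right 0)"
    unfolding \<Gamma>_def by (auto intro!: derivative_eq_intros)
  have "((\<lambda>s. Q (z + s *\<^sub>R e) - \<Gamma> s) has_real_derivative
           d - c * (exp (- k * R\<^sup>2) * (2 * k * R))) (at_right 0)"
    by (intro derivative_intros der dG)
  then have lim: "((\<lambda>s. (Q (z + s *\<^sub>R e) - \<Gamma> s) / s) \<longlongrightarrow> d - c * (exp (- k * R\<^sup>2) * (2 * k * R))) (at_right 0)"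
    unfolding has_field_derivative_iff by (simp add: Qz \<Gamma>_def)
  have "\<forall>\<^sub>F s in at_right 0. 0 \<le> (Q (z + s *\<^sub>R e) - \<Gamma> s) / s"
    using eventually_at_right_real[of 0 "R/2"] R low by (auto elim!: eventually_mono)
  from tendsto_lowerbound[OF lim this]
  have "d \<ge> c * (exp (- k * R\<^sup>2) * (2 * k * R))" by simp
  moreover have "c * (exp (- k * R\<^sup>2) * (2 * k * R)) > 0" using ck R by simp
  ultimately show ?thesis by linarith
qed

text \<open>The positivity set is open by continuity and the zero set is open by the barrier; the
  half space is connected, so one of them is empty.\<close>

lemma strong_minimum_principle_halfspace:
  fixes e :: "'a::euclidean_space"
  assumes e: "norm e = 1"
    and super: "superharmonic_on {x. 0 < x \<bullet> e} Q"
    and nonneg: "\<And>x. 0 < x \<bullet> e \<Longrightarrow> 0 \<le> Q x"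
  shows "(\<forall>x. 0 < x \<bullet> e \<longrightarrow> Q x = 0) \<or> (\<forall>x. 0 < x \<bullet> e \<longrightarrow> 0 < Q x)"
proof -
  let ?H = "{x. 0 < x \<bullet> e}"
  have openH: "open ?H" using open_halfspace_gt[of 0 e] by (simp add: inner_commute)
  have cont: "continuous_on ?H Q" by (rule superharmonic_on_continuous[OF super])
  let ?P = "?H \<inter> Q -` {0<..}" and ?Z = "?H \<inter> Q -` {0}"
  have openP: "open ?P" using continuous_open_preimage[OF cont openH] by auto
  have sub: "\<bar>x \<bullet> e - y \<bullet> e\<bar> \<le> dist x y" for x y
    using Cauchy_Schwarz_ineq2[of "x - y" e] e by (simp add: inner_diff_left dist_norm)
  have "open ?Z"
    unfolding open_contains_ball
  proof
    fix b assume b: "b \<in> ?Z"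
    then have be: "0 < b \<bullet> e" "Q b = 0" by auto
    show "\<exists>r>0. ball b r \<subseteq> ?Z"
    proof (intro exI[of _ "(b \<bullet> e)/3"] conjI subsetI)
      fix a assume a: "a \<in> ball b ((b \<bullet> e)/3)"
      have ae: "a \<bullet> e > 2 * (b \<bullet> e) / 3" using sub[of b a] a by auto
      have aH: "a \<in> ?H" using ae be by auto
      have "Q a = 0"
      proof (rule ccontr)
        assume "Q a \<noteq> 0"
        then have "a \<in> ?P" using aH nonneg[of a] by auto
        then obtain r0 where r0: "r0 > 0" "cball a r0 \<subseteq> ?P"
          using openP by (meson open_contains_cball)
        \<comment> \<open>A point \<open>a\<close> within a third of the height of \<open>b\<close>
          lies above two thirds of that height. The ball around \<open>a\<close> whose radius is
          half the height of \<open>b\<close> therefore stays in the half space and contains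
          \<open>b\<close>, where the barrier would make \<open>Q\<close> positive.\<close>
        define R where "R = (b \<bullet> e)/2"
        define r where "r = min r0 (R/4)"
        have cb: "cball a R \<subseteq> ?H"
        proof
          fix x assume "x \<in> cball a R"
          then show "x \<in> ?H" using sub[of a x] ae be unfolding R_def by auto
        qed
        have r: "0 < r" "r < R" using r0 be unfolding r_def R_def by auto
        obtain c k where ck: "c > 0" "k > 0"
          "\<And>x. x \<in> cball a R \<Longrightarrow> x \<notin> ball a r \<Longrightarrow>
             c * (exp (- k * ((x - a) \<bullet> (x - a))) - exp (- k * R\<^sup>2)) \<le> Q x"
        proof (rule annulus_barrier[OF r])
          show "continuous_on (cball a R) Q" using cont cb continuous_on_subset by blast
          show "0 \<le> Q x" if "x \<in> cball a R" for x using that cb nonneg by blast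
          show "superharmonic_on (ball a R) Q"
            using superharmonic_on_subset[OF super] cb ball_subset_cball by blast
          show "0 < Q x" if "x \<in> cball a r" for x
            using that r0 unfolding r_def by auto
        qed blast
        have dab: "dist a b < R" using a be unfolding R_def by (auto simp: dist_commute)
        have "b \<notin> ball a r"
        proof
          assume "b \<in> ball a r"
          then have "b \<in> cball a r0" unfolding r_def by auto
          then have "b \<in> ?P" using r0 by blast
          then show False using be by auto
        qed
        from ck(3)[OF _ this] dab
        have "c * (exp (- k * ((b - a) \<bullet> (b - a))) - exp (- k * R\<^sup>2)) \<le> 0" using be by auto
        moreover have "(b - a) \<bullet> (b - a) < R\<^sup>2"
          using dab power_strict_mono[of "dist b a" R 2]
          by (simp add: dist_norm power2_norm_eq_inner norm_minus_commute[of a b])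
        then have "exp (- k * R\<^sup>2) < exp (- k * ((b - a) \<bullet> (b - a)))" using ck by simp
        ultimately show False using ck(1) by (simp add: mult_le_0_iff)
      qed
      then show "a \<in> ?Z" using aH by auto
    qed (use be in auto)
  qed
  moreover have "connected ?H"
    using convex_halfspace_gt[of 0 e] by (simp add: inner_commute convex_connected)
  ultimately have "?P \<inter> ?H = {} \<or> ?Z \<inter> ?H = {}"
    using openP nonneg by (intro connectedD) force+
  then show ?thesis using nonneg by force
qed

section \<open>Tangential regularity at the boundary\<close>

text \<open>This is the classical half-ball comparison behind interior gradient bounds for Poisson's
  equation. The difference of \<open>U\<close> and its mirror image in the hyperplane through
  \<open>m\<close> orthogonal to \<open>p\<close> vanishes on that hyperplane, is at most \<omega>
  on the sphere, and has Laplacian at least \<open>- 2 * C\<close>.\<close>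

lemma reflection_difference_upper_bound:
  fixes m p :: "'a::euclidean_space"
  assumes \<rho>: "\<rho> > 0" and p: "norm p = 1"
    and tw: "\<And>x. x \<in> cball m \<rho> \<Longrightarrow> twice_diff_at U G (A x) x"
    and lap: "\<And>x. x \<in> cball m \<rho> \<Longrightarrow> \<bar>\<Sum>i\<in>Basis. A x i \<bullet> i\<bar> \<le> C"
    and osc: "\<And>x y. x \<in> cball m \<rho> \<Longrightarrow> y \<in> cball m \<rho> \<Longrightarrow> U x - U y \<le> \<omega>"
    and s: "0 \<le> s" "s \<le> \<rho>"
  shows "U (m + s *\<^sub>R p) - U (m - s *\<^sub>R p)
     \<le> \<omega> / \<rho>\<^sup>2 * (s\<^sup>2 + real DIM('a) * (\<rho> * s - s * s)) + (C + 1) * (\<rho> * s - s * s)"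
proof -
  have pp: "p \<bullet> p = 1" using p by (simp add: norm_eq_1)
  have \<omega>: "\<omega> \<ge> 0" using osc[of m m] \<rho> by simp
  have C: "C \<ge> 0" using lap[of m] \<rho> by (smt (verit) centre_in_cball abs_ge_zero)
  define N where "N = real DIM('a)"
  define S where "S = (\<lambda>x. x \<bullet> p - m \<bullet> p)"
  define l where "l = (\<lambda>x. (-2) * S x)"
  define D where "D = (\<lambda>x. U x - U (x + l x *\<^sub>R p))"
  \<comment> \<open>The square of the distance reaches \<omega> on the sphere after scaling.
    \<open>N * (\<rho> * S x - S x * S x)\<close> is nonnegative on the half ball and cancels the
    Laplacian of the square; the last summand makes the Laplacian of \<open>B\<close> equal to
    \<open>- 2 * (C + 1)\<close>, strictly below that of the difference.\<close>
  define B where "B = (\<lambda>x. \<omega> / \<rho>\<^sup>2 * ((x - m) \<bullet> (x - m) + N * (\<rho> * S x - S x * S x))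
      + (C + 1) * (\<rho> * S x - S x * S x))"
  have lapS: "lap_at S x p 0" for x
    using lap_at_diff[OF lap_at_inner[of p x] lap_at_const[of "m \<bullet> p" x]] unfolding S_def by simp
  have lapl: "lap_at l x ((-2) *\<^sub>R p) 0" for x
    using lap_at_cmult[OF lapS[of x], of "-2"] unfolding l_def by simp
  have lapSS: "lap_at (\<lambda>x. \<rho> * S x - S x * S x) x (\<rho> *\<^sub>R p - (S x *\<^sub>R p + S x *\<^sub>R p)) (-2)" for x
    using lap_at_diff[OF lap_at_cmult[OF lapS[of x], of \<rho>] lap_at_mult[OF lapS[of x] lapS[of x]]]
    by (simp add: pp)
  have lapB: "\<exists>g. lap_at B x g (- 2 * (C + 1))" for x
  proof -
    have "lap_at B x
      ((\<omega> / \<rho>\<^sup>2) *\<^sub>R (2 *\<^sub>R (x - m) + N *\<^sub>R (\<rho> *\<^sub>R p - (S x *\<^sub>R p + S x *\<^sub>R p)))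
         + (C + 1) *\<^sub>R (\<rho> *\<^sub>R p - (S x *\<^sub>R p + S x *\<^sub>R p)))
      (\<omega> / \<rho>\<^sup>2 * (2 * real DIM('a) + N * (-2)) + (C + 1) * (-2))"
      unfolding B_def by (intro lap_at_add lap_at_cmult lap_at_dist2 lapSS)
    then show ?thesis by (auto simp: N_def algebra_simps)
  qed
  have refl_dist: "(x + l x *\<^sub>R p - m) \<bullet> (x + l x *\<^sub>R p - m) = (x - m) \<bullet> (x - m)" for x
  proof -
    have "(x - m + l x *\<^sub>R p) \<bullet> (x - m + l x *\<^sub>R p)
       = (x - m) \<bullet> (x - m) + 2 * l x * ((x - m) \<bullet> p) + (l x)\<^sup>2"
      by (simp add: inner_add_left inner_add_right pp inner_commute power2_eq_square algebra_simps)
    moreover have "(x - m) \<bullet> p = S x" by (simp add: S_def inner_diff_left)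
    ultimately show ?thesis by (simp add: l_def power2_eq_square algebra_simps)
  qed
  have refl_ball: "x + l x *\<^sub>R p \<in> cball m \<rho>" if "x \<in> cball m \<rho>" for x
    using refl_dist[of x] that
    by (metis dist_commute dist_norm mem_cball norm_eq_sqrt_inner)
  have Scont: "continuous_on X S" for X unfolding S_def by (intro continuous_intros)
  let ?K = "cball m \<rho> \<inter> {x. 0 \<le> S x}"
  have Sle: "S x \<le> \<rho>" if "x \<in> cball m \<rho>" for x
  proof -
    have "S x \<le> norm (x - m) * norm p"
      unfolding S_def inner_diff_left[symmetric] by (rule norm_cauchy_schwarz)
    then show ?thesis using that p by (simp add: dist_norm norm_minus_commute)
  qed
  have Bpos: "B x \<ge> (\<omega> / \<rho>\<^sup>2) * ((x - m) \<bullet> (x - m))" if "x \<in> ?K" for x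
  proof -
    have "\<rho> * S x - S x * S x \<ge> 0" using Sle[of x] that
      by (simp add: mult_right_mono)
    then have "0 \<le> \<omega> / \<rho>\<^sup>2 * (N * (\<rho> * S x - S x * S x))" "0 \<le> (C + 1) * (\<rho> * S x - S x * S x)"
      using \<omega> C by (auto simp: N_def intro!: mult_nonneg_nonneg)
    then show ?thesis unfolding B_def distrib_left by linarith
  qed
  have Ucont: "continuous_on (cball m \<rho>) U"
    by (intro continuous_at_imp_continuous_on ballI lap_at_isCont[OF lap_at_twice_diff[OF tw]])
  have lcont: "continuous_on X (\<lambda>x. x + l x *\<^sub>R p)" for X
    unfolding l_def by (intro continuous_intros Scont)
  have "\<exists>y\<in>?K. \<forall>x\<in>?K. D x - B x \<le> D y - B y"
  proof (rule continuous_attains_sup)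
    have "closed {x. 0 \<le> S x}" unfolding S_def by (intro closed_Collect_le continuous_intros)
    then show "compact ?K" by (simp add: compact_Int_closed)
    have "m \<in> ?K" using \<rho> by (auto simp: S_def)
    then show "?K \<noteq> {}" by blast
    have "continuous_on ?K (\<lambda>x. U (x + l x *\<^sub>R p))"
      by (rule continuous_on_compose2[OF Ucont lcont]) (use refl_ball in auto)
    then show "continuous_on ?K (\<lambda>x. D x - B x)" unfolding D_def B_def
      by (intro continuous_intros continuous_on_subset[OF Ucont] Scont) auto
  qed
  then obtain x0 where x0: "x0 \<in> ?K" "\<And>x. x \<in> ?K \<Longrightarrow> D x - B x \<le> D x0 - B x0" by blast
  have "D x0 - B x0 \<le> 0"
  proof (rule ccontr)
    assume pos: "\<not> ?thesis"
    have "S x0 \<noteq> 0"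
    proof
      assume "S x0 = 0"
      then have "D x0 = 0" by (simp add: D_def l_def)
      moreover have "B x0 \<ge> 0" using Bpos[OF x0(1)] \<omega> by (smt (verit) inner_ge_zero zero_le_divide_iff zero_le_power2 mult_nonneg_nonneg)
      ultimately show False using pos by simp
    qed
    then have S0: "S x0 > 0" using x0(1) by auto
    have "dist m x0 \<noteq> \<rho>"
    proof
      assume "dist m x0 = \<rho>"
      then have "(x0 - m) \<bullet> (x0 - m) = \<rho>\<^sup>2"
        by (simp add: dist_norm norm_minus_commute power2_norm_eq_inner[symmetric])
      then have "B x0 \<ge> \<omega>" using Bpos[OF x0(1)] \<rho> by simp
      moreover have "D x0 \<le> \<omega>" unfolding D_def using x0(1) refl_ball by (intro osc) auto
      ultimately show False using pos by simp
    qed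
    then have dx: "dist m x0 < \<rho>" using x0(1) by auto
    have x0b: "x0 \<in> cball m \<rho>" using x0 by auto
    let ?y = "x0 + l x0 *\<^sub>R p"
    have lin: "linear (A ?y)" using tw[OF refl_ball[OF x0b]] unfolding twice_diff_at_def
      by (auto dest: has_derivative_linear)
    have "lap_at (\<lambda>x. U (x + l x *\<^sub>R p)) x0 (G ?y + (G ?y \<bullet> p) *\<^sub>R ((-2) *\<^sub>R p))
      ((\<Sum>i\<in>Basis. A ?y i \<bullet> i) + A ?y ((-2) *\<^sub>R p) \<bullet> p + A ?y p \<bullet> ((-2) *\<^sub>R p)
        + (((-2) *\<^sub>R p) \<bullet> ((-2) *\<^sub>R p)) * (A ?y p \<bullet> p) + 0 * (G ?y \<bullet> p))"
      by (rule lap_at_shift_along[OF lapl tw[OF refl_ball[OF x0b]]])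
    then have "lap_at (\<lambda>x. U (x + l x *\<^sub>R p)) x0 (G ?y + (G ?y \<bullet> p) *\<^sub>R ((-2) *\<^sub>R p))
      (\<Sum>i\<in>Basis. A ?y i \<bullet> i)" using linear_cmul[OF lin, of "-2" p] linear_neg[OF lin] by (simp add: pp)
    from lap_at_diff[OF lap_at_twice_diff[OF tw[OF x0b]] this]
    obtain g where lapD: "lap_at D x0 g ((\<Sum>i\<in>Basis. A x0 i \<bullet> i) - (\<Sum>i\<in>Basis. A ?y i \<bullet> i))"
      unfolding D_def by blast
    obtain g' where lapB': "lap_at B x0 g' (- 2 * (C + 1))" using lapB by blast
    note lapDB = lap_at_diff[OF lapD lapB']
    have "open (ball m \<rho> \<inter> {x. 0 < S x})"
      by (intro open_Int open_ball open_Collect_less Scont continuous_intros)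
    moreover have "x0 \<in> ball m \<rho> \<inter> {x. 0 < S x}" using dx S0 by auto
    ultimately have "\<forall>\<^sub>F x in nhds x0. x \<in> ball m \<rho> \<inter> {x. 0 < S x}"
      by (rule eventually_nhds_in_open)
    then have "\<forall>\<^sub>F x in nhds x0. D x - B x \<le> D x0 - B x0"
      by eventually_elim (use x0(2) in auto)
    from lap_at_local_max[OF lapDB this]
    have "(\<Sum>i\<in>Basis. A x0 i \<bullet> i) - (\<Sum>i\<in>Basis. A ?y i \<bullet> i) + 2 * C + 2 \<le> 0" by simp
    then show False using lap[OF x0b] lap[OF refl_ball[OF x0b]] by linarith
  qed
  moreover have "m + s *\<^sub>R p \<in> ?K" using s p \<rho> by (auto simp: S_def inner_add_left pp dist_norm)
  ultimately have "D (m + s *\<^sub>R p) \<le> B (m + s *\<^sub>R p)" using x0(2) by fastforce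
  moreover have S_eq: "S (m + s *\<^sub>R p) = s" by (simp add: S_def inner_add_left pp)
  moreover have "D (m + s *\<^sub>R p) = U (m + s *\<^sub>R p) - U (m - s *\<^sub>R p)"
  proof -
    have "m + s *\<^sub>R p + (- 2 * s) *\<^sub>R p = m - s *\<^sub>R p"
      by (simp add: algebra_simps flip: scaleR_add_left)
    then show ?thesis unfolding D_def l_def S_eq by (simp only:)
  qed
  ultimately show ?thesis
    unfolding B_def N_def by (simp add: pp power2_eq_square)
qed

text \<open>Replacing \<open>p\<close> by \<open>-p\<close> exchanges the two points, which turns
  the upper bound into a bound for the absolute value. Up to the dimension the factor is the usual
  gradient bound at scale \<rho>: oscillation over \<rho>, plus the size of the Laplacian times
  \<rho>.\<close>

lemma reflection_difference_bound:
  fixes m p :: "'a::euclidean_space"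
  assumes \<rho>: "\<rho> > 0" and p: "norm p = 1"
    and tw: "\<And>x. x \<in> cball m \<rho> \<Longrightarrow> twice_diff_at U G (A x) x"
    and lap: "\<And>x. x \<in> cball m \<rho> \<Longrightarrow> \<bar>\<Sum>i\<in>Basis. A x i \<bullet> i\<bar> \<le> C"
    and osc: "\<And>x y. x \<in> cball m \<rho> \<Longrightarrow> y \<in> cball m \<rho> \<Longrightarrow> U x - U y \<le> \<omega>"
    and s: "\<bar>s\<bar> \<le> \<rho>"
  shows "\<bar>U (m + s *\<^sub>R p) - U (m - s *\<^sub>R p)\<bar>
     \<le> (\<omega> / \<rho> * (real DIM('a) + 1) + (C + 1) * \<rho>) * \<bar>s\<bar>"
proof -
  have \<omega>: "\<omega> \<ge> 0" using osc[of m m] \<rho> by simp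
  have C: "C \<ge> 0" using lap[of m] \<rho> by (smt (verit) centre_in_cball abs_ge_zero)
  have main: "U (m + s *\<^sub>R v) - U (m - s *\<^sub>R v) \<le> (\<omega> / \<rho> * (real DIM('a) + 1) + (C + 1) * \<rho>) * s"
    if v: "norm v = 1" and s: "0 \<le> s" "s \<le> \<rho>" for v s
  proof -
    have "U (m + s *\<^sub>R v) - U (m - s *\<^sub>R v)
      \<le> \<omega> / \<rho>\<^sup>2 * (s\<^sup>2 + real DIM('a) * (\<rho> * s - s * s)) + (C + 1) * (\<rho> * s - s * s)"
      by (rule reflection_difference_upper_bound[OF \<rho> v tw lap osc s]) auto
    also have "\<dots> \<le> \<omega> / \<rho>\<^sup>2 * (\<rho> * s + real DIM('a) * (\<rho> * s)) + (C + 1) * (\<rho> * s)"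
    proof (intro add_mono mult_left_mono)
      show "s\<^sup>2 \<le> \<rho> * s" using s by (simp add: power2_eq_square mult_right_mono)
    qed (use s \<omega> C in auto)
    also have "\<dots> = (\<omega> / \<rho> * (real DIM('a) + 1) + (C + 1) * \<rho>) * s"
      using \<rho> by (simp add: field_simps power2_eq_square)
    finally show ?thesis .
  qed
  show ?thesis
  proof (cases "s \<ge> 0")
    case True
    then show ?thesis using main[of p s] main[of "-p" s] p s by auto
  next
    case False
    then show ?thesis using main[of p "-s"] main[of "-p" "-s"] p s by auto
  qed
qed

text \<open>At height s a ball of radius s/2 fits into the half space, so tangential difference
  quotients there are at most a multiple of osc/s + C s. The shift is O(s^2), and the oscillation
  tends to 0 by continuity at \<open>z\<close>; the product is o(s).\<close>

lemma tangential_shift_negligible: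
  fixes e p z :: "'a::euclidean_space"
  assumes e: "norm e = 1" and p: "norm p = 1" "p \<bullet> e = 0" and z: "z \<bullet> e = 0" and r0: "r0 > 0"
    and cont: "continuous_on (cball z r0 \<inter> {x. 0 \<le> x \<bullet> e}) U"
    and tw: "\<And>x. x \<in> cball z r0 \<Longrightarrow> 0 < x \<bullet> e \<Longrightarrow> twice_diff_at U G (A x) x"
    and lap: "\<And>x. x \<in> cball z r0 \<Longrightarrow> 0 < x \<bullet> e \<Longrightarrow> \<bar>\<Sum>i\<in>Basis. A x i \<bullet> i\<bar> \<le> C"
    and \<delta>: "\<And>s. 0 < s \<Longrightarrow> \<bar>\<delta> s\<bar> \<le> K * s\<^sup>2"
  shows "((\<lambda>s. (U (z + s *\<^sub>R e + \<delta> s *\<^sub>R p) - U (z + s *\<^sub>R e)) / s) \<longlongrightarrow> 0) (at_right 0)"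
proof (rule tendstoI)
  fix \<epsilon> :: real assume \<epsilon>: "\<epsilon> > 0"
  define N where "N = real DIM('a) + 1"
  have N: "N > 0" by (simp add: N_def)
  have K: "K \<ge> 0" using \<delta>[of 1] by simp
  have ee: "e \<bullet> e = 1" using e by (simp add: norm_eq_1)
  define \<eta> where "\<eta> = \<epsilon> / (4 * N * (K + 1))"
  have \<eta>: "\<eta> > 0" using \<epsilon> N K by (simp add: \<eta>_def)
  let ?S = "cball z r0 \<inter> {x. 0 \<le> x \<bullet> e}"
  have "z \<in> ?S" using r0 z by auto
  with cont obtain r1 where r1: "r1 > 0" "\<And>x. x \<in> ?S \<Longrightarrow> dist x z < r1 \<Longrightarrow> dist (U x) (U z) < \<eta>"
    unfolding continuous_on_iff using \<eta> by meson
  have C: "C \<ge> 0"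
  proof -
    have "z + r0 *\<^sub>R e \<in> cball z r0" "0 < (z + r0 *\<^sub>R e) \<bullet> e"
      using r0 e by (auto simp: dist_norm inner_add_left z ee)
    from lap[OF this] show ?thesis by linarith
  qed
  \<comment> \<open>The entries with \<open>r0\<close> and \<open>r1\<close> keep all balls used
    below near \<open>z\<close>; \<open>1 / (K + 1)\<close> makes the shift at most
    \<open>s\<close>, hence admissible for radius \<open>s / 2\<close>; the last entry controls the
    contribution of the bound \<open>C\<close> on the Laplacian.\<close>
  define s1 where "s1 = Min {1, r0 / (4 + 2*K), r1 / (4 + 2*K), 1 / (K + 1), \<epsilon> / (4 * (C + 1) * (K + 1))}"
  have s1: "s1 > 0" "s1 \<le> 1" "s1 \<le> r0 / (4 + 2*K)" "s1 \<le> r1 / (4 + 2*K)" "s1 \<le> 1 / (K + 1)"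
     "s1 \<le> \<epsilon> / (4 * (C + 1) * (K + 1))"
    using r0 r1 K \<epsilon> C unfolding s1_def by auto
  have "\<forall>\<^sub>F s in at_right 0. s \<in> {0<..<s1}" by (rule eventually_at_right_real[OF s1(1)])
  then show "\<forall>\<^sub>F s in at_right 0. dist ((U (z + s *\<^sub>R e + \<delta> s *\<^sub>R p) - U (z + s *\<^sub>R e)) / s) 0 < \<epsilon>"
  proof eventually_elim
    case (elim s)
    then have s: "0 < s" "s < s1" by auto
    have s_le: "s \<le> 1" "s * (4 + 2*K) < r0" "s * (4 + 2*K) < r1" "s * (K + 1) \<le> 1"
      "s * (4 * (C + 1) * (K + 1)) < \<epsilon>"
    proof -
      show "s \<le> 1" using s s1 by simp
      have "s < r0 / (4 + 2*K)" using s s1 by simp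
      then show "s * (4 + 2*K) < r0" using K by (simp add: field_simps)
      have "s < r1 / (4 + 2*K)" using s s1 by simp
      then show "s * (4 + 2*K) < r1" using K by (simp add: field_simps)
      have "s < 1 / (K + 1)" using s s1 by simp
      then show "s * (K + 1) \<le> 1" using K by (simp add: field_simps)
      have "s < \<epsilon> / (4 * (C + 1) * (K + 1))" using s s1 by simp
      then show "s * (4 * (C + 1) * (K + 1)) < \<epsilon>" using K C by (simp add: pos_less_divide_eq)
    qed
    have ds: "\<bar>\<delta> s\<bar> \<le> K * s\<^sup>2" using \<delta> s by blast
    have ds1: "K * s\<^sup>2 \<le> s"
    proof -
      have "s * (s * K) \<le> s * 1" using s s_le(4) K by (intro mult_left_mono) (auto simp: algebra_simps)
      then show ?thesis by (simp add: power2_eq_square mult.commute mult.left_commute)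
    qed
    \<comment> \<open>The two points to be compared are mirror images of each other with respect to
      their midpoint \<open>m\<close>, at distance \<open>\<bar>\<delta> s\<bar> / 2\<close> from
      it.\<close>
    define m where "m = z + s *\<^sub>R e + (\<delta> s / 2) *\<^sub>R p"
    define \<rho> where "\<rho> = s / 2"
    have \<rho>: "\<rho> > 0" using s by (simp add: \<rho>_def)
    have in_ball: "0 < x \<bullet> e \<and> dist x z < r1 \<and> x \<in> cball z r0" if x: "x \<in> cball m \<rho>" for x
    proof -
      have "\<bar>(x - m) \<bullet> e\<bar> \<le> norm (x - m) * norm e" by (rule Cauchy_Schwarz_ineq2)
      then have "\<bar>x \<bullet> e - m \<bullet> e\<bar> \<le> s / 2"
        using x e by (simp add: inner_diff_left dist_norm norm_minus_commute \<rho>_def)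
      moreover have "m \<bullet> e = s" by (simp add: m_def inner_add_left z ee p)
      ultimately have 1: "0 < x \<bullet> e" using s by linarith
      have "dist m z \<le> norm (s *\<^sub>R e) + norm ((\<delta> s / 2) *\<^sub>R p)"
        unfolding m_def dist_norm using norm_triangle_ineq[of "s *\<^sub>R e" "(\<delta> s / 2) *\<^sub>R p"]
        by (simp add: algebra_simps)
      also have "\<dots> \<le> s + s / 2" using ds ds1 e p s by simp
      finally have "dist x z \<le> s / 2 + (s + s / 2)"
        using x dist_triangle[of x z m] by (simp add: \<rho>_def dist_commute)
      also have "\<dots> \<le> s * (4 + 2 * K)" using s K by (simp add: algebra_simps)
      finally show ?thesis using 1 s_le by (auto simp: dist_commute)
    qed
    have "\<bar>U (m + (\<delta> s / 2) *\<^sub>R p) - U (m - (\<delta> s / 2) *\<^sub>R p)\<bar>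
       \<le> (2 * \<eta> / \<rho> * (real DIM('a) + 1) + (C + 1) * \<rho>) * \<bar>\<delta> s / 2\<bar>"
    proof (rule reflection_difference_bound[OF \<rho> p(1)])
      show "twice_diff_at U G (A x) x" if "x \<in> cball m \<rho>" for x using in_ball[OF that] tw by blast
      show "\<bar>\<Sum>i\<in>Basis. A x i \<bullet> i\<bar> \<le> C" if "x \<in> cball m \<rho>" for x using in_ball[OF that] lap by blast
      show "U x - U y \<le> 2 * \<eta>" if "x \<in> cball m \<rho>" "y \<in> cball m \<rho>" for x y
      proof -
        have "dist (U x) (U z) < \<eta>" "dist (U y) (U z) < \<eta>"
          using in_ball[OF that(1)] in_ball[OF that(2)] by (auto intro!: r1(2))
        then show ?thesis unfolding dist_real_def by linarith
      qed
      show "\<bar>\<delta> s / 2\<bar> \<le> \<rho>" using ds ds1 by (simp add: \<rho>_def)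
    qed
    also have "m - (\<delta> s / 2) *\<^sub>R p = z + s *\<^sub>R e" by (simp add: m_def)
    also have "m + (\<delta> s / 2) *\<^sub>R p = z + s *\<^sub>R e + \<delta> s *\<^sub>R p"
      by (simp add: m_def flip: scaleR_add_left)
    also have "(2 * \<eta> / \<rho> * (real DIM('a) + 1) + (C + 1) * \<rho>) * \<bar>\<delta> s / 2\<bar>
      \<le> (2 * \<eta> / \<rho> * N + (C + 1) * \<rho>) * (K * s\<^sup>2 / 2)"
      unfolding N_def using ds \<eta> \<rho> C by (intro mult_left_mono) auto
    also have "\<dots> = s * (2 * \<eta> * N * K + (C + 1) * K * s\<^sup>2 / 4)"
      using s by (simp add: \<rho>_def field_simps power2_eq_square)
    finally have "\<bar>U (z + s *\<^sub>R e + \<delta> s *\<^sub>R p) - U (z + s *\<^sub>R e)\<bar> / s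
        \<le> 2 * \<eta> * N * K + (C + 1) * K * s\<^sup>2 / 4"
      using s by (simp add: divide_le_eq mult.commute)
    moreover have "2 * \<eta> * N * K \<le> \<epsilon> / 2"
    proof -
      have "2 * \<eta> * N * K \<le> 2 * \<eta> * N * (K + 1)" using \<eta> N by simp
      also have "\<dots> = \<epsilon> / 2"
      proof -
        have "N \<noteq> 0" "K + 1 \<noteq> 0" using N K by auto
        moreover have "2 * (\<epsilon> / (4 * N * k)) * N * k = \<epsilon> / 2" if "N \<noteq> 0" "k \<noteq> 0" for k
          using that by (simp add: field_simps)
        ultimately show ?thesis unfolding \<eta>_def by blast
      qed
      finally show ?thesis .
    qed
    moreover have "(C + 1) * K * s\<^sup>2 / 4 \<le> \<epsilon> / 4"
    proof -
      have "(C + 1) * K * s\<^sup>2 \<le> (C + 1) * (K + 1) * s"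
        using s s_le(1) C K by (intro mult_mono) (auto simp: power2_eq_square mult_left_le)
      also have "\<dots> \<le> \<epsilon>"
      proof -
        have "0 \<le> (C + 1) * (K + 1) * s" using s C K by simp
        moreover have "s * (4 * (C + 1) * (K + 1)) = 4 * ((C + 1) * (K + 1) * s)" by simp
        ultimately show ?thesis using s_le(5) by linarith
      qed
      finally show ?thesis by simp
    qed
    ultimately show ?case using \<epsilon> s by (simp add: dist_real_def)
  qed
qed

section \<open>Homogeneous functions and conformal reflections\<close>

lemma lap_at_norm_powr:
  fixes x :: "'a::euclidean_space"
  assumes x: "x \<noteq> 0"
  shows "lap_at (\<lambda>x. norm x powr \<beta>) x ((\<beta> * norm x powr (\<beta> - 2)) *\<^sub>R x)
     (\<beta> * (\<beta> + real DIM('a) - 2) * norm x powr (\<beta> - 2))"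
proof -
  let ?q = "(x - 0) \<bullet> (x - 0)"
  have q: "?q > 0" using x by simp
  have nq: "(y \<bullet> y) powr s = norm y powr (2 * s)" for y :: 'a and s
    by (metis norm_ge_zero powr_powr powr_numeral zero_neq_numeral power2_norm_eq_inner)
  have "lap_at (\<lambda>x. (\<lambda>s. s powr (\<beta>/2)) ((x - 0) \<bullet> (x - 0))) x
     ((\<beta>/2 * ?q powr (\<beta>/2 - 1)) *\<^sub>R (2 *\<^sub>R (x - 0)))
     ((\<beta>/2 * ((\<beta>/2 - 1) * ?q powr (\<beta>/2 - 1 - 1))) * ((2 *\<^sub>R (x - 0)) \<bullet> (2 *\<^sub>R (x - 0)))
       + (\<beta>/2 * ?q powr (\<beta>/2 - 1)) * (2 * real DIM('a)))"
  proof (rule lap_at_compose[OF lap_at_dist2])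
    have "\<forall>\<^sub>F s in nhds ?q. s \<in> {0<..}" using q by (intro eventually_nhds_in_open) auto
    then show "\<forall>\<^sub>F s in nhds ?q. ((\<lambda>s. s powr (\<beta>/2)) has_real_derivative \<beta>/2 * s powr (\<beta>/2 - 1)) (at s)"
      by eventually_elim (rule has_real_derivative_powr, simp)
    show "((\<lambda>s. \<beta>/2 * s powr (\<beta>/2 - 1)) has_real_derivative
        \<beta>/2 * ((\<beta>/2 - 1) * ?q powr (\<beta>/2 - 1 - 1))) (at ?q)"
      by (intro DERIV_cmult has_real_derivative_powr q)
  qed
  then have "lap_at (\<lambda>x. norm x powr \<beta>) x ((\<beta> * norm x powr (\<beta> - 2)) *\<^sub>R x)
     (\<beta> * (\<beta> - 2) * (norm x powr (\<beta> - 4) * (x \<bullet> x)) + \<beta> * norm x powr (\<beta> - 2) * real DIM('a))"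
    by (simp add: nq algebra_simps)
  moreover have "norm x powr (\<beta> - 4) * (x \<bullet> x) = norm x powr (\<beta> - 2)"
    using x by (simp add: power2_norm_eq_inner[symmetric] powr_numeral[symmetric] powr_add[symmetric] del: powr_numeral)
  ultimately have "lap_at (\<lambda>x. norm x powr \<beta>) x ((\<beta> * norm x powr (\<beta> - 2)) *\<^sub>R x)
     (\<beta> * (\<beta> - 2) * norm x powr (\<beta> - 2) + \<beta> * norm x powr (\<beta> - 2) * real DIM('a))"
    by (simp only:)
  then show ?thesis by (simp add: algebra_simps)
qed

lemma lap_at_norm:
  fixes x :: "'a::euclidean_space"
  assumes "x \<noteq> 0"
  shows "lap_at norm x ((1 / norm x) *\<^sub>R x) ((real DIM('a) - 1) / norm x)"
proof -
  have "norm x powr -1 = 1 / norm x" using assms by (simp add: powr_minus divide_inverse)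
  then show ?thesis using lap_at_norm_powr[OF assms, of 1] by simp
qed

text \<open>The function is extended with degree 0, so its gradient is tangential and its Laplacian
  on the sphere is the Gegenbauer operator in the height \<open>x \<bullet> a\<close>, for dimension
  \<open>DIM('a) - 1\<close>.\<close>

lemma lap_at_zonal:
  fixes x a :: "'a::euclidean_space"
  assumes x: "norm x = 1" and a: "norm a = 1"
    and \<phi>: "\<And>s. (\<phi> has_real_derivative \<phi>' s) (at s)"
    and \<phi>': "\<And>s. (\<phi>' has_real_derivative \<phi>'' s) (at s)"
  shows "lap_at (\<lambda>x. \<phi> ((x \<bullet> a) * norm x powr (-1))) x (\<phi>' (x \<bullet> a) *\<^sub>R (a - (x \<bullet> a) *\<^sub>R x))
    (\<phi>'' (x \<bullet> a) * (1 - (x \<bullet> a)\<^sup>2) - (real DIM('a) - 1) * (x \<bullet> a) * \<phi>' (x \<bullet> a))"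
proof -
  have x0: "x \<noteq> 0" using x by auto
  have xx: "x \<bullet> x = 1" "a \<bullet> a = 1" using x a by (simp_all add: norm_eq_1)
  have "lap_at (\<lambda>x. (x \<bullet> a) * norm x powr (-1)) x (a - (x \<bullet> a) *\<^sub>R x) (- (real DIM('a) - 1) * (x \<bullet> a))"
    using lap_at_mult[OF lap_at_inner[of a x] lap_at_norm_powr[OF x0, of "-1"]] x
    by (simp add: algebra_simps inner_commute)
  from lap_at_compose[OF this, of \<phi> \<phi>' "\<phi>'' (x \<bullet> a)"] \<phi> \<phi>'
  have "lap_at (\<lambda>x. \<phi> ((x \<bullet> a) * norm x powr (-1))) x (\<phi>' (x \<bullet> a) *\<^sub>R (a - (x \<bullet> a) *\<^sub>R x))
     (\<phi>'' (x \<bullet> a) * ((a - (x \<bullet> a) *\<^sub>R x) \<bullet> (a - (x \<bullet> a) *\<^sub>R x))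
        + \<phi>' (x \<bullet> a) * (- (real DIM('a) - 1) * (x \<bullet> a)))"
    using x by simp
  moreover have "(a - (x \<bullet> a) *\<^sub>R x) \<bullet> (a - (x \<bullet> a) *\<^sub>R x) = 1 - (x \<bullet> a)\<^sup>2"
    by (simp add: inner_diff_left inner_diff_right xx inner_commute power2_eq_square)
  ultimately have "lap_at (\<lambda>x. \<phi> ((x \<bullet> a) * norm x powr (-1))) x (\<phi>' (x \<bullet> a) *\<^sub>R (a - (x \<bullet> a) *\<^sub>R x))
     (\<phi>'' (x \<bullet> a) * (1 - (x \<bullet> a)\<^sup>2) + \<phi>' (x \<bullet> a) * (- (real DIM('a) - 1) * (x \<bullet> a)))"
    by (simp only:)
  then show ?thesis by (simp add: algebra_simps)
qed

lemma lap_at_line_derivative: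
  assumes "lap_at F x g L"
  shows "((\<lambda>s. F (x + s *\<^sub>R v)) has_real_derivative (g \<bullet> v)) (at 0 within S)"
proof -
  have "(F has_derivative (\<lambda>h. g \<bullet> h)) (at (x + 0 *\<^sub>R v))"
    using assms unfolding lap_at_def twice_diff_at_def by (auto dest: eventually_nhds_x_imp_x)
  moreover have "((\<lambda>s. x + s *\<^sub>R v) has_derivative (\<lambda>s. s *\<^sub>R v)) (at 0 within S)"
    by (auto intro!: derivative_eq_intros)
  ultimately have "((\<lambda>s. F (x + s *\<^sub>R v)) has_derivative (\<lambda>s. g \<bullet> (s *\<^sub>R v))) (at 0 within S)"
    using has_derivative_compose by blast
  then show ?thesis by (rule has_derivative_imp_has_field_derivative) simp
qed

text \<open>Below, the degree is 0 for the radially constant extension of \<open>u\<close> and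
  -\<gamma> for the conformal one. \<open>G\<close> and \<open>A\<close> are the gradient and
  Hessian as global fields, which permits differentiating the homogeneity relations.\<close>

locale homogeneous_halfspace =
  fixes e :: "'a::euclidean_space" and F :: "'a \<Rightarrow> real" and G :: "'a \<Rightarrow> 'a"
    and A :: "'a \<Rightarrow> 'a \<Rightarrow> 'a" and \<beta> :: real
  assumes hom: "\<And>x c. 0 < x \<bullet> e \<Longrightarrow> 0 < c \<Longrightarrow> F (c *\<^sub>R x) = c powr \<beta> * F x"
    and grad: "\<And>x. 0 < x \<bullet> e \<Longrightarrow> (F has_derivative (\<lambda>h. G x \<bullet> h)) (at x)"
    and hess: "\<And>x. 0 < x \<bullet> e \<Longrightarrow> (G has_derivative A x) (at x)"
begin

lemma open_H: "open {x. 0 < x \<bullet> e}"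
  using open_halfspace_gt[of 0 e] by (simp add: inner_commute)

lemma ev_H: "0 < x \<bullet> e \<Longrightarrow> \<forall>\<^sub>F y in nhds x. 0 < y \<bullet> e"
  using eventually_nhds_in_open[OF open_H] by auto

lemma twice_diff: "0 < x \<bullet> e \<Longrightarrow> twice_diff_at F G (A x) x"
  unfolding twice_diff_at_def using ev_H[of x] hess[of x] by (auto elim: eventually_mono dest: grad)

lemma euler: assumes x: "0 < x \<bullet> e" shows "G x \<bullet> x = \<beta> * F x"
proof -
  have "((\<lambda>c. c *\<^sub>R x) has_derivative (\<lambda>c. c *\<^sub>R x)) (at 1)" by (auto intro!: derivative_eq_intros)
  moreover have "(F has_derivative (\<lambda>h. G x \<bullet> h)) (at (1 *\<^sub>R x))" using grad[OF x] by simp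
  ultimately have "((\<lambda>c. F (c *\<^sub>R x)) has_derivative (\<lambda>c. G x \<bullet> (c *\<^sub>R x))) (at 1)"
    by (rule has_derivative_compose)
  then have 1: "((\<lambda>c. F (c *\<^sub>R x)) has_real_derivative G x \<bullet> x) (at 1)"
    by (rule has_derivative_imp_has_field_derivative) simp
  have "((\<lambda>c. c powr \<beta> * F x) has_real_derivative \<beta> * F x) (at 1)"
    by (auto intro!: derivative_eq_intros)
  then have "((\<lambda>c. F (c *\<^sub>R x)) has_real_derivative \<beta> * F x) (at 1)"
    by (rule DERIV_cong_ev[THEN iffD1, rotated -1])
       (use hom[OF x] eventually_nhds_in_open[of "{0<..}" "1::real"] in \<open>auto elim!: eventually_mono\<close>)
  with 1 show ?thesis by (rule DERIV_unique)
qed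

lemma grad_hom: assumes x: "0 < x \<bullet> e" and c: "0 < c" shows "G (c *\<^sub>R x) = c powr (\<beta> - 1) *\<^sub>R G x"
proof -
  have cx: "0 < (c *\<^sub>R x) \<bullet> e" using x c by simp
  have "((\<lambda>x. c *\<^sub>R x) has_derivative (\<lambda>h. c *\<^sub>R h)) (at x)" by (auto intro!: derivative_eq_intros)
  then have 1: "((\<lambda>x. F (c *\<^sub>R x)) has_derivative (\<lambda>h. G (c *\<^sub>R x) \<bullet> (c *\<^sub>R h))) (at x)"
    using grad[OF cx] by (rule has_derivative_compose)
  have "((\<lambda>x. c powr \<beta> * F x) has_derivative (\<lambda>h. c powr \<beta> * (G x \<bullet> h))) (at x)"
    using grad[OF x] by (auto intro!: derivative_eq_intros)
  moreover have "\<forall>\<^sub>F y in at x. c powr \<beta> * F y = F (c *\<^sub>R y)"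
    using ev_H[OF x] unfolding eventually_at_filter
    by eventually_elim (use hom c in auto)
  ultimately have "((\<lambda>x. F (c *\<^sub>R x)) has_derivative (\<lambda>h. c powr \<beta> * (G x \<bullet> h))) (at x)"
    by (rule has_derivative_transform_eventually) (use hom x c in auto)
  from has_derivative_unique[OF 1 this]
  have eq: "c * (G (c *\<^sub>R x) \<bullet> h) = c powr \<beta> * (G x \<bullet> h)" for h by (simp add: fun_eq_iff)
  have "c powr \<beta> = c * c powr (\<beta> - 1)" using c by (simp add: powr_diff)
  with eq c have "G (c *\<^sub>R x) \<bullet> h = (c powr (\<beta> - 1) *\<^sub>R G x) \<bullet> h" for h by simp
  then show ?thesis by (metis vector_eq_rdot)
qed

lemma hess_self: assumes x: "0 < x \<bullet> e" shows "A x x = (\<beta> - 1) *\<^sub>R G x"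
proof -
  have "((\<lambda>c. c *\<^sub>R x) has_derivative (\<lambda>c. c *\<^sub>R x)) (at 1)" by (auto intro!: derivative_eq_intros)
  moreover have "(G has_derivative A x) (at (1 *\<^sub>R x))" using hess[OF x] by simp
  ultimately have 1: "((\<lambda>c. G (c *\<^sub>R x)) has_derivative (\<lambda>c. A x (c *\<^sub>R x))) (at 1)"
    by (rule has_derivative_compose)
  have "((\<lambda>c. c powr (\<beta> - 1) *\<^sub>R G x) has_derivative (\<lambda>c. (c * (\<beta> - 1)) *\<^sub>R G x)) (at 1)"
    by (auto intro!: derivative_eq_intros simp: algebra_simps)
  moreover have "\<forall>\<^sub>F c in at 1. c powr (\<beta> - 1) *\<^sub>R G x = G (c *\<^sub>R x)"
    using eventually_nhds_in_open[of "{0<..}" "1::real"] unfolding eventually_at_filter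
    by (auto simp: grad_hom[OF x] elim!: eventually_mono)
  ultimately have "((\<lambda>c. G (c *\<^sub>R x)) has_derivative (\<lambda>c. (c * (\<beta> - 1)) *\<^sub>R G x)) (at 1)"
    by (rule has_derivative_transform_eventually) auto
  from has_derivative_unique[OF 1 this] show ?thesis
    by (metis mult_1 scaleR_one)
qed

text \<open>Obtained by differentiating Euler's relation, whereas \<open>hess_self\<close>
  differentiates the homogeneity of the gradient. The two together do the work that symmetry of
  \<open>A x\<close> would do.\<close>

lemma hess_inner_self: assumes x: "0 < x \<bullet> e" shows "A x h \<bullet> x = (\<beta> - 1) * (G x \<bullet> h)"
proof -
  have 1: "((\<lambda>x. G x \<bullet> x) has_derivative (\<lambda>h. G x \<bullet> h + A x h \<bullet> x)) (at x)"
    using hess[OF x] by (auto intro!: derivative_eq_intros)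
  have "((\<lambda>x. \<beta> * F x) has_derivative (\<lambda>h. \<beta> * (G x \<bullet> h))) (at x)"
    using grad[OF x] by (auto intro!: derivative_eq_intros)
  moreover have "\<forall>\<^sub>F y in at x. \<beta> * F y = G y \<bullet> y"
    using ev_H[OF x] unfolding eventually_at_filter by eventually_elim (simp add: euler)
  ultimately have "((\<lambda>x. G x \<bullet> x) has_derivative (\<lambda>h. \<beta> * (G x \<bullet> h))) (at x)"
    by (rule has_derivative_transform_eventually) (use euler x in auto)
  from has_derivative_unique[OF 1 this] have "G x \<bullet> h + A x h \<bullet> x = \<beta> * (G x \<bullet> h)"
    by (simp add: fun_eq_iff)
  then show ?thesis by (simp add: algebra_simps)
qed

lemma hess_hom: assumes x: "0 < x \<bullet> e" and c: "0 < c"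
  shows "A (c *\<^sub>R x) h = c powr (\<beta> - 2) *\<^sub>R A x h"
proof -
  have cx: "0 < (c *\<^sub>R x) \<bullet> e" using x c by simp
  have "((\<lambda>x. c *\<^sub>R x) has_derivative (\<lambda>h. c *\<^sub>R h)) (at x)" by (auto intro!: derivative_eq_intros)
  then have 1: "((\<lambda>x. G (c *\<^sub>R x)) has_derivative (\<lambda>h. A (c *\<^sub>R x) (c *\<^sub>R h))) (at x)"
    using hess[OF cx] by (rule has_derivative_compose)
  have "((\<lambda>x. c powr (\<beta> - 1) *\<^sub>R G x) has_derivative (\<lambda>h. c powr (\<beta> - 1) *\<^sub>R A x h)) (at x)"
    using hess[OF x] by (auto intro!: derivative_eq_intros)
  moreover have "\<forall>\<^sub>F y in at x. c powr (\<beta> - 1) *\<^sub>R G y = G (c *\<^sub>R y)"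
    using ev_H[OF x] unfolding eventually_at_filter
    by eventually_elim (use grad_hom c in auto)
  ultimately have "((\<lambda>x. G (c *\<^sub>R x)) has_derivative (\<lambda>h. c powr (\<beta> - 1) *\<^sub>R A x h)) (at x)"
    by (rule has_derivative_transform_eventually) (use grad_hom x c in auto)
  from has_derivative_unique[OF 1 this]
  have "A (c *\<^sub>R x) (c *\<^sub>R ((1 / c) *\<^sub>R h)) = c powr (\<beta> - 1) *\<^sub>R A x ((1 / c) *\<^sub>R h)" by metis
  moreover have "A x ((1 / c) *\<^sub>R h) = (1 / c) *\<^sub>R A x h"
    using linear_cmul[OF has_derivative_linear[OF hess[OF x]]] by blast
  moreover have "c powr (\<beta> - 1) * (1 / c) = c powr (\<beta> - 2)" using c by (simp add: powr_diff power2_eq_square)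
  ultimately show ?thesis using c by simp
qed

lemma hess_linear: "0 < x \<bullet> e \<Longrightarrow> linear (A x)"
  using hess has_derivative_linear by blast

end

text \<open>In homogeneous coordinates, the conformal reflection of the sphere in the boundary of the cap
  \<open>x \<bullet> p \<ge> t\<close> is the Lorentz reflection of the light cone in the spacelike vector \<open>(p, t)\<close>,
  here written for the spatial component only.\<close>

definition cap_shift :: "'a::euclidean_space \<Rightarrow> real \<Rightarrow> 'a \<Rightarrow> real" where
  "cap_shift p t x = 2 / (1 - t\<^sup>2) * (t * norm x - x \<bullet> p)"

definition cap_inv :: "'a::euclidean_space \<Rightarrow> real \<Rightarrow> 'a \<Rightarrow> 'a" where
  "cap_inv p t x = x + cap_shift p t x *\<^sub>R p"

text \<open>A Lorentz reflection maps the null vector with space part \<open>x\<close> and time part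
  \<open>norm x\<close> to a null vector, whose time part is the right-hand side. The lower bound,
  an equality for \<open>x\<close> parallel to \<open>p\<close> in the same direction, also shows
  that this time part is nonnegative, so it is the norm itself.\<close>

lemma norm_cap_inv:
  assumes p: "norm p = 1" and t: "0 \<le> t" "t < 1"
  shows "norm (cap_inv p t x) = norm x + t * cap_shift p t x"
    and "norm (cap_inv p t x) \<ge> (1 - t) / (1 + t) * norm x"
proof -
  have t2: "1 - t\<^sup>2 > 0" using t by (simp add: power_less_one_iff abs_square_less_1)
  define c where "c = 2 / (1 - t\<^sup>2)"
  have "2 / d * d = 2" if "d > 0" for d :: real using that by simp
  from this[OF t2] have c: "c * (1 - t\<^sup>2) = 2" unfolding c_def .
  have c0: "c > 0" using t2 by (simp add: c_def)
  define s r where "s = x \<bullet> p" and "r = norm x"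
  have sr: "s \<le> r" unfolding s_def r_def using norm_cauchy_schwarz[of x p] p by simp
  have l: "cap_shift p t x = c * (t * r - s)" by (simp add: cap_shift_def c_def s_def r_def)
  have pp: "p \<bullet> p = 1" using p by (simp add: norm_eq_1)
  have 0: "r + t * (c * (t * r - s)) = c * ((1 + t\<^sup>2) * r - 2 * t * s) / 2"
  proof -
    have "2 * r = c * (1 - t\<^sup>2) * r" using c by simp
    then show ?thesis by (simp add: algebra_simps power2_eq_square)
  qed
  also have "\<dots> \<ge> c * ((1 + t\<^sup>2) * r - 2 * t * r) / 2"
    using c0 sr t by (simp add: mult_left_mono)
  also have "c * ((1 + t\<^sup>2) * r - 2 * t * r) / 2 = (1 - t)/(1 + t) * r"
  proof -
    have "(1 - t\<^sup>2) = (1 - t) * (1 + t)" by (simp add: algebra_simps power2_eq_square)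
    then have "c / 2 = 1 / ((1 - t) * (1 + t))" by (simp add: c_def)
    moreover have "(1 + t\<^sup>2) * r - 2 * t * r = (1 - t) * (1 - t) * r" by (simp add: algebra_simps power2_eq_square)
    ultimately have "c * ((1 + t\<^sup>2) * r - 2 * t * r) / 2 = 1 / ((1 - t) * (1 + t)) * ((1 - t) * (1 - t) * r)"
      by (metis times_divide_eq_left)
    also have "\<dots> = (1 - t) / (1 + t) * r"
    proof -
      have "1 / (a * b) * (a * a * r) = a / b * r" if "a \<noteq> 0" for a b using that by simp
      then show ?thesis using t by simp
    qed
    finally show ?thesis .
  qed
  finally have low: "(1 - t)/(1 + t) * r \<le> r + t * (c * (t * r - s))" .
  moreover have "(1 - t)/(1 + t) * r \<ge> 0" using t by (simp add: r_def)
  ultimately have nn: "r + t * (c * (t * r - s)) \<ge> 0" by linarith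
  have "(norm (cap_inv p t x))\<^sup>2 = r\<^sup>2 + 2 * (c * (t * r - s)) * s + (c * (t * r - s))\<^sup>2"
    unfolding power2_norm_eq_inner cap_inv_def l
    by (simp add: inner_add_left inner_add_right pp inner_commute s_def r_def power2_norm_eq_inner
         power2_eq_square algebra_simps)
       (simp add: power2_eq_square[symmetric] power2_norm_eq_inner)
  also have "\<dots> = (r + t * (c * (t * r - s)))\<^sup>2"
  proof -
    have "r\<^sup>2 + 2 * (c * (t * r - s)) * s + (c * (t * r - s))\<^sup>2 - (r + t * (c * (t * r - s)))\<^sup>2
        = c * (t * r - s) * ((2 * s - 2 * t * r) + (c * (1 - t\<^sup>2)) * (t * r - s))"
      by (simp add: algebra_simps power2_eq_square)
    also have "\<dots> = 0" unfolding c by simp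
    finally show ?thesis by simp
  qed
  finally show eq: "norm (cap_inv p t x) = norm x + t * cap_shift p t x"
    unfolding l using nn by (simp add: r_def)
  show "norm (cap_inv p t x) \<ge> (1 - t) / (1 + t) * norm x"
    unfolding eq l using low by (simp add: r_def)
qed

lemma cap_inv_nonzero:
  assumes "norm p = 1" "0 \<le> t" "t < 1" "x \<noteq> 0"
  shows "cap_inv p t x \<noteq> 0"
proof
  assume "cap_inv p t x = 0"
  moreover have "(1 - t) / (1 + t) * norm x > 0" using assms by simp
  ultimately show False using norm_cap_inv(2)[OF assms(1-3), of x] by simp
qed

lemma cap_inv_inner: "p \<bullet> e = 0 \<Longrightarrow> cap_inv p t x \<bullet> e = x \<bullet> e"
  by (simp add: cap_inv_def inner_add_left)

lemma cap_inv_scale: "c > 0 \<Longrightarrow> cap_inv p t (c *\<^sub>R x) = c *\<^sub>R cap_inv p t x"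
  by (simp add: cap_inv_def cap_shift_def scaleR_add_right right_diff_distrib mult.left_commute)

lemma cap_inv_fixed: "x \<bullet> p = t * norm x \<Longrightarrow> cap_inv p t x = x"
  by (simp add: cap_inv_def cap_shift_def)

lemma norm_cap_inv_le:
  assumes "norm p = 1" "0 \<le> t" "t < 1" "t * norm x \<le> x \<bullet> p"
  shows "norm (cap_inv p t x) \<le> norm x"
proof -
  have "1 - t\<^sup>2 > 0" using assms by (simp add: power_less_one_iff abs_square_less_1)
  then have "cap_shift p t x \<le> 0" using assms unfolding cap_shift_def
    by (intro mult_nonneg_nonpos) auto
  then show ?thesis using norm_cap_inv(1)[OF assms(1-3), of x] assms(2)
    by (simp add: mult_nonneg_nonpos)
qed

text \<open>Strictness is lost at \<open>t = 0\<close>, where the map is an ordinary isometric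
  reflection. This is why the strict comparison of \<open>U\<close> with its reflection is available
  for positive \<open>t\<close> only.\<close>

lemma norm_cap_inv_less:
  assumes "norm p = 1" "0 < t" "t < 1" "t * norm x < x \<bullet> p"
  shows "norm (cap_inv p t x) < norm x"
proof -
  have "1 - t\<^sup>2 > 0" using assms by (simp add: power_less_one_iff abs_square_less_1)
  then have "cap_shift p t x < 0" using assms unfolding cap_shift_def
    by (intro mult_pos_neg) auto
  then have "t * cap_shift p t x < 0" using assms by (simp add: mult_pos_neg)
  then show ?thesis using norm_cap_inv(1)[of p t x] assms by simp
qed

lemma lap_at_cap_shift:
  fixes x p :: "'a::euclidean_space"
  assumes "x \<noteq> 0"
  shows "lap_at (cap_shift p t) x ((2 / (1 - t\<^sup>2)) *\<^sub>R ((t / norm x) *\<^sub>R x - p))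
    (2 / (1 - t\<^sup>2) * (t * ((real DIM('a) - 1) / norm x)))"
proof -
  have "lap_at (\<lambda>x. 2 / (1 - t\<^sup>2) * (t * norm x - x \<bullet> p)) x
    ((2 / (1 - t\<^sup>2)) *\<^sub>R (t *\<^sub>R ((1 / norm x) *\<^sub>R x) - p))
    (2 / (1 - t\<^sup>2) * (t * ((real DIM('a) - 1) / norm x) - 0))"
    by (intro lap_at_cmult lap_at_diff lap_at_norm lap_at_inner assms)
  then show ?thesis by (simp add: cap_shift_def[abs_def])
qed

text \<open>Conformal covariance in ambient form. After all Hessian terms are reduced by
  homogeneity, the first-order terms carry the factor \<open>2 * \<beta> + DIM('a) - 3\<close>,
  which the choice of degree annihilates, and the coefficient of \<open>A y p \<bullet> p\<close>
  vanishes because \<open>c * (1 - t\<^sup>2) = 2\<close>.\<close>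

lemma (in homogeneous_halfspace) lap_at_cap_inv:
  assumes \<beta>: "2 * \<beta> = 3 - real DIM('a)"
    and p: "norm p = 1" "p \<bullet> e = 0" and t: "0 \<le> t" "t < 1" and x: "0 < x \<bullet> e"
  shows "\<exists>g. lap_at (\<lambda>x. F (cap_inv p t x)) x g (\<Sum>i\<in>Basis. A (cap_inv p t x) i \<bullet> i)"
proof -
  have x0: "x \<noteq> 0" using x by auto
  define r s where "r = norm x" and "s = x \<bullet> p"
  have r: "r > 0" using x0 by (simp add: r_def)
  have t2: "1 - t\<^sup>2 > 0" using t by (simp add: power_less_one_iff abs_square_less_1)
  define c where "c = 2 / (1 - t\<^sup>2)"
  have "2 / d * d = 2" if "d > 0" for d :: real using that by simp
  from this[OF t2] have c: "c * (1 - t\<^sup>2) = 2" unfolding c_def .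
  define y where "y = cap_inv p t x"
  have y: "0 < y \<bullet> e" unfolding y_def using cap_inv_inner[OF p(2)] x by simp
  define l where "l = c * (t * r - s)"
  have l: "cap_shift p t x = l" by (simp add: cap_shift_def l_def c_def r_def s_def)
  \<comment> \<open>The Hessian is taken at the image point \<open>y\<close>, where homogeneity
    evaluates it in the direction \<open>y\<close>; solving for \<open>x\<close> makes its value in
    direction \<open>x\<close> accessible.\<close>
  have xy: "x = y - l *\<^sub>R p" by (simp add: y_def cap_inv_def l)
  define v where "v = c *\<^sub>R ((t / r) *\<^sub>R x - p)"
  have pp: "p \<bullet> p = 1" using p by (simp add: norm_eq_1)
  note lin = hess_linear[OF y]
  have Ax: "A y x = (\<beta> - 1) *\<^sub>R G y - l *\<^sub>R A y p"
    by (subst xy) (simp add: linear_diff[OF lin] linear_cmul[OF lin] hess_self[OF y])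
  have Apx: "A y p \<bullet> x = (\<beta> - 1) * (G y \<bullet> p) - l * (A y p \<bullet> p)"
    by (subst xy) (simp add: inner_diff_right hess_inner_self[OF y])
  have Avv: "A y v = c *\<^sub>R ((t / r) *\<^sub>R A y x - A y p)"
    unfolding v_def by (simp add: linear_diff[OF lin] linear_cmul[OF lin])
  have Av: "A y v \<bullet> p = c * (t / r) * ((\<beta> - 1) * (G y \<bullet> p) - l * (A y p \<bullet> p)) - c * (A y p \<bullet> p)"
    unfolding Avv Ax by (simp add: inner_diff_left algebra_simps)
  have Apv: "A y p \<bullet> v = c * (t / r) * ((\<beta> - 1) * (G y \<bullet> p) - l * (A y p \<bullet> p)) - c * (A y p \<bullet> p)"
    unfolding v_def by (simp add: inner_diff_right Apx algebra_simps)
  have vv: "v \<bullet> v = c\<^sup>2 * (t\<^sup>2 - 2 * (t / r) * s + 1)"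
  proof -
    have "v \<bullet> v = c\<^sup>2 * ((t / r)\<^sup>2 * (x \<bullet> x) - 2 * (t / r) * s + 1)"
      unfolding v_def by (simp add: inner_diff_left inner_diff_right pp inner_commute s_def
          power2_eq_square algebra_simps)
    moreover have "(t / r)\<^sup>2 * (x \<bullet> x) = t\<^sup>2"
      using r by (simp add: r_def power_divide power2_norm_eq_inner[symmetric])
    ultimately show ?thesis by simp
  qed
  have "lap_at (\<lambda>x. F (cap_inv p t x)) x (G y + (G y \<bullet> p) *\<^sub>R v)
     ((\<Sum>i\<in>Basis. A y i \<bullet> i) + A y v \<bullet> p + A y p \<bullet> v + (v \<bullet> v) * (A y p \<bullet> p)
        + (c * (t * ((real DIM('a) - 1) / r))) * (G y \<bullet> p))"
    using lap_at_shift_along[OF lap_at_cap_shift[OF x0, of p t], of F G "A y" p,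
        folded cap_inv_def, folded y_def c_def r_def, folded v_def] twice_diff[OF y] by blast
  moreover have "A y v \<bullet> p + A y p \<bullet> v + (v \<bullet> v) * (A y p \<bullet> p)
        + (c * (t * ((real DIM('a) - 1) / r))) * (G y \<bullet> p) = 0"
  proof -
    have "A y v \<bullet> p + A y p \<bullet> v + (v \<bullet> v) * (A y p \<bullet> p)
        + (c * (t * ((real DIM('a) - 1) / r))) * (G y \<bullet> p)
      = (2 * \<beta> - 2 + real DIM('a) - 1) * (c * (t / r) * (G y \<bullet> p))
        + (c\<^sup>2 * (t\<^sup>2 - 2 * (t / r) * s + 1) - 2 * c * (t / r) * l - 2 * c) * (A y p \<bullet> p)"
      unfolding Av Apv vv by (simp add: algebra_simps add_divide_distrib diff_divide_distrib)
    moreover have "2 * \<beta> - 2 + real DIM('a) - 1 = 0" using \<beta> by simp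
    moreover have "c\<^sup>2 * (t\<^sup>2 - 2 * (t / r) * s + 1) - 2 * c * (t / r) * l - 2 * c = 0"
    proof -
      have "(t / r) * l = c * (t\<^sup>2 - (t / r) * s)"
        unfolding l_def using r by (simp add: field_simps power2_eq_square)
      then have "c\<^sup>2 * (t\<^sup>2 - 2 * (t / r) * s + 1) - 2 * c * ((t / r) * l) - 2 * c
         = c * (c * (1 - t\<^sup>2) - 2)"
        by (simp only:) (simp add: algebra_simps power2_eq_square)
      then show ?thesis using c by (simp add: mult.assoc)
    qed
    ultimately show ?thesis by simp
  qed
  ultimately show ?thesis unfolding y_def
    by (metis (no_types, lifting) add.assoc add.right_neutral)
qed

section \<open>Moving spheres\<close>

lemma powr_diff_le:
  fixes u v a :: real
  assumes "0 < v" "v \<le> u" "1 \<le> a"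
  shows "u powr a - v powr a \<le> a * u powr (a - 1) * (u - v)"
proof (cases "v = u")
  case False
  then have vu: "v < u" using assms by simp
  have "\<exists>z. v < z \<and> z < u \<and> u powr a - v powr a = (u - v) * (a * z powr (a - 1))"
    by (rule MVT2[OF vu]) (use assms in \<open>auto intro!: has_real_derivative_powr\<close>)
  then obtain z where z: "v < z" "z < u" "u powr a - v powr a = (u - v) * (a * z powr (a - 1))" by blast
  have "z powr (a - 1) \<le> u powr (a - 1)" using z assms by (intro powr_mono2) auto
  then have "(u - v) * (a * z powr (a - 1)) \<le> (u - v) * (a * u powr (a - 1))"
    using assms by (intro mult_left_mono) auto
  then show ?thesis using z(3) by (simp add: mult.commute)
qed simp

text \<open>A positive solution in homogeneous coordinates: \<open>U\<close> is the extension of degree \<open>-\<gamma>\<close>, for which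
  the conformal Laplacian of the sphere becomes the Euclidean Laplacian.\<close>

locale conformal_solution = homogeneous_halfspace e U G A "-\<gamma>"
  for e :: "'a::euclidean_space" and U G A \<gamma> +
  fixes h k :: "real \<Rightarrow> real" and P Q :: real
  assumes e: "norm e = 1" and dim: "4 \<le> DIM('a)"
    and \<gamma>: "2 * \<gamma> = real DIM('a) - 3"
    and P: "1 \<le> P" and Q: "1 \<le> Q"
    and U_cont: "continuous_on {x. 0 \<le> x \<bullet> e \<and> x \<noteq> 0} U"
    and U_pos: "\<And>x. 0 \<le> x \<bullet> e \<Longrightarrow> x \<noteq> 0 \<Longrightarrow> 0 < U x"
    and U_hom: "\<And>x c. 0 \<le> x \<bullet> e \<Longrightarrow> x \<noteq> 0 \<Longrightarrow> 0 < c \<Longrightarrow> U (c *\<^sub>R x) = c powr (-\<gamma>) * U x"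
    and U_pde: "\<And>x. 0 < x \<bullet> e \<Longrightarrow> (\<Sum>i\<in>Basis. A x i \<bullet> i) = - (h (norm x powr \<gamma> * U x) * U x powr P)"
    and U_bdry: "\<And>z. z \<bullet> e = 0 \<Longrightarrow> z \<noteq> 0 \<Longrightarrow>
       ((\<lambda>s. U (z + s *\<^sub>R e)) has_real_derivative - (k (norm z powr \<gamma> * U z) * U z powr Q)) (at_right 0)"
    and h_dec: "\<And>s t. 0 < s \<Longrightarrow> s < t \<Longrightarrow> h t < h s"
    and h_cont: "continuous_on {0<..} h"
    and k_noninc: "\<And>s t. 0 < s \<Longrightarrow> s \<le> t \<Longrightarrow> k t \<le> k s"
    and k_nonneg: "\<And>t. 0 < t \<Longrightarrow> 0 \<le> k t"
begin

section \<open>Equations and continuity of the reflected function\<close>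

lemma \<gamma>_pos: "\<gamma> > 0" using \<gamma> dim by simp

lemma ee: "e \<bullet> e = 1" using e by (simp add: norm_eq_1)

abbreviation "closed_cone \<equiv> {x. 0 \<le> x \<bullet> e \<and> x \<noteq> 0}"
abbreviation "hemisphere \<equiv> {x. norm x = 1 \<and> 0 \<le> x \<bullet> e}"

lemma compact_hemisphere: "compact hemisphere"
proof -
  have "hemisphere = sphere 0 1 \<inter> {x. 0 \<le> x \<bullet> e}" by auto
  moreover have "closed {x. 0 \<le> x \<bullet> e}" by (intro closed_Collect_le continuous_intros)
  ultimately show ?thesis by (simp add: compact_Int_closed)
qed

lemma rhs_cont: "continuous_on closed_cone (\<lambda>x. h (norm x powr \<gamma> * U x) * U x powr P)"
proof -
  have 1: "continuous_on closed_cone (\<lambda>x. norm x powr \<gamma> * U x)"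
    using U_cont by (intro continuous_intros) auto
  have "continuous_on closed_cone (\<lambda>x. h (norm x powr \<gamma> * U x))"
    by (rule continuous_on_compose2[OF h_cont 1]) (use U_pos in auto)
  then show ?thesis using U_cont U_pos by (intro continuous_intros) (auto dest: U_pos)
qed

abbreviation "V p t x \<equiv> U (cap_inv p t x)"

lemma cap_inv_cone:
  assumes "norm p = 1" "p \<bullet> e = 0" "0 \<le> t" "t < 1" "x \<in> closed_cone"
  shows "cap_inv p t x \<in> closed_cone"
  using assms cap_inv_nonzero[of p t x] by (simp add: cap_inv_inner)

lemma cap_inv_cont: "continuous_on S (cap_inv p t)"
  unfolding cap_inv_def cap_shift_def by (intro continuous_intros)

lemma V_cont:
  assumes "norm p = 1" "p \<bullet> e = 0" "0 \<le> t" "t < 1"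
  shows "continuous_on closed_cone (V p t)"
  by (rule continuous_on_compose2[OF U_cont cap_inv_cont]) (use cap_inv_cone[OF assms] in auto)

lemma V_hom:
  assumes "norm p = 1" "p \<bullet> e = 0" "0 \<le> t" "t < 1" "x \<in> closed_cone" "c > 0"
  shows "V p t (c *\<^sub>R x) = c powr (-\<gamma>) * V p t x"
  using cap_inv_cone[OF assms(1-5)] U_hom assms(6) by (simp add: cap_inv_scale)

lemma V_lap:
  assumes "norm p = 1" "p \<bullet> e = 0" "0 \<le> t" "t < 1" "0 < x \<bullet> e"
  shows "\<exists>g. lap_at (V p t) x g (- (h (norm (cap_inv p t x) powr \<gamma> * V p t x) * V p t x powr P))"
proof -
  have "2 * - \<gamma> = 3 - real DIM('a)" using \<gamma> by simp
  from lap_at_cap_inv[OF this assms] show ?thesis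
    using U_pde[of "cap_inv p t x"] assms by (simp add: cap_inv_inner)
qed

lemma U_lap:
  assumes "0 < x \<bullet> e"
  shows "\<exists>g. lap_at U x g (- (h (norm x powr \<gamma> * U x) * U x powr P))"
  using lap_at_twice_diff[OF twice_diff[OF assms]] U_pde[OF assms] by auto

text \<open>The reflection maps the line \<open>z + s e\<close> to a parabola-like curve through its image point;
  the tangential deviation is \<open>O(s\<^sup>2)\<close> and hence does not contribute to the normal derivative.\<close>

lemma V_bdry:
  assumes p: "norm p = 1" "p \<bullet> e = 0" and t: "0 \<le> t" "t < 1" and z: "z \<bullet> e = 0" "norm z = 1"
  shows "((\<lambda>s. V p t (z + s *\<^sub>R e)) has_real_derivative
      - (k (norm (cap_inv p t z) powr \<gamma> * V p t z) * V p t z powr Q)) (at_right 0)"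
proof -
  have z0: "z \<noteq> 0" using z by auto
  define y where "y = cap_inv p t z"
  have y0: "y \<noteq> 0" unfolding y_def by (rule cap_inv_nonzero[OF p(1) t z0])
  have ye: "y \<bullet> e = 0" unfolding y_def using p z by (simp add: cap_inv_inner)
  \<comment> \<open>Since \<open>p\<close> and \<open>e\<close> are orthogonal, only the norm in
    \<open>cap_shift\<close> varies along the line, and the norm of \<open>z + s *\<^sub>R e\<close>
    exceeds 1 by at most s^2.\<close>
  define \<delta> where "\<delta> = (\<lambda>s. 2 / (1 - t\<^sup>2) * (t * (norm (z + s *\<^sub>R e) - 1)))"
  have t2: "1 - t\<^sup>2 > 0" using t by (simp add: power_less_one_iff abs_square_less_1)
  have Xeq: "cap_inv p t (z + s *\<^sub>R e) = y + s *\<^sub>R e + \<delta> s *\<^sub>R p" for s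
  proof -
    have "cap_shift p t (z + s *\<^sub>R e) = cap_shift p t z + \<delta> s"
      using z p by (simp add: cap_shift_def \<delta>_def inner_add_left inner_commute[of e p]
          ring_distribs[symmetric] del: times_divide_eq_left)
        (simp add: algebra_simps)
    then show ?thesis by (simp add: y_def cap_inv_def algebra_simps)
  qed
  have \<delta>_bound: "\<bar>\<delta> s\<bar> \<le> 2 / (1 - t\<^sup>2) * s\<^sup>2" if "0 < s" for s
  proof -
    have n2: "(norm (z + s *\<^sub>R e))\<^sup>2 = 1 + s\<^sup>2"
    proof -
      have "z \<bullet> z = 1" using z by (simp add: norm_eq_1)
      then show ?thesis unfolding power2_norm_eq_inner
        using z ee by (simp add: inner_add_left inner_add_right inner_commute[of e z] power2_eq_square)
    qed
    have n1: "norm (z + s *\<^sub>R e) \<ge> 1"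
    proof (rule power2_le_imp_le)
      show "1\<^sup>2 \<le> (norm (z + s *\<^sub>R e))\<^sup>2" unfolding n2 by simp
    qed simp
    have "norm (z + s *\<^sub>R e) \<le> 1 + s\<^sup>2"
    proof (rule power2_le_imp_le)
      show "(norm (z + s *\<^sub>R e))\<^sup>2 \<le> (1 + s\<^sup>2)\<^sup>2" unfolding n2 by (simp add: power2_sum)
    qed simp
    then have "t * (norm (z + s *\<^sub>R e) - 1) \<le> 1 * s\<^sup>2" using t n1 by (intro mult_mono) auto
    moreover have "0 \<le> t * (norm (z + s *\<^sub>R e) - 1)" using t n1 by simp
    ultimately show ?thesis unfolding \<delta>_def using t2
      by (simp add: abs_mult divide_right_mono)
  qed
  define r0 where "r0 = norm y / 2"
  have r0: "r0 > 0" using y0 by (simp add: r0_def)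
  let ?B = "cball y r0 \<inter> {x. 0 \<le> x \<bullet> e}"
  have B_sub: "?B \<subseteq> closed_cone"
  proof
    fix x assume x: "x \<in> ?B"
    have "x \<noteq> 0"
    proof
      assume "x = 0"
      then have "norm y \<le> r0" using x by auto
      then show False using y0 by (simp add: r0_def)
    qed
    then show "x \<in> closed_cone" using x by auto
  qed
  have "closed {x. 0 \<le> x \<bullet> e}" by (intro closed_Collect_le continuous_intros)
  then have "compact ?B" by (simp add: compact_Int_closed)
  then have "bounded ((\<lambda>x. h (norm x powr \<gamma> * U x) * U x powr P) ` ?B)"
    using compact_continuous_image[OF continuous_on_subset[OF rhs_cont B_sub]] compact_imp_bounded by blast
  then obtain C where C: "\<forall>x\<in>?B. \<bar>h (norm x powr \<gamma> * U x) * U x powr P\<bar> \<le> C"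
    unfolding bounded_iff by auto
  have shift: "((\<lambda>s. (U (y + s *\<^sub>R e + \<delta> s *\<^sub>R p) - U (y + s *\<^sub>R e)) / s) \<longlongrightarrow> 0) (at_right 0)"
  proof (rule tangential_shift_negligible[OF e p ye r0, of U G A C])
    show "continuous_on ?B U" by (rule continuous_on_subset[OF U_cont B_sub])
    show "twice_diff_at U G (A x) x" if "0 < x \<bullet> e" for x using twice_diff[OF that] .
    show "\<bar>\<Sum>i\<in>Basis. A x i \<bullet> i\<bar> \<le> C" if "x \<in> cball y r0" "0 < x \<bullet> e" for x
      using C that U_pde[of x] by auto
    show "\<bar>\<delta> s\<bar> \<le> 2 / (1 - t\<^sup>2) * s\<^sup>2" if "0 < s" for s using \<delta>_bound[OF that] .
  qed
  have "((\<lambda>s. (U (y + s *\<^sub>R e) - U y) / s) \<longlongrightarrow> - (k (norm y powr \<gamma> * U y) * U y powr Q)) (at_right 0)"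
    using U_bdry[OF ye y0] unfolding has_field_derivative_iff by simp
  from tendsto_add[OF shift this]
  have "((\<lambda>s. (U (y + s *\<^sub>R e + \<delta> s *\<^sub>R p) - U y) / s) \<longlongrightarrow> - (k (norm y powr \<gamma> * U y) * U y powr Q)) (at_right 0)"
    by (simp add: diff_divide_distrib)
  moreover have "\<delta> 0 = 0" using z by (simp add: \<delta>_def)
  ultimately show ?thesis
    unfolding has_field_derivative_iff Xeq y_def[symmetric] by simp
qed

section \<open>Linear differential inequalities and comparison in narrow caps\<close>

lemma h_mono: "0 < s \<Longrightarrow> s \<le> t \<Longrightarrow> h t \<le> h s"
  using h_dec[of s t] by (cases "s = t") auto

lemma powr_norm_mult_le:
  assumes "norm x \<le> 1" "0 < v"
  shows "norm x powr \<gamma> * v \<le> v"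
proof -
  have "norm x powr \<gamma> \<le> 1" using assms \<gamma>_pos by (simp add: powr_le1)
  then show ?thesis using assms by simp
qed

text \<open>The first bound is compactness. For the second, monotonicity bounds
  \<open>k (U x)\<close> by the value of \<open>k\<close> at the minimum of
  \<open>U\<close>.\<close>

lemma U_bounds:
  obtains C where "C \<ge> 0"
    "\<And>x. x \<in> hemisphere \<Longrightarrow> \<bar>h (U x)\<bar> * (P * U x powr (P - 1)) \<le> C"
    "\<And>x. x \<in> hemisphere \<Longrightarrow> k (U x) * (Q * U x powr (Q - 1)) \<le> C"
proof -
  have sub: "hemisphere \<subseteq> closed_cone" by auto
  have Uc: "continuous_on hemisphere U" by (rule continuous_on_subset[OF U_cont sub])
  have Up: "0 < U x" if "x \<in> hemisphere" for x using that sub U_pos by blast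
  have Un: "U x \<noteq> 0" if "norm x = 1" "0 \<le> x \<bullet> e" for x using that Up[of x] by auto
  have "continuous_on hemisphere (\<lambda>x. h (U x))"
    by (rule continuous_on_compose2[OF h_cont Uc]) (use Up in auto)
  then have "continuous_on hemisphere (\<lambda>x. \<bar>h (U x)\<bar> * (P * U x powr (P - 1)))"
    using Uc by (intro continuous_intros) (use Un in auto)
  from compact_imp_bounded[OF compact_continuous_image[OF this compact_hemisphere]]
  obtain C1 where C1: "\<And>x. x \<in> hemisphere \<Longrightarrow> \<bar>\<bar>h (U x)\<bar> * (P * U x powr (P - 1))\<bar> \<le> C1"
    unfolding bounded_iff by auto
  have "continuous_on hemisphere (\<lambda>x. Q * U x powr (Q - 1))"
    using Uc by (intro continuous_intros) (use Un in auto)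
  from compact_imp_bounded[OF compact_continuous_image[OF this compact_hemisphere]]
  obtain C2 where C2: "\<And>x. x \<in> hemisphere \<Longrightarrow> \<bar>Q * U x powr (Q - 1)\<bar> \<le> C2"
    unfolding bounded_iff by auto
  have "e \<in> hemisphere" using e ee by simp
  then have "hemisphere \<noteq> {}" by blast
  from continuous_attains_inf[OF compact_hemisphere this Uc]
  obtain y where y: "y \<in> hemisphere" "\<And>x. x \<in> hemisphere \<Longrightarrow> U y \<le> U x" by blast
  show ?thesis
  proof (rule that[of "max 0 (max C1 (k (U y) * C2))"])
    show "\<bar>h (U x)\<bar> * (P * U x powr (P - 1)) \<le> max 0 (max C1 (k (U y) * C2))"
      if "x \<in> hemisphere" for x using C1[OF that] by linarith
    show "k (U x) * (Q * U x powr (Q - 1)) \<le> max 0 (max C1 (k (U y) * C2))"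
      if x: "x \<in> hemisphere" for x
    proof -
      have "k (U x) * (Q * U x powr (Q - 1)) \<le> k (U y) * C2"
        using C2[OF x] k_noninc[OF Up[OF y(1)] y(2)[OF x]] k_nonneg[OF Up[OF y(1)]] Q Up[OF x]
        by (intro mult_mono) auto
      then show ?thesis by linarith
    qed
  qed simp
qed

text \<open>Where \<open>V < U\<close>, the reflected argument of \<open>h\<close> is at most
  \<open>V\<close> and hence below \<open>U x\<close>, so by monotonicity \<open>h\<close> there may
  be replaced by \<open>h (U x)\<close>. What remains is a difference of powers of \<open>U\<close>
  and \<open>V\<close>, which is linear in \<open>U - V\<close> up to a bounded factor. This is the
  substitute for a Lipschitz condition.\<close>

lemma lap_difference_le:
  assumes p: "norm p = 1" "p \<bullet> e = 0" and t: "0 \<le> t" "t < 1"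
    and x: "norm x = 1" "0 \<le> x \<bullet> e" "t \<le> x \<bullet> p" and less: "V p t x < U x"
    and C: "\<bar>h (U x)\<bar> * (P * U x powr (P - 1)) \<le> C"
  shows "h (U x) * U x powr P - h (norm (cap_inv p t x) powr \<gamma> * V p t x) * V p t x powr P
     \<le> C * (U x - V p t x)"
proof -
  have xc: "x \<in> closed_cone" using x by auto
  let ?y = "cap_inv p t x"
  have yc: "?y \<in> closed_cone" by (rule cap_inv_cone[OF p t xc])
  have pos: "0 < V p t x" "0 < U x" using U_pos xc yc by auto
  have n: "norm ?y \<le> 1" using norm_cap_inv_le[OF p(1) t, of x] x by simp
  have y0: "norm ?y powr \<gamma> * V p t x > 0" using yc pos by simp
  have "norm ?y powr \<gamma> * V p t x \<le> U x" using powr_norm_mult_le[OF n pos(1)] less by simp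
  then have hle: "h (U x) \<le> h (norm ?y powr \<gamma> * V p t x)" using h_mono y0 by blast
  have "h (U x) * U x powr P - h (norm ?y powr \<gamma> * V p t x) * V p t x powr P
     \<le> h (U x) * (U x powr P - V p t x powr P)"
    using mult_right_mono[OF hle, of "V p t x powr P"] by (simp add: algebra_simps)
  also have "\<dots> \<le> \<bar>h (U x)\<bar> * (U x powr P - V p t x powr P)"
    using pos less P by (intro mult_right_mono) (auto intro!: powr_mono2)
  also have "\<dots> \<le> \<bar>h (U x)\<bar> * (P * U x powr (P - 1) * (U x - V p t x))"
    using powr_diff_le[OF pos(1) less_imp_le[OF less] P] by (intro mult_left_mono) auto
  also have "\<dots> = \<bar>h (U x)\<bar> * (P * U x powr (P - 1)) * (U x - V p t x)" by simp
  also have "\<dots> \<le> C * (U x - V p t x)" using C less by (intro mult_right_mono) auto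
  finally show ?thesis .
qed

text \<open>The same replacement for the boundary nonlinearity; nonnegativity of
  \<open>k (U x)\<close> takes the place of the absolute value.\<close>

lemma bdry_difference_le:
  assumes p: "norm p = 1" "p \<bullet> e = 0" and t: "0 \<le> t" "t < 1"
    and x: "norm x = 1" "0 \<le> x \<bullet> e" "t \<le> x \<bullet> p" and less: "V p t x < U x"
    and C: "k (U x) * (Q * U x powr (Q - 1)) \<le> C"
  shows "k (U x) * U x powr Q - k (norm (cap_inv p t x) powr \<gamma> * V p t x) * V p t x powr Q
     \<le> C * (U x - V p t x)"
proof -
  have xc: "x \<in> closed_cone" using x by auto
  let ?y = "cap_inv p t x"
  have yc: "?y \<in> closed_cone" by (rule cap_inv_cone[OF p t xc])
  have pos: "0 < V p t x" "0 < U x" using U_pos xc yc by auto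
  have n: "norm ?y \<le> 1" using norm_cap_inv_le[OF p(1) t, of x] x by simp
  have y0: "norm ?y powr \<gamma> * V p t x > 0" using yc pos by simp
  have "norm ?y powr \<gamma> * V p t x \<le> U x" using powr_norm_mult_le[OF n pos(1)] less by simp
  then have kle: "k (U x) \<le> k (norm ?y powr \<gamma> * V p t x)" using k_noninc y0 by blast
  have "k (U x) * U x powr Q - k (norm ?y powr \<gamma> * V p t x) * V p t x powr Q
     \<le> k (U x) * (U x powr Q - V p t x powr Q)"
    using mult_right_mono[OF kle, of "V p t x powr Q"] by (simp add: algebra_simps)
  also have "\<dots> \<le> k (U x) * (Q * U x powr (Q - 1) * (U x - V p t x))"
    using powr_diff_le[OF pos(1) less_imp_le[OF less] Q] k_nonneg[OF pos(2)]
    by (intro mult_left_mono) auto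
  also have "\<dots> = k (U x) * (Q * U x powr (Q - 1)) * (U x - V p t x)" by simp
  also have "\<dots> \<le> C * (U x - V p t x)" using C less by (intro mult_right_mono) auto
  finally show ?thesis .
qed

text \<open>The extension has the degree of \<open>U\<close>, so that the quotient of
  \<open>U - V\<close> by it is constant on rays. The exponential gives slope \<open>- K\<close> in
  direction \<open>e\<close> at the equator, and for \<open>0 \<le> q \<le> 1/2\<close> the values
  on the closed hemisphere stay between 1/2 and 2 when \<open>K \<ge> 0\<close>.\<close>

definition barrier :: "real \<Rightarrow> (real \<Rightarrow> real) \<Rightarrow> 'a \<Rightarrow> 'a \<Rightarrow> real" where
  "barrier K q p x = norm x powr (-\<gamma>) *
     (1 + exp (- K * ((x \<bullet> e) * norm x powr (-1))) - q ((x \<bullet> p) * norm x powr (-1)))"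

lemma lap_at_barrier:
  fixes K :: real
  assumes p: "norm p = 1" and x: "norm x = 1"
    and q: "\<And>s. (q has_real_derivative q' s) (at s)"
    and q': "\<And>s. (q' has_real_derivative q'' s) (at s)"
  defines "b0 \<equiv> 1 + exp (- K * (x \<bullet> e)) - q (x \<bullet> p)"
  shows "lap_at (barrier K q p) x
     ((- K * exp (- K * (x \<bullet> e))) *\<^sub>R (e - (x \<bullet> e) *\<^sub>R x) - q' (x \<bullet> p) *\<^sub>R (p - (x \<bullet> p) *\<^sub>R x)
        - (\<gamma> * b0) *\<^sub>R x)
     (exp (- K * (x \<bullet> e)) * (K\<^sup>2 * (1 - (x \<bullet> e)\<^sup>2) + (real DIM('a) - 1) * (x \<bullet> e) * K)
        - (q'' (x \<bullet> p) * (1 - (x \<bullet> p)\<^sup>2) - (real DIM('a) - 1) * (x \<bullet> p) * q' (x \<bullet> p))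
        - \<gamma> * (real DIM('a) - 2 - \<gamma>) * b0)"
proof -
  have x0: "x \<noteq> 0" using x by auto
  have xx: "x \<bullet> x = 1" using x by (simp add: norm_eq_1)
  have E: "lap_at (\<lambda>x. exp (- K * ((x \<bullet> e) * norm x powr (-1)))) x
     ((- K * exp (- K * (x \<bullet> e))) *\<^sub>R (e - (x \<bullet> e) *\<^sub>R x))
     ((- K * (- K * exp (- K * (x \<bullet> e)))) * (1 - (x \<bullet> e)\<^sup>2)
        - (real DIM('a) - 1) * (x \<bullet> e) * (- K * exp (- K * (x \<bullet> e))))"
    by (rule lap_at_zonal[OF x e, where \<phi> = "\<lambda>s. exp (- K * s)"]) (auto intro!: derivative_eq_intros)
  note lapq = lap_at_zonal[OF x p q q']
  note B = lap_at_diff[OF lap_at_add[OF lap_at_const[of 1] E] lapq]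
  have perp: "x \<bullet> (a - (x \<bullet> a) *\<^sub>R x) = 0" for a by (simp add: inner_diff_right xx)
  have "lap_at (barrier K q p) x
    (1 *\<^sub>R (0 + (- K * exp (- K * (x \<bullet> e))) *\<^sub>R (e - (x \<bullet> e) *\<^sub>R x) - q' (x \<bullet> p) *\<^sub>R (p - (x \<bullet> p) *\<^sub>R x))
       + b0 *\<^sub>R (- \<gamma>) *\<^sub>R x)
    (1 * (0 + ((- K * (- K * exp (- K * (x \<bullet> e)))) * (1 - (x \<bullet> e)\<^sup>2)
        - (real DIM('a) - 1) * (x \<bullet> e) * (- K * exp (- K * (x \<bullet> e))))
        - (q'' (x \<bullet> p) * (1 - (x \<bullet> p)\<^sup>2) - (real DIM('a) - 1) * (x \<bullet> p) * q' (x \<bullet> p)))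
      + 2 * (((- \<gamma>) *\<^sub>R x) \<bullet> (0 + (- K * exp (- K * (x \<bullet> e))) *\<^sub>R (e - (x \<bullet> e) *\<^sub>R x)
           - q' (x \<bullet> p) *\<^sub>R (p - (x \<bullet> p) *\<^sub>R x)))
      + b0 * (- \<gamma> * (- \<gamma> + real DIM('a) - 2)))"
    using lap_at_mult[OF lap_at_norm_powr[OF x0, of "-\<gamma>"] B] x
    unfolding barrier_def[abs_def] b0_def by simp
  \<comment> \<open>The factor of degree 0 has a gradient tangential to the sphere, while the
    gradient of the power of the norm is radial, so the cross term drops out.\<close>
  moreover have "((- \<gamma>) *\<^sub>R x) \<bullet> (0 + (- K * exp (- K * (x \<bullet> e))) *\<^sub>R (e - (x \<bullet> e) *\<^sub>R x)
           - q' (x \<bullet> p) *\<^sub>R (p - (x \<bullet> p) *\<^sub>R x)) = 0"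
  proof -
    have "(c *\<^sub>R x) \<bullet> (0 + a *\<^sub>R u - b *\<^sub>R w) = 0" if "x \<bullet> u = 0" "x \<bullet> w = 0" for a b c u w
      using that by (simp add: inner_diff_right)
    then show ?thesis using perp by blast
  qed
  ultimately show ?thesis
    by (simp add: algebra_simps power2_eq_square xx)
qed

lemma barrier_hom:
  assumes "x \<noteq> 0" "c > 0"
  shows "barrier K q p (c *\<^sub>R x) = c powr (-\<gamma>) * barrier K q p x"
  using assms by (simp add: barrier_def powr_mult powr_minus field_simps)

lemma barrier_cont:
  assumes "continuous_on UNIV q"
  shows "continuous_on (- {0}) (barrier K q p)"
  unfolding barrier_def
  by (intro continuous_intros continuous_on_compose2[OF assms]) auto

definition cap_le :: "'a \<Rightarrow> real \<Rightarrow> bool" where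
  "cap_le p t \<longleftrightarrow> (\<forall>x\<in>hemisphere. t \<le> x \<bullet> p \<longrightarrow> U x \<le> V p t x)"

text \<open>One constant has to serve every direction, every cap and every profile \<open>q\<close>.
  The supersolution condition is imposed only on the strip between \<open>t\<close> and
  \<open>t1\<close>; beyond \<open>t1\<close> the comparison is already given. The strip is the
  whole cap at the start of the process and a thin layer along the cap boundary when it
  continues.\<close>

definition narrow_constant :: "real \<Rightarrow> bool" where
  "narrow_constant \<Lambda> \<longleftrightarrow> (\<forall>p t t1 q q' q''. norm p = 1 \<longrightarrow> p \<bullet> e = 0 \<longrightarrow> 0 \<le> t \<longrightarrow> t < 1 \<longrightarrow>
      (\<forall>s. (q has_real_derivative q' s) (at s)) \<longrightarrow> (\<forall>s. (q' has_real_derivative q'' s) (at s)) \<longrightarrow>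
      (\<forall>s. t \<le> s \<longrightarrow> s \<le> t1 \<longrightarrow> s \<le> 1 \<longrightarrow> 0 \<le> q s \<and> q s \<le> 1/2 \<and>
          \<Lambda> \<le> q'' s * (1 - s\<^sup>2) - (real DIM('a) - 1) * s * q' s) \<longrightarrow>
      (\<forall>x\<in>hemisphere. t1 < x \<bullet> p \<longrightarrow> U x \<le> V p t x) \<longrightarrow> cap_le p t)"

lemma narrow_constantD:
  assumes "narrow_constant \<Lambda>" "norm p = 1" "p \<bullet> e = 0" "0 \<le> t" "t < 1"
    "\<And>s. (q has_real_derivative q' s) (at s)" "\<And>s. (q' has_real_derivative q'' s) (at s)"
    "\<And>s. t \<le> s \<Longrightarrow> s \<le> t1 \<Longrightarrow> s \<le> 1 \<Longrightarrow> 0 \<le> q s \<and> q s \<le> 1/2 \<and>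
          \<Lambda> \<le> q'' s * (1 - s\<^sup>2) - (real DIM('a) - 1) * s * q' s"
    "\<And>x. x \<in> hemisphere \<Longrightarrow> t1 < x \<bullet> p \<Longrightarrow> U x \<le> V p t x"
  shows "cap_le p t"
  by (rule assms(1)[unfolded narrow_constant_def, rule_format]) (fact assms(2-5) assms(6) assms(7) | (rule assms(8,9); assumption))+

text \<open>The barrier is a strict supersolution for the linear inequality satisfied by \<open>U - V\<close>: the exponential
  takes care of the boundary condition, and \<open>q\<close> of the equation.\<close>

lemma narrow_region: "\<exists>\<Lambda>\<ge>1. narrow_constant \<Lambda>"
proof -
  obtain C where C: "C \<ge> 0"
    "\<And>x. x \<in> hemisphere \<Longrightarrow> \<bar>h (U x)\<bar> * (P * U x powr (P - 1)) \<le> C"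
    "\<And>x. x \<in> hemisphere \<Longrightarrow> k (U x) * (Q * U x powr (Q - 1)) \<le> C"
    using U_bounds by blast
  define N where "N = real DIM('a) - 1"
  have N: "N \<ge> 3" using dim by (simp add: N_def)
  \<comment> \<open>The barrier is at most 2, so the boundary term contributes at most
    \<open>2 * C\<close> per unit of \<kappa>, less than \<open>K\<close>. \<open>\<Lambda>\<close>
    below absorbs the Laplacian \<open>K\<^sup>2 + N * K\<close> of the exponential and the interior
    term \<open>2 * C\<close>, with 1 to spare.\<close>
  define K where "K = 2 * C + 1"
  have K: "K \<ge> 1" using C by (simp add: K_def)
  define \<Lambda> where "\<Lambda> = K\<^sup>2 + N * K + 2 * C + 1"
  show ?thesis
    unfolding narrow_constant_def cap_le_def
  proof (intro exI[of _ \<Lambda>] conjI allI impI ballI)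
    have "0 \<le> N * K" using N K by simp
    then show "\<Lambda> \<ge> 1" unfolding \<Lambda>_def using C by simp
    fix p :: 'a and t t1 :: real and q q' q'' :: "real \<Rightarrow> real" and x :: 'a
    assume p: "norm p = 1" "p \<bullet> e = 0" and t: "0 \<le> t" "t < 1"
      and "\<forall>s. (q has_real_derivative q' s) (at s)" "\<forall>s. (q' has_real_derivative q'' s) (at s)"
      and "\<forall>s. t \<le> s \<longrightarrow> s \<le> t1 \<longrightarrow> s \<le> 1 \<longrightarrow> 0 \<le> q s \<and> q s \<le> 1/2 \<and>
          \<Lambda> \<le> q'' s * (1 - s\<^sup>2) - (real DIM('a) - 1) * s * q' s"
      and "\<forall>x\<in>hemisphere. t1 < x \<bullet> p \<longrightarrow> U x \<le> V p t x"
      and x: "x \<in> hemisphere" "t \<le> x \<bullet> p"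
    then have q: "\<And>s. (q has_real_derivative q' s) (at s)" and q': "\<And>s. (q' has_real_derivative q'' s) (at s)"
      and good: "\<And>s. t \<le> s \<Longrightarrow> s \<le> t1 \<Longrightarrow> s \<le> 1 \<Longrightarrow> 0 \<le> q s \<and> q s \<le> 1/2 \<and>
          \<Lambda> \<le> q'' s * (1 - s\<^sup>2) - (real DIM('a) - 1) * s * q' s"
      and outer: "\<And>x. x \<in> hemisphere \<Longrightarrow> t1 < x \<bullet> p \<Longrightarrow> U x \<le> V p t x"
      by blast+
    let ?V = "V p t" and ?\<Psi> = "barrier K q p"
    define W where "W = (\<lambda>x. U x - ?V x)"
    have qc: "continuous_on UNIV q" using q
      by (meson DERIV_isCont continuous_at_imp_continuous_on)
    have p1: "x \<bullet> p \<le> 1" if "norm x = 1" for x using norm_cauchy_schwarz[of x p] that p by simp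
    let ?D = "hemisphere \<inter> {x. t \<le> x \<bullet> p \<and> x \<bullet> p \<le> t1}"
    have D_sub: "?D \<subseteq> closed_cone" "?D \<subseteq> - {0}" by auto
    have \<Psi>_sphere: "?\<Psi> x = 1 + exp (- K * (x \<bullet> e)) - q (x \<bullet> p)" if "norm x = 1" for x
      using that by (simp add: barrier_def)
    have \<Psi>_range: "1/2 \<le> ?\<Psi> x \<and> ?\<Psi> x \<le> 2" if x: "x \<in> ?D" for x
    proof -
      have "0 \<le> q (x \<bullet> p)" "q (x \<bullet> p) \<le> 1/2" using good[of "x \<bullet> p"] x p1[of x] by auto
      moreover have "exp (- K * (x \<bullet> e)) \<le> 1" using K x by simp
      moreover have "exp (- K * (x \<bullet> e)) > 0" by simp
      ultimately show ?thesis using \<Psi>_sphere[of x] x by (simp del: exp_gt_zero exp_le_one_iff)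
    qed
    have W_cont: "continuous_on closed_cone W" unfolding W_def
      by (intro continuous_intros U_cont V_cont[OF p t])
    have W_hom: "W (c *\<^sub>R x) = c powr (-\<gamma>) * W x" if "x \<in> closed_cone" "c > 0" for x c
      using that U_hom[of x c] V_hom[OF p t that] by (simp add: W_def algebra_simps)
    show "U x \<le> V p t x"
    proof (rule ccontr)
      assume "\<not> ?thesis"
      then have Wx: "W x > 0" by (simp add: W_def)
      then have xD: "x \<in> ?D" using x outer[of x] by (force simp: W_def)
      \<comment> \<open>At a maximum of the quotient, \<kappa> being its value,
        \<open>W - \<kappa> * ?\<Psi>\<close> vanishes and is locally maximal in the closed half
        space. This works without a sign condition on the zero-order coefficient of the inequality
        for \<open>W\<close>.\<close>
      have "\<exists>y\<in>?D. \<forall>x\<in>?D. W x / ?\<Psi> x \<le> W y / ?\<Psi> y"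
      proof (rule continuous_attains_sup)
        have "closed {x. t \<le> x \<bullet> p \<and> x \<bullet> p \<le> t1}"
          by (intro closed_Collect_conj closed_Collect_le continuous_intros)
        then show "compact ?D" using compact_hemisphere by (rule compact_Int_closed[rotated])
        show "?D \<noteq> {}" using xD by blast
        show "continuous_on ?D (\<lambda>x. W x / ?\<Psi> x)"
          using \<Psi>_range
          by (intro continuous_on_divide continuous_on_subset[OF W_cont D_sub(1)]
               continuous_on_subset[OF barrier_cont[OF qc] D_sub(2)]) force
      qed
      then obtain y where y: "y \<in> ?D" "\<And>x. x \<in> ?D \<Longrightarrow> W x / ?\<Psi> x \<le> W y / ?\<Psi> y" by blast
      define \<kappa> where "\<kappa> = W y / ?\<Psi> y"
      have \<Psi>y: "1/2 \<le> ?\<Psi> y" "?\<Psi> y \<le> 2" using \<Psi>_range[OF y(1)] by auto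
      have "0 < W x / ?\<Psi> x" using Wx \<Psi>_range[OF xD] by (intro divide_pos_pos) auto
      then have \<kappa>: "\<kappa> > 0" using y(2)[OF xD] unfolding \<kappa>_def by linarith
      have Wy: "W y = \<kappa> * ?\<Psi> y" using \<Psi>y by (simp add: \<kappa>_def)
      have Wy_pos: "W y > 0" using Wy \<kappa> \<Psi>y by simp
      have yn: "norm y = 1" "0 \<le> y \<bullet> e" "t \<le> y \<bullet> p" "y \<bullet> p \<le> t1" "y \<in> hemisphere" using y(1) by auto
      have y0: "y \<noteq> 0" using yn by auto
      have "y \<bullet> p \<noteq> t"
      proof
        assume "y \<bullet> p = t"
        then have "cap_inv p t y = y" using yn by (intro cap_inv_fixed) simp
        then show False using Wy_pos by (simp add: W_def)
      qed
      then have yt: "t < y \<bullet> p" using yn by simp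
      \<comment> \<open>Equal degrees reduce the claim at \<open>x\<close> to its projection on the
        sphere. There it follows from maximality inside the strip, and beyond the strip from
        \<open>W \<le> 0\<close>. The latter case is needed because \<open>y\<close> may lie on the
        edge \<open>y \<bullet> p = t1\<close>.\<close>
      have near: "\<forall>\<^sub>F x in nhds y. 0 \<le> x \<bullet> e \<longrightarrow> W x - \<kappa> * ?\<Psi> x \<le> 0"
      proof -
        have "\<forall>\<^sub>F x in nhds y. x \<in> {x. t * norm x < x \<bullet> p}"
          using yt yn by (intro eventually_nhds_in_open open_Collect_less continuous_intros) auto
        moreover have "\<forall>\<^sub>F x in nhds y. x \<in> - {0}" using y0 by (intro eventually_nhds_in_open) auto
        moreover have "\<forall>\<^sub>F x in nhds y. x \<in> {x \<in> - {0}. 0 < ?\<Psi> x}"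
        proof (rule eventually_nhds_in_open)
          have "open (- {0::'a} \<inter> ?\<Psi> -` {0<..})"
            by (rule continuous_open_preimage[OF barrier_cont[OF qc]]) auto
          moreover have "- {0::'a} \<inter> ?\<Psi> -` {0<..} = {x \<in> - {0}. 0 < ?\<Psi> x}" by auto
          ultimately show "open {x \<in> - {0}. 0 < ?\<Psi> x}" by simp
          show "y \<in> {x \<in> - {0}. 0 < ?\<Psi> x}" using y0 \<Psi>y by auto
        qed
        ultimately show ?thesis
        proof eventually_elim
          case (elim x)
          show ?case
          proof
            assume xe: "0 \<le> x \<bullet> e"
            have xc: "x \<in> closed_cone" using elim xe by auto
            define w where "w = (1 / norm x) *\<^sub>R x"
            have nx: "norm x > 0" using xc by auto
            have xw: "x = norm x *\<^sub>R w" using nx by (simp add: w_def)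
            have w: "norm w = 1" "0 \<le> w \<bullet> e" "t \<le> w \<bullet> p"
              using nx xe elim(1) by (auto simp: w_def field_simps)
            have wc: "w \<in> closed_cone" using w by auto
            have \<Psi>w: "?\<Psi> x = norm x powr (-\<gamma>) * ?\<Psi> w"
              using barrier_hom[of w "norm x" K q p] wc nx xw by simp
            have "0 < norm x powr (-\<gamma>)" using nx by simp
            then have \<Psi>w0: "?\<Psi> w > 0" using elim(3) \<Psi>w by (simp add: zero_less_mult_iff)
            have "W w \<le> \<kappa> * ?\<Psi> w"
            proof (cases "w \<bullet> p \<le> t1")
              case True
              then have "W w / ?\<Psi> w \<le> \<kappa>" unfolding \<kappa>_def using w y(2) by auto
              then show ?thesis using \<Psi>w0 by (simp add: divide_le_eq)
            next
              case False
              then have "W w \<le> 0" using outer[of w] w by (simp add: W_def)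
              also have "0 \<le> \<kappa> * ?\<Psi> w" using \<kappa> \<Psi>w0 by simp
              finally show ?thesis .
            qed
            then have "norm x powr (-\<gamma>) * W w \<le> norm x powr (-\<gamma>) * (\<kappa> * ?\<Psi> w)"
              by (intro mult_left_mono) auto
            then show "W x - \<kappa> * ?\<Psi> x \<le> 0"
              using \<Psi>w W_hom[OF wc nx] xw by (simp add: mult.left_commute)
          qed
        qed
      qed
      have Vlt: "?V y < U y" using Wy_pos by (simp add: W_def)
      have gy: "\<Lambda> \<le> q'' (y \<bullet> p) * (1 - (y \<bullet> p)\<^sup>2) - N * (y \<bullet> p) * q' (y \<bullet> p)"
        using good[of "y \<bullet> p"] yn p1[of y] by (auto simp: N_def)
      note lapB = lap_at_barrier[OF p(1) yn(1) q q', where K = K, folded N_def, folded \<Psi>_sphere[OF yn(1)]]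
      show False
      proof (cases "y \<bullet> e > 0")
        case True
        obtain g1 where g1: "lap_at U y g1 (- (h (norm y powr \<gamma> * U y) * U y powr P))"
          using U_lap[OF True] by blast
        obtain g2 where g2: "lap_at ?V y g2 (- (h (norm (cap_inv p t y) powr \<gamma> * ?V y) * ?V y powr P))"
          using V_lap[OF p t True] by blast
        note lapW = lap_at_diff[OF lap_at_diff[OF g1 g2] lap_at_cmult[OF lapB, of \<kappa>]]
        have "\<forall>\<^sub>F x in nhds y. (U x - ?V x) - \<kappa> * ?\<Psi> x \<le> (U y - ?V y) - \<kappa> * ?\<Psi> y"
          using near ev_H[OF True] by eventually_elim (use Wy in \<open>auto simp: W_def\<close>)
        from lap_at_local_max[OF lapW this]
        have "- (h (U y) * U y powr P) + h (norm (cap_inv p t y) powr \<gamma> * ?V y) * ?V y powr P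
          - \<kappa> * (exp (- K * (y \<bullet> e)) * (K\<^sup>2 * (1 - (y \<bullet> e)\<^sup>2) + N * (y \<bullet> e) * K)
            - (q'' (y \<bullet> p) * (1 - (y \<bullet> p)\<^sup>2) - N * (y \<bullet> p) * q' (y \<bullet> p))
            - \<gamma> * (real DIM('a) - 2 - \<gamma>) * ?\<Psi> y) \<le> 0"
          using yn by simp
        moreover have "h (U y) * U y powr P - h (norm (cap_inv p t y) powr \<gamma> * ?V y) * ?V y powr P
          \<le> C * (U y - ?V y)"
          by (rule lap_difference_le[OF p t yn(1-3) Vlt C(2)[OF yn(5)]])
        moreover have "C * (U y - ?V y) \<le> \<kappa> * (2 * C)"
        proof -
          have "C * (U y - ?V y) = \<kappa> * (C * ?\<Psi> y)" using Wy by (simp add: W_def)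
          also have "\<dots> \<le> \<kappa> * (C * 2)" using \<kappa> C(1) \<Psi>y by (intro mult_left_mono) auto
          finally show ?thesis by simp
        qed
        moreover have "exp (- K * (y \<bullet> e)) * (K\<^sup>2 * (1 - (y \<bullet> e)\<^sup>2) + N * (y \<bullet> e) * K)
            - (q'' (y \<bullet> p) * (1 - (y \<bullet> p)\<^sup>2) - N * (y \<bullet> p) * q' (y \<bullet> p))
            - \<gamma> * (real DIM('a) - 2 - \<gamma>) * ?\<Psi> y \<le> - (2 * C + 1)"
        proof -
          have ye: "y \<bullet> e \<le> 1" using norm_cauchy_schwarz[of y e] yn e by simp
          have sq: "(y \<bullet> e)\<^sup>2 \<le> 1" using ye yn(2) by (simp add: power_le_one)
          have "K\<^sup>2 * (1 - (y \<bullet> e)\<^sup>2) \<le> K\<^sup>2 * 1" by (intro mult_left_mono) auto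
          moreover have "N * (y \<bullet> e) * K \<le> N * 1 * K" using N K ye by (intro mult_right_mono mult_left_mono) auto
          ultimately have "K\<^sup>2 * (1 - (y \<bullet> e)\<^sup>2) + N * (y \<bullet> e) * K \<le> K\<^sup>2 + N * K" by simp
          moreover have "0 \<le> K\<^sup>2 * (1 - (y \<bullet> e)\<^sup>2) + N * (y \<bullet> e) * K"
            using sq N K yn by (intro add_nonneg_nonneg mult_nonneg_nonneg) auto
          moreover have "exp (- K * (y \<bullet> e)) \<le> 1" using K yn by simp
          ultimately have "exp (- K * (y \<bullet> e)) * (K\<^sup>2 * (1 - (y \<bullet> e)\<^sup>2) + N * (y \<bullet> e) * K) \<le> 1 * (K\<^sup>2 + N * K)"
            by (intro mult_mono) auto
          moreover have "0 \<le> \<gamma> * (real DIM('a) - 2 - \<gamma>) * ?\<Psi> y"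
            using \<gamma>_pos \<gamma> dim \<Psi>y by (intro mult_nonneg_nonneg) auto
          moreover have "a - d - c \<le> - (2 * C + 1)" if "a \<le> 1 * b" "0 \<le> c" "b + 2 * C + 1 \<le> d" for a b c d :: real
            using that by linarith
          ultimately show ?thesis using gy unfolding \<Lambda>_def by blast
        qed
        then have "\<kappa> * (exp (- K * (y \<bullet> e)) * (K\<^sup>2 * (1 - (y \<bullet> e)\<^sup>2) + N * (y \<bullet> e) * K)
            - (q'' (y \<bullet> p) * (1 - (y \<bullet> p)\<^sup>2) - N * (y \<bullet> p) * q' (y \<bullet> p))
            - \<gamma> * (real DIM('a) - 2 - \<gamma>) * ?\<Psi> y) \<le> \<kappa> * (- (2 * C + 1))"
          using \<kappa> by (intro mult_left_mono) auto
        then have "\<kappa> * (exp (- K * (y \<bullet> e)) * (K\<^sup>2 * (1 - (y \<bullet> e)\<^sup>2) + N * (y \<bullet> e) * K)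
            - (q'' (y \<bullet> p) * (1 - (y \<bullet> p)\<^sup>2) - N * (y \<bullet> p) * q' (y \<bullet> p))
            - \<gamma> * (real DIM('a) - 2 - \<gamma>) * ?\<Psi> y) \<le> - (\<kappa> * (2 * C)) - \<kappa>"
          by (simp add: algebra_simps)
        ultimately show False using \<kappa> by linarith
      next
        case False
        then have ye: "y \<bullet> e = 0" using yn by simp
        have d1: "((\<lambda>s. U (y + s *\<^sub>R e)) has_real_derivative - (k (U y) * U y powr Q)) (at_right 0)"
          using U_bdry[OF ye y0] yn by simp
        note d2 = V_bdry[OF p t ye yn(1)]
        \<comment> \<open>At an equatorial point \<open>y\<close> and \<open>p\<close> are
          orthogonal to \<open>e\<close>, so only the exponential contributes.\<close>
        have d3: "((\<lambda>s. ?\<Psi> (y + s *\<^sub>R e)) has_real_derivative - K) (at_right 0)"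
        proof -
          have "((\<lambda>s. ?\<Psi> (y + s *\<^sub>R e)) has_real_derivative
             ((- K * exp (- K * (y \<bullet> e))) *\<^sub>R (e - (y \<bullet> e) *\<^sub>R y) - q' (y \<bullet> p) *\<^sub>R (p - (y \<bullet> p) *\<^sub>R y)
                 - (\<gamma> * ?\<Psi> y) *\<^sub>R y) \<bullet> e) (at_right 0)"
            by (rule lap_at_line_derivative[OF lapB])
          then show ?thesis by (simp add: inner_diff_left ye ee p(2))
        qed
        have "((\<lambda>s. U (y + s *\<^sub>R e) - ?V (y + s *\<^sub>R e) - \<kappa> * ?\<Psi> (y + s *\<^sub>R e)) has_real_derivative
          - (k (U y) * U y powr Q) - (- (k (norm (cap_inv p t y) powr \<gamma> * ?V y) * ?V y powr Q)) - \<kappa> * (- K)) (at_right 0)"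
          by (intro DERIV_diff DERIV_cmult d1 d2 d3)
        then have lim: "((\<lambda>s. (W (y + s *\<^sub>R e) - \<kappa> * ?\<Psi> (y + s *\<^sub>R e)) / s) \<longlongrightarrow>
          - (k (U y) * U y powr Q) - (- (k (norm (cap_inv p t y) powr \<gamma> * ?V y) * ?V y powr Q)) - \<kappa> * (- K)) (at_right 0)"
          using Wy unfolding has_field_derivative_iff W_def by simp
        have "((\<lambda>s. y + s *\<^sub>R e) \<longlongrightarrow> y + 0 *\<^sub>R e) (at_right 0)" by (intro tendsto_intros)
        then have "filterlim (\<lambda>s. y + s *\<^sub>R e) (nhds y) (at_right 0)" by simp
        then have "\<forall>\<^sub>F s in at_right 0. 0 \<le> (y + s *\<^sub>R e) \<bullet> e \<longrightarrow> W (y + s *\<^sub>R e) - \<kappa> * ?\<Psi> (y + s *\<^sub>R e) \<le> 0"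
          using near unfolding filterlim_iff by blast
        moreover have "\<forall>\<^sub>F s in at_right 0. s \<in> {0::real<..<1}" by (rule eventually_at_right_real) simp
        ultimately have "\<forall>\<^sub>F s in at_right 0. (W (y + s *\<^sub>R e) - \<kappa> * ?\<Psi> (y + s *\<^sub>R e)) / s \<le> 0"
          by eventually_elim (auto simp: inner_add_left ye ee divide_nonpos_pos)
        from tendsto_upperbound[OF lim this]
        have "\<kappa> * K \<le> k (U y) * U y powr Q - k (norm (cap_inv p t y) powr \<gamma> * ?V y) * ?V y powr Q"
          by simp
        also have "\<dots> \<le> C * (U y - ?V y)"
          by (rule bdry_difference_le[OF p t yn(1-3) Vlt C(3)[OF yn(5)]])
        also have "\<dots> = \<kappa> * (C * ?\<Psi> y)" using Wy by (simp add: W_def)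
        also have "\<dots> \<le> \<kappa> * (C * 2)" using \<kappa> C(1) \<Psi>y by (intro mult_left_mono) auto
        finally have "K \<le> C * 2" using \<kappa> by simp
        then show False unfolding K_def by simp
      qed
    qed
  qed
qed

section \<open>Strict inequality inside a cap\<close>

lemma normalize_cone:
  assumes "x \<in> closed_cone"
  obtains w where "w \<in> hemisphere" "x = norm x *\<^sub>R w" "norm x > 0" "x \<bullet> p = norm x * (w \<bullet> p)"
    "x \<bullet> e = norm x * (w \<bullet> e)"
proof (rule that[of "(1 / norm x) *\<^sub>R x"])
  show "(1 / norm x) *\<^sub>R x \<in> hemisphere" using assms by auto
qed (use assms in auto)

lemma cap_le_cone:
  assumes p: "norm p = 1" "p \<bullet> e = 0" and t: "0 \<le> t" "t < 1" and le: "cap_le p t"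
    and x: "x \<in> closed_cone" "t * norm x \<le> x \<bullet> p"
  shows "U x \<le> V p t x"
proof -
  obtain w where w: "w \<in> hemisphere" "x = norm x *\<^sub>R w" "norm x > 0" "x \<bullet> p = norm x * (w \<bullet> p)"
      "x \<bullet> e = norm x * (w \<bullet> e)"
    by (rule normalize_cone[OF x(1), where p = p])
  have "t \<le> w \<bullet> p" using x(2) w by (simp add: mult.commute)
  then have le: "U w \<le> V p t w" using le w unfolding cap_le_def by blast
  have wc: "w \<in> closed_cone" using w by auto
  have "U (norm x *\<^sub>R w) \<le> V p t (norm x *\<^sub>R w)"
    using U_hom[of w "norm x"] V_hom[OF p t wc w(3)] wc w(3) le by simp
  then show ?thesis using w(2) by simp
qed

text \<open>At an interior contact point the Laplacians compare to
  \<open>h (norm (cap_inv p t x) powr \<gamma> * U x) \<le> h (U x)\<close>. The image of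
  \<open>x\<close> has norm below 1, so strict decrease of \<open>h\<close> contradicts this at the
  single point; no propagation of the contact set is required.\<close>

lemma cap_strict_interior:
  assumes p: "norm p = 1" "p \<bullet> e = 0" and t: "0 < t" "t < 1" and le: "cap_le p t"
    and x: "norm x = 1" "0 < x \<bullet> e" "t < x \<bullet> p"
  shows "U x < V p t x"
proof (rule ccontr)
  assume "\<not> ?thesis"
  have t0: "0 \<le> t" using t by simp
  have xc: "x \<in> closed_cone" using x by auto
  have "U x \<le> V p t x" using cap_le_cone[OF p t0 t(2) le xc] x by simp
  with \<open>\<not> ?thesis\<close> have eq: "V p t x = U x" by simp
  obtain g1 where g1: "lap_at U x g1 (- (h (norm x powr \<gamma> * U x) * U x powr P))"
    using U_lap[OF x(2)] by blast
  obtain g2 where g2: "lap_at (V p t) x g2 (- (h (norm (cap_inv p t x) powr \<gamma> * V p t x) * V p t x powr P))"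
    using V_lap[OF p t0 t(2) x(2)] by blast
  have "\<forall>\<^sub>F y in nhds x. y \<in> {y. t * norm y < y \<bullet> p}"
    using x by (intro eventually_nhds_in_open open_Collect_less continuous_intros) auto
  then have "\<forall>\<^sub>F y in nhds x. U y - V p t y \<le> U x - V p t x"
    using ev_H[OF x(2)]
  proof eventually_elim
    case (elim y)
    then have "U y \<le> V p t y" by (intro cap_le_cone[OF p t0 t(2) le]) auto
    then show ?case using eq by simp
  qed
  from lap_at_local_max[OF lap_at_diff[OF g1 g2] this]
  have "h (norm (cap_inv p t x) powr \<gamma> * U x) * U x powr P \<le> h (U x) * U x powr P"
    using x eq by simp
  moreover have Ux: "U x > 0" using U_pos xc by blast
  ultimately have "h (norm (cap_inv p t x) powr \<gamma> * U x) \<le> h (U x)" by simp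
  moreover have "h (U x) < h (norm (cap_inv p t x) powr \<gamma> * U x)"
  proof (rule h_dec)
    have "norm (cap_inv p t x) < 1" using norm_cap_inv_less[OF p(1) t, of x] x by simp
    moreover have pos: "norm (cap_inv p t x) > 0" using cap_inv_nonzero[OF p(1) t0 t(2), of x] xc by simp
    ultimately have "norm (cap_inv p t x) powr \<gamma> < 1"
      using \<gamma>_pos powr_less_mono2[of \<gamma> "norm (cap_inv p t x)" 1] by simp
    then show "norm (cap_inv p t x) powr \<gamma> * U x < U x" using Ux by simp
    show "0 < norm (cap_inv p t x) powr \<gamma> * U x" using pos Ux by simp
  qed
  ultimately show False by simp
qed

text \<open>At an equatorial contact point strict decrease of \<open>h\<close> makes
  \<open>V - U\<close> superharmonic in a small tangent ball. Hopf's lemma then forces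
  \<open>k\<close> at the smaller argument to be strictly smaller, against its monotonicity.\<close>

lemma cap_strict:
  assumes p: "norm p = 1" "p \<bullet> e = 0" and t: "0 < t" "t < 1" and le: "cap_le p t"
    and x: "norm z = 1" "0 \<le> z \<bullet> e" "t < z \<bullet> p"
  shows "U z < V p t z"
proof (cases "z \<bullet> e > 0")
  case True
  then show ?thesis using cap_strict_interior[OF p t le] x by blast
next
  case False
  then have ze: "z \<bullet> e = 0" using x by simp
  have t0: "0 \<le> t" using t by simp
  have zc: "z \<in> closed_cone" using x by auto
  show ?thesis
  proof (rule ccontr)
    assume "\<not> ?thesis"
    moreover have "U z \<le> V p t z" using cap_le_cone[OF p t0 t(2) le zc] x by simp
    ultimately have eq: "V p t z = U z" by simp
    have Uz: "U z > 0" using U_pos zc by blast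
    have n1: "norm (cap_inv p t z) < 1" using norm_cap_inv_less[OF p(1) t, of z] x by simp
    have n0: "norm (cap_inv p t z) > 0" using cap_inv_nonzero[OF p(1) t0 t(2), of z] zc by simp
    have c1: "norm (cap_inv p t z) powr \<gamma> < 1"
      using n0 n1 \<gamma>_pos powr_less_mono2[of \<gamma> "norm (cap_inv p t z)" 1] by simp
    have lt: "norm (cap_inv p t z) powr \<gamma> * U z < U z" using c1 Uz by simp
    have gt: "0 < norm (cap_inv p t z) powr \<gamma> * U z" using n0 Uz by simp
    define R where "R = (\<lambda>x. h (norm x powr \<gamma> * U x) * U x powr P)"
    \<comment> \<open>\<open>S\<close> is the Laplacian of \<open>V - U\<close>. It is negative at
      \<open>z\<close> and continuous up to the equator, hence negative nearby, even where the sign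
      of the nonlinear difference is not otherwise known.\<close>
    define S where "S = (\<lambda>x. R x - R (cap_inv p t x))"
    have Rc: "continuous_on closed_cone R" unfolding R_def by (rule rhs_cont)
    have RX: "continuous_on closed_cone (\<lambda>x. R (cap_inv p t x))"
      by (rule continuous_on_compose2[OF Rc cap_inv_cont]) (use cap_inv_cone[OF p t0 t(2)] in auto)
    have Sc: "continuous_on closed_cone S" unfolding S_def by (intro continuous_intros Rc RX)
    have "S z < 0"
    proof -
      have "h (U z) < h (norm (cap_inv p t z) powr \<gamma> * U z)" by (rule h_dec[OF gt lt])
      then show ?thesis using Uz eq x by (simp add: S_def R_def)
    qed
    then obtain d1 where d1: "d1 > 0" "\<And>x. x \<in> closed_cone \<Longrightarrow> dist x z < d1 \<Longrightarrow> dist (S x) (S z) < - S z"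
      using Sc[unfolded continuous_on_iff, rule_format, OF zc, of "- S z"] by auto
    have "open {x. t * norm x < x \<bullet> p}" by (intro open_Collect_less continuous_intros)
    moreover have "z \<in> {x. t * norm x < x \<bullet> p}" using x by simp
    ultimately obtain d2 where d2: "d2 > 0" "ball z d2 \<subseteq> {x. t * norm x < x \<bullet> p}"
      by (meson open_contains_ball)
    \<comment> \<open>The tangent ball lies within distance \<open>2 * r\<close> of
      \<open>z\<close>, so quarters of \<open>d1\<close> and \<open>d2\<close> suffice.\<close>
    define r where "r = min (1/4) (min (d1/4) (d2/4))"
    have r: "r > 0" "r \<le> 1/4" "r \<le> d1/4" "r \<le> d2/4" using d1 d2 unfolding r_def by auto
    let ?a = "z + r *\<^sub>R e"
    have in_cb: "x \<in> closed_cone \<and> dist x z < d1 \<and> t * norm x < x \<bullet> p" if xb: "x \<in> cball ?a r" for x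
    proof -
      have "dist x z \<le> dist x ?a + dist ?a z" by (rule dist_triangle)
      also have "dist ?a z = r" using e r by (simp add: dist_norm)
      also have "dist x ?a \<le> r" using xb by (simp add: dist_commute)
      finally have dz: "dist x z \<le> 2 * r" by simp
      have xe: "0 \<le> x \<bullet> e" and "x \<noteq> 0" using tangent_ball(2,3)[OF e ze r(1) xb] zc by auto
      moreover have "x \<in> ball z d2" using dz r(1,4) by (simp add: dist_commute)
      then have "t * norm x < x \<bullet> p" using d2(2) by blast
      moreover have "dist x z < d1" using dz r(1,3) by simp
      ultimately show ?thesis using xe by auto
    qed
    have cb_sub: "cball ?a r \<subseteq> closed_cone" using in_cb by blast
    note xe_pos = tangent_ball(1)[OF e ze r(1)]
    have "((\<lambda>s. V p t (z + s *\<^sub>R e) - U (z + s *\<^sub>R e)) has_real_derivative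
       - (k (norm (cap_inv p t z) powr \<gamma> * V p t z) * V p t z powr Q)
       - (- (k (norm z powr \<gamma> * U z) * U z powr Q))) (at_right 0)"
      using zc by (intro DERIV_diff V_bdry[OF p t0 t(2) ze x(1)] U_bdry[OF ze]) auto
    then have "- (k (norm (cap_inv p t z) powr \<gamma> * V p t z) * V p t z powr Q)
       - (- (k (norm z powr \<gamma> * U z) * U z powr Q)) > 0"
    proof (rule hopf_boundary_derivative[OF e r(1), rotated -1])
      show "continuous_on (cball ?a r) (\<lambda>x. V p t x - U x)"
        by (intro continuous_intros continuous_on_subset[OF V_cont[OF p t0 t(2)] cb_sub]
            continuous_on_subset[OF U_cont cb_sub])
      show "V p t z - U z = 0" using eq by simp
      show "0 < V p t x - U x" if xb: "x \<in> ball ?a r" for x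
      proof -
        have xi: "x \<in> closed_cone" "t * norm x < x \<bullet> p" using in_cb[of x] xb by auto
        obtain w where w: "w \<in> hemisphere" "x = norm x *\<^sub>R w" "norm x > 0" "x \<bullet> p = norm x * (w \<bullet> p)"
            "x \<bullet> e = norm x * (w \<bullet> e)"
          by (rule normalize_cone[OF xi(1), where p = p])
        have "0 < w \<bullet> e" using xe_pos[OF xb] w(3,5) by (simp add: zero_less_mult_iff)
        moreover have "t < w \<bullet> p" using xi(2) w(3,4) by (simp add: mult.commute)
        ultimately have lt: "U w < V p t w" using w cap_strict_interior[OF p t le] by blast
        have wc: "w \<in> closed_cone" using w by auto
        have "norm x powr (-\<gamma>) > 0" using w(3) by simp
        then have "norm x powr (-\<gamma>) * U w < norm x powr (-\<gamma>) * V p t w" using lt by simp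
        moreover have "U (norm x *\<^sub>R w) = norm x powr (-\<gamma>) * U w"
          using wc w(3) by (intro U_hom) auto
        ultimately have "U (norm x *\<^sub>R w) < V p t (norm x *\<^sub>R w)"
          using V_hom[OF p t0 t(2) wc w(3)] by linarith
        then show ?thesis unfolding w(2)[symmetric] by linarith
      qed
      show "superharmonic_on (ball ?a r) (\<lambda>x. V p t x - U x)"
        unfolding superharmonic_on_def
      proof
        fix x assume xb: "x \<in> ball ?a r"
        obtain g1 where g1: "lap_at U x g1 (- (h (norm x powr \<gamma> * U x) * U x powr P))"
          using U_lap[OF xe_pos[OF xb]] by blast
        obtain g2 where g2: "lap_at (V p t) x g2 (- (h (norm (cap_inv p t x) powr \<gamma> * V p t x) * V p t x powr P))"
          using V_lap[OF p t0 t(2) xe_pos[OF xb]] by blast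
        have "dist (S x) (S z) < - S z" using in_cb[of x] xb d1(2) by auto
        then have "S x < 0" by (simp add: dist_real_def)
        then show "\<exists>g L. lap_at (\<lambda>x. V p t x - U x) x g L \<and> L \<le> 0"
          using lap_at_diff[OF g2 g1] by (intro exI conjI) (auto simp: S_def R_def)
      qed
    qed
    then have "k (norm (cap_inv p t z) powr \<gamma> * U z) * U z powr Q < k (U z) * U z powr Q"
      using eq x by simp
    moreover have "k (U z) \<le> k (norm (cap_inv p t z) powr \<gamma> * U z)"
      using k_noninc[OF gt] lt by simp
    ultimately show False using Uz by (simp add: mult_le_cancel_right)
  qed
qed

section \<open>Continuity argument in the size of the cap\<close>

lemma V_cont_joint:
  assumes p: "norm p = 1" "p \<bullet> e = 0"
  shows "continuous_on ({0..<1} \<times> closed_cone) (\<lambda>(t, x). V p t x)"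
proof -
  have nz: "1 - t\<^sup>2 \<noteq> 0" if "0 \<le> t" "t < 1" for t :: real
    using that abs_square_less_1[of t] by auto
  have "continuous_on ({0..<1} \<times> closed_cone) (\<lambda>z. cap_inv p (fst z) (snd z))"
    unfolding cap_inv_def cap_shift_def by (intro continuous_intros) (use nz in force)
  then have "continuous_on ({0..<1} \<times> closed_cone) (\<lambda>z. U (cap_inv p (fst z) (snd z)))"
    by (rule continuous_on_compose2[OF U_cont]) (use cap_inv_cone[OF p] in auto)
  then show ?thesis by (simp add: case_prod_beta)
qed

text \<open>The profile \<open>\<Lambda> * (1 - s)\<close> is at most 1/2 for
  \<open>s \<ge> 1 - 1 / (2 * \<Lambda>)\<close>, and its drift term alone,
  \<open>N * s * \<Lambda>\<close> with \<open>N \<ge> 3\<close> and \<open>s \<ge> 1/2\<close>,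
  exceeds \<open>\<Lambda>\<close>. The strip reaches the centre of the cap, so nothing is left
  beyond it.\<close>

lemma cap_start:
  assumes p: "norm p = 1" "p \<bullet> e = 0"
  obtains t0 where "0 \<le> t0" "t0 < 1" "\<And>t. t0 \<le> t \<Longrightarrow> t < 1 \<Longrightarrow> cap_le p t"
proof -
  obtain \<Lambda> where \<Lambda>: "\<Lambda> \<ge> 1" and narrow: "narrow_constant \<Lambda>" using narrow_region by blast
  define N where "N = real DIM('a) - 1"
  have N: "N \<ge> 3" using dim by (simp add: N_def)
  show ?thesis
  proof (rule that[of "1 - 1 / (2 * \<Lambda>)"])
    show "0 \<le> 1 - 1 / (2 * \<Lambda>)" "1 - 1 / (2 * \<Lambda>) < 1" using \<Lambda> by (auto simp: field_simps)
    fix t assume t: "1 - 1 / (2 * \<Lambda>) \<le> t" "t < 1"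
    have half: "1/2 \<le> 1 - 1 / (2 * \<Lambda>)" using \<Lambda> by (simp add: field_simps)
    have t0: "0 \<le> t" using t half by linarith
    show "cap_le p t"
      proof (rule narrow_constantD[OF narrow p t0 t(2), of "\<lambda>s. \<Lambda> * (1 - s)" "\<lambda>s. - \<Lambda>" "\<lambda>s. 0" 1])
        show "((\<lambda>s. \<Lambda> * (1 - s)) has_real_derivative - \<Lambda>) (at s)" for s
          by (auto intro!: derivative_eq_intros)
        show "((\<lambda>s. - \<Lambda>) has_real_derivative 0) (at s)" for s by simp
        show "0 \<le> \<Lambda> * (1 - s) \<and> \<Lambda> * (1 - s) \<le> 1/2 \<and>
          \<Lambda> \<le> 0 * (1 - s\<^sup>2) - (real DIM('a) - 1) * s * - \<Lambda>" if "t \<le> s" "s \<le> 1" for s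
        proof -
          have "1 - s \<le> 1 / (2 * \<Lambda>)" using that t by linarith
          then have "\<Lambda> * (1 - s) \<le> \<Lambda> * (1 / (2 * \<Lambda>))" using \<Lambda> by (intro mult_left_mono) auto
          moreover have "\<Lambda> * (1 / (2 * \<Lambda>)) = 1/2" using \<Lambda> by simp
          moreover have "1 \<le> N * s"
          proof -
            have "1/2 \<le> s" using that t half by linarith
            then have "3 * (1/2) \<le> N * s" using N by (intro mult_mono) auto
            then show ?thesis by simp
          qed
          then have "\<Lambda> * 1 \<le> \<Lambda> * (N * s)" using \<Lambda> by (intro mult_left_mono) auto
          ultimately show ?thesis using \<Lambda> that by (auto simp: N_def algebra_simps)
        qed
        show "U x \<le> V p t x" if "x \<in> hemisphere" "1 < x \<bullet> p" for x
          using norm_cauchy_schwarz[of x p] that p by simp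
      qed
  qed
qed

text \<open>Away from the cap boundary the strict inequality has a positive minimum on a compact set
  and survives a small change of \<open>t\<close> by uniform continuity. The remaining layer around
  \<open>x \<bullet> p = t\<close> is thin enough for the barrier.\<close>

lemma cap_step:
  assumes p: "norm p = 1" "p \<bullet> e = 0" and t: "0 < t" "t < 1" and le: "cap_le p t"
  obtains t' where "0 \<le> t'" "t' < t" "\<And>\<tau>. t' \<le> \<tau> \<Longrightarrow> \<tau> < t \<Longrightarrow> cap_le p \<tau>"
proof -
  obtain \<Lambda> where \<Lambda>: "\<Lambda> \<ge> 1" and narrow: "narrow_constant \<Lambda>" using narrow_region by blast
  define N where "N = real DIM('a) - 1"
  have N: "N \<ge> 3" using dim by (simp add: N_def)
  define d where "d = 1 - t"
  have d: "0 < d" "d < 1" using t by (auto simp: d_def)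
  \<comment> \<open>In the layer \<open>1 - s\<^sup>2 \<ge> d / 2\<close> and
    \<open>N * s * (s - t) \<le> d / 4\<close>, so the operator applied to
    \<open>M * (s - t)\<^sup>2\<close> is at least \<open>2 * M * (d / 4) = \<Lambda>\<close>. The
    entry \<open>1 / (2 * M)\<close> of \<epsilon> keeps the profile below 1/2, and
    \<open>t / 2\<close> keeps the new parameter nonnegative.\<close>
  define M where "M = 2 * \<Lambda> / d"
  have M: "M > 0" using \<Lambda> d by (simp add: M_def)
  define \<epsilon> where "\<epsilon> = Min {1, d / 2, d / (4 * N), 1 / (2 * M), t / 2}"
  have \<epsilon>: "0 < \<epsilon>" "\<epsilon> \<le> 1" "\<epsilon> \<le> d / 2" "\<epsilon> \<le> d / (4 * N)" "\<epsilon> \<le> 1 / (2 * M)" "\<epsilon> \<le> t / 2"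
    using d M N t unfolding \<epsilon>_def by auto
  let ?K = "hemisphere \<inter> {x. t + \<epsilon> \<le> x \<bullet> p}"
  have "closed {x. t + \<epsilon> \<le> x \<bullet> p}" by (intro closed_Collect_le continuous_intros)
  then have Kc: "compact ?K" using compact_hemisphere by (rule compact_Int_closed[rotated])
  have K_sub: "?K \<subseteq> closed_cone" by auto
  have t0: "0 \<le> t" using t by simp
  obtain \<delta> where \<delta>: "\<delta> > 0" "\<And>\<tau> x. 0 \<le> \<tau> \<Longrightarrow> \<tau> < t \<Longrightarrow> t - \<tau> < \<delta> \<Longrightarrow> x \<in> ?K \<Longrightarrow> U x \<le> V p \<tau> x"
  proof (cases "?K = {}")
    case True
    show ?thesis by (rule that[of 1]) (use True in auto)
  next
    case False
    let ?f = "\<lambda>(\<tau>, x). V p \<tau> x"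
    have "uniformly_continuous_on ({0..t} \<times> ?K) ?f"
    proof (rule compact_uniformly_continuous)
      show "continuous_on ({0..t} \<times> ?K) ?f"
        by (rule continuous_on_subset[OF V_cont_joint[OF p]]) (use t K_sub in auto)
      show "compact ({0..t} \<times> ?K)" by (intro compact_Times Kc) simp
    qed
    moreover have "\<exists>y\<in>?K. \<forall>x\<in>?K. V p t y - U y \<le> V p t x - U x"
    proof (rule continuous_attains_inf[OF Kc False])
      show "continuous_on ?K (\<lambda>x. V p t x - U x)"
        by (intro continuous_intros continuous_on_subset[OF V_cont[OF p t0 t(2)] K_sub]
            continuous_on_subset[OF U_cont K_sub])
    qed
    then obtain y where y: "y \<in> ?K" "\<And>x. x \<in> ?K \<Longrightarrow> V p t y - U y \<le> V p t x - U x" by blast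
    define m where "m = V p t y - U y"
    have m: "m > 0" using cap_strict[OF p t le, of y] y(1) \<epsilon>(1) by (auto simp: m_def)
    ultimately obtain \<delta> where \<delta>: "\<delta> > 0"
      "\<And>z z'. z \<in> {0..t} \<times> ?K \<Longrightarrow> z' \<in> {0..t} \<times> ?K \<Longrightarrow> dist z' z < \<delta> \<Longrightarrow> dist (?f z') (?f z) < m"
      unfolding uniformly_continuous_on_def by blast
    show ?thesis
    proof (rule that[OF \<delta>(1)])
      fix \<tau> x assume a: "0 \<le> \<tau>" "\<tau> < t" "t - \<tau> < \<delta>" "x \<in> ?K"
      have "dist (?f (\<tau>, x)) (?f (t, x)) < m"
        by (rule \<delta>(2)) (use a t0 in \<open>auto simp: dist_Pair_Pair dist_real_def\<close>)
      then have "V p t x - V p \<tau> x < m" by (simp add: dist_real_def)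
      then show "U x \<le> V p \<tau> x" using y(2)[OF a(4)] by (simp add: m_def)
    qed
  qed
  define t' where "t' = max (t - \<epsilon>) (t - \<delta> / 2)"
  show ?thesis
  proof (rule that[of t'])
    show "0 \<le> t'" using \<epsilon> t unfolding t'_def by auto
    show "t' < t" using \<epsilon>(1) \<delta>(1) unfolding t'_def by auto
    fix \<tau> assume \<tau>: "t' \<le> \<tau>" "\<tau> < t"
    have \<tau>': "t - \<epsilon> \<le> \<tau>" "t - \<tau> < \<delta>" "0 \<le> \<tau>" "\<tau> < 1"
      using \<tau> \<delta>(1) \<epsilon> t unfolding t'_def by auto
    show "cap_le p \<tau>"
      proof (rule narrow_constantD[OF narrow p \<tau>'(3,4), of "\<lambda>s. M * (s - t)\<^sup>2" "\<lambda>s. 2 * M * (s - t)" "\<lambda>s. 2 * M" "t + \<epsilon>"])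
        show "((\<lambda>s. M * (s - t)\<^sup>2) has_real_derivative 2 * M * (s - t)) (at s)" for s
          by (auto intro!: derivative_eq_intros)
        show "((\<lambda>s. 2 * M * (s - t)) has_real_derivative 2 * M) (at s)" for s
          by (auto intro!: derivative_eq_intros)
        show "0 \<le> M * (s - t)\<^sup>2 \<and> M * (s - t)\<^sup>2 \<le> 1/2 \<and>
          \<Lambda> \<le> 2 * M * (1 - s\<^sup>2) - (real DIM('a) - 1) * s * (2 * M * (s - t))"
          if s: "\<tau> \<le> s" "s \<le> t + \<epsilon>" "s \<le> 1" for s
        proof (intro conjI)
          have ab: "\<bar>s - t\<bar> \<le> \<epsilon>" using s \<tau>' by auto
          show "0 \<le> M * (s - t)\<^sup>2" using M by simp
          have "(s - t)\<^sup>2 \<le> \<epsilon>\<^sup>2" using ab abs_le_square_iff[of "s - t" \<epsilon>] \<epsilon> by simp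
          also have "\<dots> \<le> \<epsilon> * 1" unfolding power2_eq_square using \<epsilon> by (intro mult_left_mono) auto
          finally have "M * (s - t)\<^sup>2 \<le> M * (1 / (2 * M))" using \<epsilon> M by (intro mult_left_mono) auto
          then show "M * (s - t)\<^sup>2 \<le> 1/2" using M by simp
          have s01: "0 \<le> s" using s \<tau>' by simp
          have "s * s \<le> s * 1" using s01 s by (intro mult_left_mono) auto
          then have "1 - s\<^sup>2 \<ge> d / 2" using s(2) \<epsilon>(3) unfolding power2_eq_square d_def by simp
          moreover have "N * s * (s - t) \<le> d / 4"
          proof -
            have "N * s * (s - t) \<le> N * s * \<epsilon>" using ab N s01 by (intro mult_left_mono) auto
            also have "\<dots> \<le> N * 1 * \<epsilon>" using N s \<epsilon> by (intro mult_right_mono mult_left_mono) auto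
            also have "\<dots> \<le> N * 1 * (d / (4 * N))" using \<epsilon> N by (intro mult_left_mono) auto
            also have "\<dots> = d / 4" using N by simp
            finally show ?thesis .
          qed
          ultimately have "2 * M * (d / 4) \<le> 2 * M * ((1 - s\<^sup>2) - N * s * (s - t))"
            using M by (intro mult_left_mono) auto
          moreover have "2 * M * (d / 4) = \<Lambda>" using d by (simp add: M_def)
          ultimately show "\<Lambda> \<le> 2 * M * (1 - s\<^sup>2) - (real DIM('a) - 1) * s * (2 * M * (s - t))"
            unfolding N_def by (simp add: algebra_simps)
        qed
        show "U x \<le> V p \<tau> x" if "x \<in> hemisphere" "t + \<epsilon> < x \<bullet> p" for x
          using \<delta>(2)[OF \<tau>'(3) \<tau>(2) \<tau>'(2)] that by auto
      qed
  qed
qed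

text \<open>The parameters from which all smaller caps are admissible form an up-closed set. Its
  infimum is admissible by continuity in \<open>t\<close>, points on the cap boundary being fixed,
  and \<open>cap_step\<close> would push a positive infimum further down.\<close>

lemma cap_le_zero:
  assumes p: "norm p = 1" "p \<bullet> e = 0"
  shows "cap_le p 0"
proof -
  define T where "T = {t. 0 \<le> t \<and> t < 1 \<and> (\<forall>\<tau>. t \<le> \<tau> \<longrightarrow> \<tau> < 1 \<longrightarrow> cap_le p \<tau>)}"
  obtain t0 where t0: "0 \<le> t0" "t0 < 1" "\<And>t. t0 \<le> t \<Longrightarrow> t < 1 \<Longrightarrow> cap_le p t"
    using cap_start[OF p] by blast
  then have T0: "t0 \<in> T" by (auto simp: T_def)
  have bdd: "bdd_below T" unfolding T_def by (rule bdd_belowI[of _ 0]) auto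
  define s where "s = Inf T"
  have s0: "0 \<le> s" unfolding s_def using T0 by (intro cInf_greatest) (auto simp: T_def)
  have s1: "s < 1" using cInf_lower[OF T0 bdd] t0(2) unfolding s_def by linarith
  have above: "cap_le p \<tau>" if "s < \<tau>" "\<tau> < 1" for \<tau>
  proof -
    obtain t where "t \<in> T" "t < \<tau>" using \<open>s < \<tau>\<close> cInf_less_iff[of T \<tau>] T0 bdd unfolding s_def by blast
    then show ?thesis using that unfolding T_def by auto
  qed
  have at_s: "cap_le p s"
    unfolding cap_le_def
  proof (intro ballI impI)
    fix x assume x: "x \<in> hemisphere" "s \<le> x \<bullet> p"
    show "U x \<le> V p s x"
    proof (cases "x \<bullet> p = s")
      case True
      then have "cap_inv p s x = x" using x by (intro cap_inv_fixed) auto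
      then show ?thesis by simp
    next
      case False
      then have sx: "s < x \<bullet> p" using x by simp
      have xc: "x \<in> closed_cone" using x by auto
      have "continuous_on {0..<1} (\<lambda>\<tau>. (\<lambda>(t, x). V p t x) (\<tau>, x))"
        by (rule continuous_on_compose2[OF V_cont_joint[OF p]]) (use xc in \<open>auto intro!: continuous_intros\<close>)
      then have "continuous_on {0..<1} (\<lambda>\<tau>. V p \<tau> x)" by simp
      then have "((\<lambda>\<tau>. V p \<tau> x) \<longlongrightarrow> V p s x) (at s within {0..<1})"
        using s0 s1 unfolding continuous_on_def by auto
      then have "((\<lambda>\<tau>. V p \<tau> x) \<longlongrightarrow> V p s x) (at s within {s..(s + 1) / 2})"
        by (rule tendsto_within_subset) (use s0 s1 in auto)
      then have lim: "((\<lambda>\<tau>. V p \<tau> x) \<longlongrightarrow> V p s x) (at_right s)"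
        using s1 by (simp add: at_within_Icc_at_right)
      have "\<forall>\<^sub>F \<tau> in at_right s. \<tau> \<in> {s<..<min 1 (x \<bullet> p)}"
        by (rule eventually_at_right_real) (use s1 sx in auto)
      then have "\<forall>\<^sub>F \<tau> in at_right s. U x \<le> V p \<tau> x"
        by eventually_elim (use above x in \<open>auto simp: cap_le_def\<close>)
      from tendsto_lowerbound[OF lim this] show ?thesis by simp
    qed
  qed
  have "s = 0"
  proof (rule ccontr)
    assume "s \<noteq> 0"
    then have "0 < s" using s0 by simp
    from cap_step[OF p this s1 at_s] obtain t' where
      t': "0 \<le> t'" "t' < s" "\<And>\<tau>. t' \<le> \<tau> \<Longrightarrow> \<tau> < s \<Longrightarrow> cap_le p \<tau>" by blast
    have "t' \<in> T" unfolding T_def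
    proof (intro CollectI conjI allI impI)
      show "cap_le p \<tau>" if "t' \<le> \<tau>" "\<tau> < 1" for \<tau>
        using that t'(3) above at_s by (cases \<tau> s rule: linorder_cases) auto
    qed (use t' s1 in auto)
    then show False using cInf_lower[OF _ bdd] t'(2) unfolding s_def by fastforce
  qed
  then show ?thesis using at_s by simp
qed

text \<open>Two points of equal height are exchanged by the reflection orthogonal to their
  difference, which is horizontal. Using the unit vector in this direction and its opposite gives
  both inequalities.\<close>

theorem axially_symmetric:
  assumes x: "norm x = 1" "0 \<le> x \<bullet> e" and y: "norm y = 1" "0 \<le> y \<bullet> e" and eq: "x \<bullet> e = y \<bullet> e"
  shows "U x = U y"
proof -
  have le: "U x \<le> U y" if x: "norm x = 1" "0 \<le> x \<bullet> e" and y: "norm y = 1" "0 \<le> y \<bullet> e"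
    and eq: "x \<bullet> e = y \<bullet> e" and ne: "x \<noteq> y" for x y
  proof -
    define d where "d = norm (x - y)"
    have d: "d > 0" using ne by (simp add: d_def)
    define p where "p = (1 / d) *\<^sub>R (x - y)"
    have p: "norm p = 1" "p \<bullet> e = 0" using d eq by (auto simp: p_def d_def inner_diff_left)
    have xx: "x \<bullet> x = 1" "y \<bullet> y = 1" using x y by (simp_all add: norm_eq_1)
    have "d\<^sup>2 = 2 - 2 * (x \<bullet> y)" unfolding d_def power2_norm_eq_inner
      by (simp add: inner_diff_left inner_diff_right xx inner_commute)
    then have xp: "x \<bullet> p = d / 2" using d
      by (simp add: p_def inner_diff_right xx field_simps power2_eq_square)
    have "cap_inv p 0 x = y"
    proof -
      have "cap_inv p 0 x = x - (2 * (x \<bullet> p)) *\<^sub>R p" by (simp add: cap_inv_def cap_shift_def)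
      also have "\<dots> = x - (x - y)" unfolding xp using d by (simp add: p_def)
      finally show ?thesis by simp
    qed
    moreover have "U x \<le> U (cap_inv p 0 x)"
      using cap_le_zero[OF p] x xp d unfolding cap_le_def by simp
    ultimately show ?thesis by simp
  qed
  show ?thesis
  proof (cases "x = y")
    case False
    then show ?thesis using le[OF x y eq] le[OF y x eq[symmetric]] by simp
  qed simp
qed

end

section \<open>Solutions on the hemisphere in homogeneous coordinates\<close>

text \<open>Each \<open>lap_at\<close> fact carries its own gradient field. By uniqueness of
  derivatives these all agree with \<open>g\<close> near the point, so \<open>g\<close> itself is
  differentiable and its derivative has the prescribed trace.\<close>

lemma lap_at_gradient_field:
  assumes S: "open S" and lap: "\<And>x. x \<in> S \<Longrightarrow> lap_at F x (g x) (L x)" and x: "x \<in> S"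
  shows "(F has_derivative (\<lambda>h. g x \<bullet> h)) (at x)"
    and "(g has_derivative frechet_derivative g (at x)) (at x)"
    and "(\<Sum>i\<in>Basis. frechet_derivative g (at x) i \<bullet> i) = L x"
proof -
  have 1: "(F has_derivative (\<lambda>h. g x \<bullet> h)) (at x)" if "x \<in> S" for x
    using lap[OF that] unfolding lap_at_def twice_diff_at_def by (auto dest: eventually_nhds_x_imp_x)
  show "(F has_derivative (\<lambda>h. g x \<bullet> h)) (at x)" by (rule 1[OF x])
  obtain G A where GA: "twice_diff_at F G A x" "G x = g x" "(\<Sum>i\<in>Basis. A i \<bullet> i) = L x"
    using lap[OF x] unfolding lap_at_def by blast
  have "\<forall>\<^sub>F y in nhds x. y \<in> S" using S x by (rule eventually_nhds_in_open)
  then have "\<forall>\<^sub>F y in nhds x. G y = g y"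
    using GA(1)[unfolded twice_diff_at_def, THEN conjunct1]
  proof eventually_elim
    case (elim y)
    have "(\<lambda>h. G y \<bullet> h) = (\<lambda>h. g y \<bullet> h)" using has_derivative_unique[OF elim(2) 1[OF elim(1)]] .
    then show ?case by (metis vector_eq_rdot)
  qed
  then have "\<forall>\<^sub>F y in at x. G y = g y" by (auto simp: eventually_at_filter elim: eventually_mono)
  then have gA: "(g has_derivative A) (at x)"
    using GA(1,2) unfolding twice_diff_at_def
    by (intro has_derivative_transform_eventually[of G A x UNIV g]) auto
  then have "A = frechet_derivative g (at x)" by (rule frechet_derivative_at)
  then show "(g has_derivative frechet_derivative g (at x)) (at x)"
    "(\<Sum>i\<in>Basis. frechet_derivative g (at x) i \<bullet> i) = L x" using gA GA(3) by simp_all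
qed

section \<open>From partial derivatives to the homogeneous extension\<close>

lemma sum_Basis_axis:
  fixes f :: "real^'m::finite \<Rightarrow> real"
  shows "(\<Sum>i\<in>Basis. f i) = (\<Sum>i\<in>UNIV. f (axis i 1))"
proof -
  have B: "(Basis :: (real^'m) set) = (\<lambda>i. axis i 1) ` UNIV" by (auto simp: Basis_vec_def)
  have "inj (\<lambda>i::'m. axis i (1::real))" by (auto simp: inj_on_def axis_eq_axis)
  then show ?thesis unfolding B by (subst sum.reindex) auto
qed

lemma pd_has_derivative:
  assumes "(F has_derivative D) (at x)"
  shows "pd i F x = D (axis i 1)"
proof -
  have "((\<lambda>t. x + t *\<^sub>R axis i 1) has_derivative (\<lambda>t. t *\<^sub>R axis i 1)) (at 0)"
    by (auto intro!: derivative_eq_intros)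
  moreover have "(F has_derivative D) (at (x + 0 *\<^sub>R axis i 1))" using assms by simp
  ultimately have "((\<lambda>t. F (x + t *\<^sub>R axis i 1)) has_derivative (\<lambda>t. D (t *\<^sub>R axis i 1))) (at 0)"
    by (rule has_derivative_compose)
  moreover have "D (t *\<^sub>R axis i 1) = t * D (axis i 1)" for t
    using linear_cmul[OF has_derivative_linear[OF assms]] by simp
  ultimately have "((\<lambda>t. F (x + t *\<^sub>R axis i 1)) has_real_derivative D (axis i 1)) (at 0)"
    by (intro has_derivative_imp_has_field_derivative) auto
  then show ?thesis unfolding pd_def by (rule DERIV_imp_deriv)
qed

lemma C2_on_lap_at:
  fixes F :: "real^'m::finite \<Rightarrow> real"
  assumes C2: "C2_on S F" and S: "open S" and x: "x \<in> S"
  shows "lap_at F x (\<chi> i. pd i F x) (eucl_lap F x)"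
proof -
  let ?G = "\<lambda>x. (\<chi> i. pd i F x)"
  have grad: "(F has_derivative (\<lambda>h. ?G y \<bullet> h)) (at y)" if "y \<in> S" for y
  proof -
    have "F differentiable (at y)"
      using C2 S that unfolding C2_on_def differentiable_on_def by (metis at_within_open)
    then obtain D where D: "(F has_derivative D) (at y)" unfolding differentiable_def by blast
    have "D h = ?G y \<bullet> h" for h
    proof -
      have "D h = D (\<Sum>i\<in>UNIV. (h $ i) *\<^sub>R axis i 1)"
        using basis_expansion[of h] by (simp add: scalar_mult_eq_scaleR)
      also have "\<dots> = (\<Sum>i\<in>UNIV. h $ i * D (axis i 1))"
        using has_derivative_linear[OF D] by (simp add: linear_sum linear_cmul)
      also have "\<dots> = ?G y \<bullet> h"
        by (simp add: inner_vec_def pd_has_derivative[OF D] mult.commute)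
      finally show ?thesis .
    qed
    then have "D = (\<lambda>h. ?G y \<bullet> h)" by blast
    then show ?thesis using D by simp
  qed
  define A where "A = (\<lambda>h. (\<chi> i. frechet_derivative (pd i F) (at x) h))"
  have pdd: "(pd i F has_derivative frechet_derivative (pd i F) (at x)) (at x)" for i
    using C2 S x unfolding C2_on_def differentiable_on_def
    by (metis at_within_open frechet_derivative_works)
  have "(?G has_derivative A) (at x)"
    unfolding has_derivative_componentwise_within[of ?G]
  proof
    fix j :: "real^'m" assume "j \<in> Basis"
    then obtain i where "j = axis i 1" by (auto simp: Basis_vec_def)
    then show "((\<lambda>x. ?G x \<bullet> j) has_derivative (\<lambda>x. A x \<bullet> j)) (at x)"
      using pdd[of i] by (simp add: inner_axis A_def)
  qed
  moreover have "\<forall>\<^sub>F y in nhds x. (F has_derivative (\<lambda>h. ?G y \<bullet> h)) (at y)"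
    using eventually_nhds_in_open[OF S x] by eventually_elim (rule grad)
  ultimately have "twice_diff_at F ?G A x" unfolding twice_diff_at_def by blast
  moreover have "(\<Sum>i\<in>Basis. A i \<bullet> i) = eucl_lap F x"
    unfolding sum_Basis_axis eucl_lap_def by (simp add: inner_axis A_def pd_has_derivative[OF pdd])
  ultimately show ?thesis using lap_at_twice_diff by metis
qed

locale sphere_solution =
  fixes f b :: "real \<Rightarrow> real" and e :: "'m::finite" and u :: "real^'m \<Rightarrow> real" and n \<gamma> :: real
  assumes sol: "is_solution f b e u" and dim: "4 \<le> CARD('m)"
    and n: "n = real CARD('m) - 1" and \<gamma>: "\<gamma> = (n - 2) / 2"
begin

abbreviation "ax \<equiv> axis e (1::real) :: real^'m"

definition "F = hom0 u"
definition "GF x = (\<chi> i. pd i F x)"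
definition "AF x = frechet_derivative GF (at x)"
definition "U x = norm x powr (-\<gamma>) * F x"
definition "GU x = norm x powr (-\<gamma>) *\<^sub>R GF x + F x *\<^sub>R ((- \<gamma> * norm x powr (- \<gamma> - 2)) *\<^sub>R x)"
definition "AU x = frechet_derivative GU (at x)"

lemma n_ge: "n \<ge> 3" using n dim by simp

lemma ax: "norm ax = 1" "ax \<bullet> ax = 1" by (auto simp: inner_axis)

lemma inner_ax: "x \<bullet> ax = x $ e" by (simp add: inner_axis)

lemma open_cone: "open {x. 0 < x \<bullet> ax}"
  using open_halfspace_gt[of 0 ax] by (simp add: inner_commute)

lemma F_lap0: "0 < x \<bullet> ax \<Longrightarrow> lap_at F x (GF x) (eucl_lap F x)"
  unfolding GF_def
  using C2_on_lap_at[of "cone_up e" F x] open_cone sol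
  by (simp add: is_solution_def F_def cone_up_def inner_ax)

lemma F_hom: "c > 0 \<Longrightarrow> F (c *\<^sub>R x) = F x"
  by (simp add: F_def hom0_def mult.commute[of _ c] mult.assoc[symmetric])

sublocale F: homogeneous_halfspace ax F GF AF 0
proof
  fix x assume x: "0 < x \<bullet> ax"
  show "F (c *\<^sub>R x) = c powr 0 * F x" if "0 < c" for c using F_hom[OF that] that by simp
  note fld = lap_at_gradient_field[OF open_cone, of F GF "eucl_lap F" x]
  show "(F has_derivative (\<bullet>) (GF x)) (at x)" "(GF has_derivative AF x) (at x)"
    using fld(1,2) F_lap0 x unfolding AF_def by auto
qed

lemma trace_AF0: "0 < x \<bullet> ax \<Longrightarrow> (\<Sum>i\<in>Basis. AF x i \<bullet> i) = eucl_lap F x"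
  using lap_at_gradient_field(3)[OF open_cone, of F GF "eucl_lap F" x] F_lap0 unfolding AF_def by auto

text \<open>The equation is given on the unit sphere only; the Hessian of a function of degree 0 has
  degree -2, which carries it to the open cone.\<close>

lemma trace_AF:
  assumes x: "0 < x \<bullet> ax"
  shows "(\<Sum>i\<in>Basis. AF x i \<bullet> i) = - (norm x powr (-2) * f (F x))"
proof -
  define w where "w = (1 / norm x) *\<^sub>R x"
  have nx: "norm x > 0" using x by auto
  have xw: "x = norm x *\<^sub>R w" using nx by (simp add: w_def)
  have w: "0 < w \<bullet> ax" using x nx by (simp add: w_def)
  have wn: "norm w = 1" using nx by (simp add: w_def)
  have "w \<in> hemi e" using w wn by (simp add: hemi_def inner_ax)
  then have "- eucl_lap F w = f (u w)" using sol by (auto simp: is_solution_def lap_sphere_def F_def)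
  moreover have "u w = F x" by (simp add: F_def hom0_def w_def divide_inverse)
  ultimately have "(\<Sum>i\<in>Basis. AF w i \<bullet> i) = - f (F x)" using trace_AF0[OF w] by simp
  moreover have "AF x i = norm x powr (-2) *\<^sub>R AF w i" for i
    using F.hess_hom[OF w nx, of i] xw by simp
  ultimately show ?thesis by (simp add: sum_distrib_left[symmetric])
qed

text \<open>The cross term vanishes by Euler's relation in degree 0. The Laplacian of the power of
  the norm contributes \<gamma> (n - 1 - \<gamma>) = n (n - 2) / 4, the linear term in the
  hypothesis on \<open>f\<close>.\<close>

lemma U_lap0:
  assumes x: "0 < x \<bullet> ax"
  shows "lap_at U x (GU x) (- (norm x powr (-\<gamma> - 2) * (f (F x) + n * (n - 2) / 4 * F x)))"
proof -
  have x0: "x \<noteq> 0" using x by auto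
  have lapF: "lap_at F x (GF x) (- (norm x powr (-2) * f (F x)))"
    using F_lap0[OF x] trace_AF[OF x] trace_AF0[OF x] by simp
  have perp: "x \<bullet> GF x = 0" using F.euler[OF x] by (simp add: inner_commute)
  have "lap_at U x (GU x) (norm x powr (-\<gamma>) * (- (norm x powr (-2) * f (F x)))
     + 2 * (((- \<gamma> * norm x powr (- \<gamma> - 2)) *\<^sub>R x) \<bullet> GF x)
     + F x * (- \<gamma> * (- \<gamma> + real DIM(real^'m) - 2) * norm x powr (- \<gamma> - 2)))"
    unfolding U_def[abs_def] GU_def by (rule lap_at_mult[OF lap_at_norm_powr[OF x0] lapF])
  moreover have "norm x powr (-\<gamma>) * (- (norm x powr (-2) * f (F x))) = - (norm x powr (-\<gamma> - 2) * f (F x))"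
    by (simp add: powr_add[symmetric] mult.assoc[symmetric])
  moreover have "((- \<gamma> * norm x powr (- \<gamma> - 2)) *\<^sub>R x) \<bullet> GF x = 0" using perp by simp
  moreover have "- \<gamma> * (- \<gamma> + real DIM(real^'m) - 2) = - (n * (n - 2) / 4)"
  proof -
    have "real DIM(real^'m) = n + 1" using n by simp
    then show ?thesis by (simp add: \<gamma> field_simps)
  qed
  ultimately have "lap_at U x (GU x) (- (norm x powr (-\<gamma> - 2) * f (F x)) + 2 * 0
     + F x * (- (n * (n - 2) / 4) * norm x powr (- \<gamma> - 2)))"
    by (simp only:)
  then show ?thesis by (simp add: algebra_simps)
qed

lemma U_hom_all: "c > 0 \<Longrightarrow> x \<noteq> 0 \<Longrightarrow> U (c *\<^sub>R x) = c powr (-\<gamma>) * U x"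
  by (simp add: U_def F_hom powr_mult)

lemma trace_AU:
  assumes "0 < x \<bullet> ax"
  shows "(\<Sum>i\<in>Basis. AU x i \<bullet> i) = - (norm x powr (-\<gamma> - 2) * (f (F x) + n * (n - 2) / 4 * F x))"
  unfolding AU_def by (rule lap_at_gradient_field(3)[OF open_cone]) (use assms U_lap0 in auto)

sublocale U: homogeneous_halfspace ax U GU AU "-\<gamma>"
proof
  fix x assume x: "0 < x \<bullet> ax"
  then have x0: "x \<noteq> 0" by auto
  show "U (c *\<^sub>R x) = c powr -\<gamma> * U x" if "0 < c" for c using U_hom_all[OF that x0] .
  note fld = lap_at_gradient_field[OF open_cone, of U GU
     "\<lambda>x. - (norm x powr (-\<gamma> - 2) * (f (F x) + n * (n - 2) / 4 * F x))" x]
  show "(U has_derivative (\<bullet>) (GU x)) (at x)" "(GU has_derivative AU x) (at x)"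
    using fld(1,2) U_lap0 x unfolding AU_def by auto
qed

lemma F_cont: "continuous_on {x. 0 \<le> x \<bullet> ax \<and> x \<noteq> 0} F"
proof -
  have "continuous_on (chemi e) u" using sol by (simp add: is_solution_def)
  then show ?thesis unfolding F_def hom0_def
    by (rule continuous_on_compose2)
       (auto intro!: continuous_intros simp: chemi_def inner_ax)
qed

lemma U_cont: "continuous_on {x. 0 \<le> x \<bullet> ax \<and> x \<noteq> 0} U"
  unfolding U_def by (intro continuous_intros F_cont) auto

lemma F_sphere: "norm x = 1 \<Longrightarrow> F x = u x"
  by (simp add: F_def hom0_def)

lemma U_sphere: "norm x = 1 \<Longrightarrow> U x = u x"
  by (simp add: U_def F_sphere)

text \<open>Radial projection sends the line \<open>z + s *\<^sub>R ax\<close> to the meridian at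
  angle \<open>arctan (s / r)\<close>, which has derivative \<open>1 / r\<close> at 0. The power of
  the norm is stationary there, so only \<open>F\<close> contributes.\<close>

lemma U_bdry:
  assumes z: "z \<bullet> ax = 0" "z \<noteq> 0"
  shows "((\<lambda>s. U (z + s *\<^sub>R ax)) has_real_derivative - (norm z powr (-\<gamma> - 1) * b (F z))) (at_right 0)"
proof -
  define r where "r = norm z"
  define \<zeta> where "\<zeta> = (1 / r) *\<^sub>R z"
  have r: "r > 0" using z by (simp add: r_def)
  have z\<zeta>: "z = r *\<^sub>R \<zeta>" using r by (simp add: \<zeta>_def)
  have \<zeta>n: "norm \<zeta> = 1" using r by (simp add: \<zeta>_def r_def)
  have "\<zeta> \<in> equator e" using \<zeta>n z by (simp add: equator_def \<zeta>_def inner_ax)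
  then have d: "((\<lambda>\<theta>. u (cos \<theta> *\<^sub>R \<zeta> + sin \<theta> *\<^sub>R ax)) has_real_derivative - b (u \<zeta>)) (at_right 0)"
    using sol by (auto simp: is_solution_def)
  have u\<zeta>: "u \<zeta> = F z" by (simp add: F_def hom0_def \<zeta>_def r_def divide_inverse)
  have Feq: "F (z + s *\<^sub>R ax) = u (cos (arctan (s / r)) *\<^sub>R \<zeta> + sin (arctan (s / r)) *\<^sub>R ax)" for s
  proof -
    define q where "q = sqrt (1 + (s / r)\<^sup>2)"
    have q: "q > 0" unfolding q_def by (simp add: add_pos_nonneg)
    have zz: "\<zeta> \<bullet> ax = 0" "\<zeta> \<bullet> \<zeta> = 1" using z \<zeta>n norm_eq_1[of \<zeta>] by (auto simp: \<zeta>_def)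
    have n: "norm (\<zeta> + (s / r) *\<^sub>R ax) = q"
      unfolding q_def norm_eq_sqrt_inner
      using zz ax by (simp add: inner_add_left inner_add_right inner_commute[of ax \<zeta>] power2_eq_square)
    have "z + s *\<^sub>R ax = r *\<^sub>R (\<zeta> + (s / r) *\<^sub>R ax)" using r by (simp add: z\<zeta> scaleR_add_right)
    then have "F (z + s *\<^sub>R ax) = F (\<zeta> + (s / r) *\<^sub>R ax)" using F_hom[OF r] by simp
    also have "\<dots> = u ((1 / q) *\<^sub>R (\<zeta> + (s / r) *\<^sub>R ax))" by (simp add: F_def hom0_def n inverse_eq_divide)
    also have "(1 / q) *\<^sub>R (\<zeta> + (s / r) *\<^sub>R ax) = cos (arctan (s / r)) *\<^sub>R \<zeta> + sin (arctan (s / r)) *\<^sub>R ax"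
      by (simp add: cos_arctan sin_arctan q_def scaleR_add_right)
    finally show ?thesis .
  qed
  have "((\<lambda>s. u (cos (arctan (s / r)) *\<^sub>R \<zeta> + sin (arctan (s / r)) *\<^sub>R ax)) has_real_derivative
      - b (u \<zeta>) * (1 / r)) (at_right 0)"
  proof -
    have "(\<lambda>s. arctan (s / r)) ` {0<..} \<subseteq> {0<..}" using r by auto
    then have 1: "((\<lambda>\<theta>. u (cos \<theta> *\<^sub>R \<zeta> + sin \<theta> *\<^sub>R ax)) has_real_derivative - b (u \<zeta>))
        (at (arctan (0 / r)) within (\<lambda>s. arctan (s / r)) ` {0<..})"
      using d by (simp add: DERIV_subset)
    have 2: "((\<lambda>s. arctan (s / r)) has_real_derivative 1 / r) (at_right 0)"
      using r by (auto intro!: derivative_eq_intros)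
    show ?thesis using DERIV_image_chain[OF 1 2] by (simp only: o_def)
  qed
  then have dF: "((\<lambda>s. F (z + s *\<^sub>R ax)) has_real_derivative - b (F z) * (1 / r)) (at_right 0)"
    using Feq u\<zeta> by simp
  have dn: "((\<lambda>s. norm (z + s *\<^sub>R ax) powr (-\<gamma>)) has_real_derivative 0) (at_right 0)"
    using lap_at_line_derivative[OF lap_at_norm_powr[OF z(2), of "-\<gamma>"], of ax "{0<..}"] z(1) by simp
  have "((\<lambda>s. U (z + s *\<^sub>R ax)) has_real_derivative
      0 * F (z + 0 *\<^sub>R ax) + (- b (F z) * (1 / r)) * norm (z + 0 *\<^sub>R ax) powr (-\<gamma>)) (at_right 0)"
    unfolding U_def by (rule DERIV_mult'[THEN DERIV_cong, OF dn dF]) simp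
  moreover have "norm z powr (-\<gamma> - 1) = norm z powr (-\<gamma>) * (1 / r)"
    using r by (simp add: powr_diff r_def)
  ultimately show ?thesis by (simp add: mult.commute mult.left_commute)
qed

end

section \<open>Rotationally symmetric profiles\<close>

text \<open>Write the nonlinearity as \<open>h s * s powr p\<close>, where
  \<open>1 / (p + 1) = (n - 2) / (2 * n)\<close>. Freezing \<open>h\<close> at its value at
  \<open>b\<close> leaves a function with nonnegative derivative on the interval; exchanging
  \<open>h b\<close> for \<open>h a\<close> at the left end then gains strictly. No derivative of
  \<open>f\<close> enters.\<close>

lemma pohozaev_defect_strict_mono:
  fixes f g :: "real \<Rightarrow> real" and n :: real
  assumes n: "n > 2" and a: "0 < a" "a < b"
    and g: "\<And>s. a \<le> s \<Longrightarrow> s \<le> b \<Longrightarrow> (g has_real_derivative f s + n * (n - 2) / 4 * s) (at s)"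
    and dec: "\<And>s t. 0 < s \<Longrightarrow> s < t \<Longrightarrow>
        t powr (-(n+2)/(n-2)) * (f t + n*(n-2)/4 * t) < s powr (-(n+2)/(n-2)) * (f s + n*(n-2)/4 * s)"
  shows "g a - (n - 2) / (2 * n) * a * (f a + n * (n - 2) / 4 * a)
     < g b - (n - 2) / (2 * n) * b * (f b + n * (n - 2) / 4 * b)"
proof -
  define p where "p = (n + 2) / (n - 2)"
  define w where "w = (\<lambda>s. f s + n * (n - 2) / 4 * s)"
  define h where "h = (\<lambda>s. s powr (- p) * w s)"
  have p: "p + 1 = 2 * n / (n - 2)" "p + 1 > 0" using n by (simp_all add: p_def field_simps)
  have ip: "1 / (p + 1) = (n - 2) / (2 * n)" using n by (simp add: p(1))
  have h_dec: "h t < h s" if "0 < s" "s < t" for s t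
  proof -
    have "-(n+2)/(n-2) = - p" by (simp add: p_def minus_divide_left)
    then show ?thesis using dec[OF that] unfolding h_def w_def by (simp only:)
  qed
  have w_eq: "w s = h s * s powr p" if "s > 0" for s
    using that by (simp add: h_def powr_minus field_simps)
  have sw: "s * w s = h s * s powr (p + 1)" if "s > 0" for s
    using that by (simp add: w_eq[OF that] powr_add)
  have "g a - h b * (a powr (p + 1) / (p + 1)) \<le> g b - h b * (b powr (p + 1) / (p + 1))"
  proof (rule DERIV_nonneg_imp_nondecreasing[of a b "\<lambda>s. g s - h b * (s powr (p + 1) / (p + 1))"])
    fix s assume s: "a \<le> s" "s \<le> b"
    then have s0: "s > 0" using a by simp
    have "((\<lambda>s. s powr (p + 1)) has_real_derivative (p + 1) * s powr (p + 1 - 1)) (at s)"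
      by (rule has_real_derivative_powr[OF s0])
    from DERIV_cdivide[OF this, of "p + 1"]
    have "((\<lambda>s. s powr (p + 1) / (p + 1)) has_real_derivative s powr p) (at s)" using p(2) by simp
    from DERIV_diff[OF g[OF s] DERIV_cmult[OF this, of "h b"]]
    have "((\<lambda>s. g s - h b * (s powr (p + 1) / (p + 1))) has_real_derivative w s - h b * s powr p) (at s)"
      by (simp add: w_def)
    moreover have "w s - h b * s powr p \<ge> 0"
    proof -
      have "h b \<le> h s" using h_dec[OF s0, of b] s by (cases "s = b") auto
      then show ?thesis using w_eq[OF s0] by (simp add: mult_right_mono)
    qed
    ultimately show "\<exists>y. ((\<lambda>s. g s - h b * (s powr (p + 1) / (p + 1))) has_real_derivative y) (at s) \<and> 0 \<le> y"
      by blast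
  qed (use a in simp)
  moreover have "h b * (a powr (p + 1) / (p + 1)) < h a * (a powr (p + 1) / (p + 1))"
    by (intro mult_strict_right_mono h_dec a divide_pos_pos) (use a p(2) in auto)
  ultimately have "g a - h a * (a powr (p + 1) / (p + 1)) < g b - h b * (b powr (p + 1) / (p + 1))"
    by linarith
  moreover have "(n - 2) / (2 * n) * s * w s = h s * (s powr (p + 1) / (p + 1))" if "s > 0" for s
    using sw[OF that] by (simp add: ip[symmetric] mult.assoc)
  ultimately have "g a - (n - 2) / (2 * n) * a * w a < g b - (n - 2) / (2 * n) * b * w b" using a by simp
  then show ?thesis by (simp add: w_def)
qed

text \<open>For v = (cos \<theta>)^\<gamma> \<phi> in the cylinder variable with dt = d\<theta> /
  cos \<theta>, the energy is v_t^2 / 2 - \<gamma>^2 v^2 / 2 + (cos \<theta>)^n g(\<phi>), the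
  Hamiltonian of the equation transplanted to a cylinder. It is conserved where the bracket on the
  right vanishes; the bracket measures the deviation from the critical power.\<close>

lemma pohozaev_energy_derivative:
  fixes M :: nat and \<phi> \<phi>' g f :: "real \<Rightarrow> real" and \<theta> :: real
  defines "n \<equiv> real M + 2" and "\<gamma> \<equiv> real M / 2"
  assumes M: "M \<ge> 1" and \<theta>: "0 < cos \<theta>"
    and d1: "(\<phi> has_real_derivative \<phi>' \<theta>) (at \<theta>)" and d2: "(\<phi>' has_real_derivative d) (at \<theta>)"
    and g: "(g has_real_derivative f (\<phi> \<theta>) + n * (n - 2) / 4 * \<phi> \<theta>) (at (\<phi> \<theta>))"
    and ode: "cos \<theta> * d = (n - 1) * sin \<theta> * \<phi>' \<theta> - cos \<theta> * f (\<phi> \<theta>)"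
  shows "((\<lambda>\<theta>. cos \<theta> ^ M * ((cos \<theta>)\<^sup>2 * ((\<phi>' \<theta>)\<^sup>2 / 2 - \<gamma>\<^sup>2 / 2 * (\<phi> \<theta>)\<^sup>2 + g (\<phi> \<theta>))
            - \<gamma> * (sin \<theta> * cos \<theta>) * (\<phi> \<theta> * \<phi>' \<theta>))) has_real_derivative
        - (n * sin \<theta> * cos \<theta> ^ (M + 1) *
            (g (\<phi> \<theta>) - (n - 2) / (2 * n) * \<phi> \<theta> * (f (\<phi> \<theta>) + n * (n - 2) / 4 * \<phi> \<theta>)))) (at \<theta>)"
proof -
  define C S X y z F H where "C = cos \<theta>" and "S = sin \<theta>" and "X = C ^ M" and "y = \<phi> \<theta>" and "z = \<phi>' \<theta>"
    and "F = f y" and "H = g y"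
  define X' where "X' = real M * C ^ (M - 1) * (- S)"
  have C: "C > 0" using \<theta> by (simp add: C_def)
  have dX: "((\<lambda>\<theta>. cos \<theta> ^ M) has_real_derivative X') (at \<theta>)"
    by (auto intro!: derivative_eq_intros simp: X'_def C_def S_def)
  have CX: "C * X' = - real M * S * X"
  proof -
    have "C * C ^ (M - 1) = C ^ M" using M by (simp flip: power_Suc)
    then show ?thesis by (simp add: X'_def X_def algebra_simps)
  qed
  have dH: "((\<lambda>\<theta>. g (\<phi> \<theta>)) has_real_derivative (F + n * (n - 2) / 4 * y) * z) (at \<theta>)"
    using DERIV_chain2[OF g d1] by (simp add: F_def y_def z_def)
  have dK: "((\<lambda>\<theta>. (\<phi>' \<theta>)\<^sup>2 / 2 - \<gamma>\<^sup>2 / 2 * (\<phi> \<theta>)\<^sup>2 + g (\<phi> \<theta>)) has_real_derivative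
      z * d - \<gamma>\<^sup>2 * y * z + (F + n * (n - 2) / 4 * y) * z) (at \<theta>)"
  proof -
    have "((\<lambda>\<theta>. (\<phi>' \<theta>)\<^sup>2 / 2 - \<gamma>\<^sup>2 / 2 * (\<phi> \<theta>)\<^sup>2) has_real_derivative z * d - \<gamma>\<^sup>2 * y * z) (at \<theta>)"
      using d1 d2 by (auto intro!: derivative_eq_intros simp: y_def z_def)
    from DERIV_add[OF this dH] show ?thesis .
  qed
  have dC2: "((\<lambda>\<theta>. (cos \<theta>)\<^sup>2) has_real_derivative - 2 * C * S) (at \<theta>)"
    by (auto intro!: derivative_eq_intros simp: C_def S_def)
  have dSC: "((\<lambda>\<theta>. \<gamma> * (sin \<theta> * cos \<theta>)) has_real_derivative \<gamma> * (C * C - S * S)) (at \<theta>)"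
    by (auto intro!: derivative_eq_intros simp: C_def S_def)
  have dyz: "((\<lambda>\<theta>. \<phi> \<theta> * \<phi>' \<theta>) has_real_derivative z * z + y * d) (at \<theta>)"
    using DERIV_mult[OF d1 d2] by (simp add: y_def z_def algebra_simps)
  have "((\<lambda>\<theta>. cos \<theta> ^ M * ((cos \<theta>)\<^sup>2 * ((\<phi>' \<theta>)\<^sup>2 / 2 - \<gamma>\<^sup>2 / 2 * (\<phi> \<theta>)\<^sup>2 + g (\<phi> \<theta>))
            - \<gamma> * (sin \<theta> * cos \<theta>) * (\<phi> \<theta> * \<phi>' \<theta>))) has_real_derivative
       X' * (C\<^sup>2 * (z\<^sup>2 / 2 - \<gamma>\<^sup>2 / 2 * y\<^sup>2 + H) - \<gamma> * (S * C) * (y * z))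
       + X * (- 2 * C * S * (z\<^sup>2 / 2 - \<gamma>\<^sup>2 / 2 * y\<^sup>2 + H)
              + C\<^sup>2 * (z * d - \<gamma>\<^sup>2 * y * z + (F + n * (n - 2) / 4 * y) * z)
              - \<gamma> * (C * C - S * S) * (y * z) - \<gamma> * (S * C) * (z * z + y * d))) (at \<theta>)"
    (is "(_ has_real_derivative ?D) _")
    using DERIV_mult[OF dX DERIV_diff[OF DERIV_mult[OF dC2 dK] DERIV_mult[OF dSC dyz]]]
    by (simp add: C_def S_def X_def y_def z_def H_def power2_eq_square algebra_simps)
  moreover have "?D = - (n * S * C ^ (M + 1) * (H - (n - 2) / (2 * n) * y * (F + n * (n - 2) / 4 * y)))"
    (is "_ = ?R")
  proof -
    have ode': "C * d = (n - 1) * S * z - C * F" using ode by (simp add: C_def S_def z_def F_def y_def)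
    have n2: "n - 2 = 2 * \<gamma>" "real M = 2 * \<gamma>" "n = 2 * \<gamma> + 2" by (simp_all add: n_def \<gamma>_def)
    have n0: "n \<noteq> 0" by (simp add: n_def)
    have nd: "n * ((n - 2) / (2 * n) * y * (F + n * (n - 2) / 4 * y)) = \<gamma> * y * (F + n * (n - 2) / 4 * y)"
    proof -
      have "n * (m / (2 * n) * y * w) = m / 2 * y * w" for m w using n0 by simp
      moreover have "(n - 2) / 2 = \<gamma>" using n2 by simp
      ultimately show ?thesis by metis
    qed
    \<comment> \<open>Multiplying by \<open>C\<close> lets the equation for \<open>C * d\<close> and
      the relation for \<open>C * X'\<close> be substituted without division or a truncated
      exponent; \<open>C\<close> is cancelled at the end.\<close>
    have "C * ?D = (C * X') * (C\<^sup>2 * (z\<^sup>2 / 2 - \<gamma>\<^sup>2 / 2 * y\<^sup>2 + H) - \<gamma> * (S * C) * (y * z))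
       + X * (- 2 * C\<^sup>2 * S * (z\<^sup>2 / 2 - \<gamma>\<^sup>2 / 2 * y\<^sup>2 + H)
              + C\<^sup>2 * (z * (C * d) + C * (- \<gamma>\<^sup>2 * y * z + (F + n * (n - 2) / 4 * y) * z))
              - \<gamma> * C * (C * C - S * S) * (y * z) - \<gamma> * (S * C) * (C * (z * z) + y * (C * d)))"
      by (simp add: algebra_simps power2_eq_square)
    also have "\<dots> = - (S * X * C\<^sup>2 * (n * H - \<gamma> * y * (F + n * (n - 2) / 4 * y)))"
      unfolding CX ode' n2 by (simp add: field_simps power2_eq_square)
    also have "\<dots> = - (S * X * C\<^sup>2 * (n * H - n * ((n - 2) / (2 * n) * y * (F + n * (n - 2) / 4 * y))))"
      unfolding nd ..
    also have "\<dots> = C * ?R"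
    proof -
      have "- (S * X * C\<^sup>2 * (n * H - n * T)) = C * (- (n * S * C ^ (M + 1) * (H - T)))" for T
        by (simp add: X_def algebra_simps power2_eq_square)
      then show ?thesis .
    qed
    finally have "C * ?D = C * ?R" .
    moreover have "C \<noteq> 0" using C by simp
    ultimately show ?thesis using mult_left_cancel by blast
  qed
  ultimately show ?thesis by (simp add: C_def S_def H_def F_def y_def)
qed

text \<open>The variable is the latitude: 0 on the equator, \<pi>/2 at the pole. Derivatives at the
  pole are two-sided because the great circle continues smoothly through it; on the equator only the
  one-sided Neumann condition is known. \<open>M\<close> is n - 2 as a natural number, for use as an
  exponent.\<close>

locale radial_profile =
  fixes M :: nat and n \<gamma> :: real and f \<phi> \<phi>' \<phi>'' :: "real \<Rightarrow> real"
  assumes M: "M \<ge> 1" and n: "n = real M + 2" and \<gamma>: "\<gamma> = real M / 2"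
    and cont: "continuous_on {0..pi/2} \<phi>"
    and pos: "\<And>\<theta>. 0 \<le> \<theta> \<Longrightarrow> \<theta> \<le> pi/2 \<Longrightarrow> 0 < \<phi> \<theta>"
    and d1: "\<And>\<theta>. 0 < \<theta> \<Longrightarrow> \<theta> \<le> pi/2 \<Longrightarrow> (\<phi> has_real_derivative \<phi>' \<theta>) (at \<theta>)"
    and d2: "\<And>\<theta>. 0 < \<theta> \<Longrightarrow> \<theta> \<le> pi/2 \<Longrightarrow> (\<phi>' has_real_derivative \<phi>'' \<theta>) (at \<theta>)"
    and ode: "\<And>\<theta>. 0 < \<theta> \<Longrightarrow> \<theta> < pi/2 \<Longrightarrow>
       cos \<theta> * \<phi>'' \<theta> = (n - 1) * sin \<theta> * \<phi>' \<theta> - cos \<theta> * f (\<phi> \<theta>)"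
    and neumann: "(\<phi> has_real_derivative 0) (at_right 0)"
    and f_cont: "continuous_on {0<..} f"
    and dec: "\<And>s t. 0 < s \<Longrightarrow> s < t \<Longrightarrow>
        t powr (-(n+2)/(n-2)) * (f t + n*(n-2)/4 * t) < s powr (-(n+2)/(n-2)) * (f s + n*(n-2)/4 * s)"
begin

text \<open>\<open>\<phi>'\<close> is not controlled at 0; the value 0 set here is the one-sided
  derivative of \<phi>, and it will turn out to be the limit of \<open>\<phi>'\<close> as
  well.\<close>

definition "\<psi> \<theta> = (if \<theta> = 0 then 0 else \<phi>' \<theta>)"
definition "flux \<theta> = cos \<theta> ^ (M + 1) * \<psi> \<theta>"

lemma cos_pos: "0 \<le> \<theta> \<Longrightarrow> \<theta> < pi/2 \<Longrightarrow> 0 < cos \<theta>" by (rule cos_gt_zero_pi) auto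

lemma sin_pos: "0 < \<theta> \<Longrightarrow> \<theta> \<le> pi/2 \<Longrightarrow> 0 < sin \<theta>"
  using pi_gt_zero by (intro sin_gt_zero) linarith+

lemma f\<phi>_cont: "continuous_on {0..pi/2} (\<lambda>\<theta>. f (\<phi> \<theta>))"
  by (rule continuous_on_compose2[OF f_cont cont]) (use pos in auto)

text \<open>The ODE in divergence form, with the exponent \<open>M + 1 = n - 1\<close> as
  integrating factor.\<close>

lemma flux_derivative:
  assumes \<theta>: "0 < \<theta>" "\<theta> < pi/2"
  shows "(flux has_real_derivative - (cos \<theta> ^ (M + 1) * f (\<phi> \<theta>))) (at \<theta>)"
proof -
  have "((\<lambda>\<theta>. cos \<theta> ^ (M + 1)) has_real_derivative real (M + 1) * cos \<theta> ^ M * (- sin \<theta>)) (at \<theta>)"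
    by (rule DERIV_cong[OF DERIV_power[OF DERIV_cos]]) simp
  from DERIV_mult[OF this d2] have
    "((\<lambda>\<theta>. cos \<theta> ^ (M + 1) * \<phi>' \<theta>) has_real_derivative
       real (M + 1) * cos \<theta> ^ M * (- sin \<theta>) * \<phi>' \<theta> + \<phi>'' \<theta> * cos \<theta> ^ (M + 1)) (at \<theta>)"
    using \<theta> by simp
  moreover have "real (M + 1) * cos \<theta> ^ M * (- sin \<theta>) * \<phi>' \<theta> + \<phi>'' \<theta> * cos \<theta> ^ (M + 1)
      = cos \<theta> ^ M * (cos \<theta> * \<phi>'' \<theta> - (n - 1) * sin \<theta> * \<phi>' \<theta>)"
    by (simp add: n algebra_simps)
  moreover have "\<dots> = - (cos \<theta> ^ (M + 1) * f (\<phi> \<theta>))" using ode[OF \<theta>] by simp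
  moreover have "\<forall>\<^sub>F s in nhds \<theta>. flux s = cos s ^ (M + 1) * \<phi>' s"
  proof -
    have "\<forall>\<^sub>F s in nhds \<theta>. s \<in> - {0}" using \<theta> by (intro eventually_nhds_in_open) auto
    then show ?thesis by eventually_elim (auto simp: flux_def \<psi>_def)
  qed
  ultimately show ?thesis by (simp add: DERIV_cong_ev)
qed

text \<open>The Neumann condition and the mean value theorem provide points arbitrarily close to 0
  where \<open>\<phi>'\<close> is small, and the divergence form bounds the change of the flux from
  there. Thus a derivative known only at the endpoint becomes a limit of derivatives.\<close>

lemma flux_bound:
  obtains B where "\<And>\<theta>. 0 < \<theta> \<Longrightarrow> \<theta> < pi/2 \<Longrightarrow> \<bar>flux \<theta>\<bar> \<le> B * \<theta>"
proof -
  have "bounded ((\<lambda>\<theta>. f (\<phi> \<theta>)) ` {0..pi/2})"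
    using compact_continuous_image[OF f\<phi>_cont] compact_imp_bounded by auto
  then obtain B where "\<forall>\<theta>\<in>{0..pi/2}. \<bar>f (\<phi> \<theta>)\<bar> \<le> B" unfolding bounded_iff by auto
  then have B: "\<bar>f (\<phi> \<theta>)\<bar> \<le> B" if "0 \<le> \<theta>" "\<theta> \<le> pi/2" for \<theta> using that by simp
  have B0: "B \<ge> 0" using B[of 0] by simp
  have lip: "\<bar>flux t - flux s\<bar> \<le> B * t" if st: "0 < s" "s < t" "t < pi/2" for s t
  proof -
    have "\<exists>z. s < z \<and> z < t \<and> flux t - flux s = (t - s) * (- (cos z ^ (M + 1) * f (\<phi> z)))"
      by (rule MVT2[OF st(2) flux_derivative]) (use st in auto)
    then obtain z where z: "s < z" "z < t" "flux t - flux s = (t - s) * (- (cos z ^ (M + 1) * f (\<phi> z)))" by blast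
    have "\<bar>cos z ^ (M + 1)\<bar> \<le> 1" unfolding power_abs by (rule power_le_one) auto
    then have "\<bar>cos z ^ (M + 1) * f (\<phi> z)\<bar> \<le> 1 * B"
      unfolding abs_mult using B[of z] z st by (intro mult_mono) auto
    then have "(t - s) * \<bar>cos z ^ (M + 1) * f (\<phi> z)\<bar> \<le> t * B" using st B0 by (intro mult_mono) auto
    then show ?thesis using z(3) st by (simp add: abs_mult mult.commute)
  qed
  show ?thesis
  proof (rule that[of B])
    fix \<theta> assume \<theta>: "0 < \<theta>" "\<theta> < pi/2"
    show "\<bar>flux \<theta>\<bar> \<le> B * \<theta>"
    proof (rule field_le_epsilon)
      fix \<epsilon> :: real assume \<epsilon>: "\<epsilon> > 0"
      have "((\<lambda>s. (\<phi> s - \<phi> 0) / s) \<longlongrightarrow> 0) (at_right 0)"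
        using neumann unfolding has_field_derivative_iff by simp
      then have "\<forall>\<^sub>F s in at_right 0. dist ((\<phi> s - \<phi> 0) / s) 0 < \<epsilon>" using \<epsilon> by (rule tendstoD)
      moreover have "\<forall>\<^sub>F s in at_right 0. s \<in> {0<..<\<theta>}" by (rule eventually_at_right_real[OF \<theta>(1)])
      ultimately have "\<forall>\<^sub>F s in at_right 0. dist ((\<phi> s - \<phi> 0) / s) 0 < \<epsilon> \<and> s \<in> {0<..<\<theta>}"
        by (rule eventually_conj)
      then obtain s where s: "dist ((\<phi> s - \<phi> 0) / s) 0 < \<epsilon>" "0 < s" "s < \<theta>"
        using eventually_happens'[OF trivial_limit_at_right_real] by fastforce
      have "\<exists>l z. 0 < z \<and> z < s \<and> (\<phi> has_real_derivative l) (at z) \<and> \<phi> s - \<phi> 0 = (s - 0) * l"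
      proof (rule MVT[OF s(2)])
        show "continuous_on {0..s} \<phi>" by (rule continuous_on_subset[OF cont]) (use s \<theta> in auto)
        show "\<phi> differentiable (at x)" if "0 < x" "x < s" for x
          using d1[of x] that s \<theta> real_differentiable_def by force
      qed
      then obtain l z where z: "0 < z" "z < s" "(\<phi> has_real_derivative l) (at z)" "\<phi> s - \<phi> 0 = s * l" by auto
      have "l = \<phi>' z" using DERIV_unique[OF z(3) d1[of z]] z s \<theta> by simp
      then have "\<bar>\<phi>' z\<bar> < \<epsilon>" using s z by (simp add: dist_real_def)
      moreover have "\<bar>flux z\<bar> \<le> \<bar>\<phi>' z\<bar>"
      proof -
        have "\<bar>cos z ^ (M + 1)\<bar> \<le> 1" unfolding power_abs by (rule power_le_one) auto
        then have "\<bar>cos z ^ (M + 1)\<bar> * \<bar>\<phi>' z\<bar> \<le> 1 * \<bar>\<phi>' z\<bar>" by (rule mult_right_mono) simp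
        then show ?thesis using z(1) by (simp add: flux_def \<psi>_def abs_mult)
      qed
      moreover have "\<bar>flux \<theta> - flux z\<bar> \<le> B * \<theta>" using lip[of z \<theta>] z s \<theta> by simp
      ultimately show "\<bar>flux \<theta>\<bar> \<le> B * \<theta> + \<epsilon>" by linarith
    qed
  qed
qed

lemma flux_cont: "continuous_on {0..<pi/2} flux"
proof -
  obtain B where B: "\<And>\<theta>. 0 < \<theta> \<Longrightarrow> \<theta> < pi/2 \<Longrightarrow> \<bar>flux \<theta>\<bar> \<le> B * \<theta>" using flux_bound by blast
  have "continuous (at \<theta> within {0..<pi/2}) flux" if \<theta>: "0 \<le> \<theta>" "\<theta> < pi/2" for \<theta>
  proof (cases "\<theta> = 0")
    case False
    then show ?thesis using flux_derivative[of \<theta>] \<theta> DERIV_isCont continuous_at_imp_continuous_at_within by force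
  next
    case True
    have "(flux \<longlongrightarrow> 0) (at 0 within {0..<pi/2})"
    proof (rule Lim_null_comparison)
      show "\<forall>\<^sub>F t in at 0 within {0..<pi/2}. norm (flux t) \<le> B * t"
        unfolding eventually_at_filter using B by (intro always_eventually) auto
      have "((\<lambda>t. B * t) \<longlongrightarrow> B * 0) (at 0 within {0..<pi/2})" by (intro tendsto_intros)
      then show "((\<lambda>t. B * t) \<longlongrightarrow> 0) (at 0 within {0..<pi/2})" by simp
    qed
    then show ?thesis using True by (simp add: continuous_within flux_def \<psi>_def)
  qed
  then show ?thesis by (simp add: continuous_on_eq_continuous_within)
qed

lemma \<psi>_cont: "continuous_on {0..pi/2} \<psi>"
  unfolding continuous_on_eq_continuous_within
proof
  fix \<theta> assume \<theta>: "\<theta> \<in> {0..pi/2}"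
  show "continuous (at \<theta> within {0..pi/2}) \<psi>"
  proof (cases "\<theta> = 0")
    case False
    then have "isCont \<phi>' \<theta>" using d2[of \<theta>] \<theta> DERIV_isCont by force
    moreover have "\<forall>\<^sub>F s in nhds \<theta>. \<psi> s = \<phi>' s"
    proof -
      have "\<forall>\<^sub>F s in nhds \<theta>. s \<in> - {0}" using False by (intro eventually_nhds_in_open) auto
      then show ?thesis by eventually_elim (auto simp: \<psi>_def)
    qed
    ultimately have "isCont \<psi> \<theta>" by (simp add: isCont_cong)
    then show ?thesis by (rule continuous_at_imp_continuous_at_within)
  next
    case True
    have sub: "{0..pi/4} \<subseteq> {0..<pi/2}" 
    proof
      fix t assume "t \<in> {0..pi/4}"
      then show "t \<in> {0..<pi/2}" using pi_gt_zero by (simp add: field_simps del: pi_gt_zero)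
    qed
    have nz: "cos t ^ (M + 1) \<noteq> 0" if "t \<in> {0..pi/4}" for t
    proof -
      have "0 < cos t" using that sub by (intro cos_pos) auto
      then show ?thesis by simp
    qed
    have "continuous_on {0..pi/4} (\<lambda>t. flux t / cos t ^ (M + 1))"
      by (intro continuous_intros continuous_on_subset[OF flux_cont sub]) (use nz in blast)
    then have "((\<lambda>t. flux t / cos t ^ (M + 1)) \<longlongrightarrow> 0) (at 0 within {0..pi/4})"
      unfolding continuous_on_def by (force simp: flux_def \<psi>_def)
    moreover have "\<forall>\<^sub>F t in at 0 within {0..pi/4}. flux t / cos t ^ (M + 1) = \<psi> t"
      unfolding eventually_at_filter flux_def using nz
      by (intro always_eventually) (auto simp del: power_Suc)
    ultimately have "(\<psi> \<longlongrightarrow> 0) (at 0 within {0..pi/4})" by (rule Lim_transform_eventually)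
    moreover have "at 0 within {0..pi/4} = at_right 0" "at 0 within {0..pi/2} = at_right 0"
      by (auto simp: at_within_Icc_at_right)
    ultimately show ?thesis using True by (simp add: continuous_within \<psi>_def)
  qed
qed

text \<open>The sign \<sigma> is 1 for a minimum and -1 for a maximum. From \<open>0 = \<sigma> * E
  (pi/2) \<le> \<sigma> * E \<theta> \<le> \<sigma> * E \<theta>1 \<le> 0\<close> the energy
  vanishes between \<open>\<theta>1\<close> and the pole; so does its derivative, hence
  \<open>D (\<phi> \<theta>)\<close>, and \<open>D\<close> has its only zero at the extremal
  value.\<close>

lemma extremal_value_at_pole:
  assumes \<sigma>: "\<sigma> = 1 \<or> \<sigma> = -1" and \<theta>1: "0 \<le> \<theta>1" "\<theta>1 < pi/2"
    and ext: "\<And>\<theta>. 0 \<le> \<theta> \<Longrightarrow> \<theta> \<le> pi/2 \<Longrightarrow> 0 \<le> \<sigma> * (\<phi> \<theta> - \<phi> \<theta>1)"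
  shows "\<phi> (pi/2) = \<phi> \<theta>1"
proof -
  define y where "y = \<phi> \<theta>1"
  have y: "y > 0" unfolding y_def using pos \<theta>1 by simp
  have \<psi>1: "\<psi> \<theta>1 = 0"
  proof (cases "\<theta>1 = 0")
    case False
    then have t: "0 < \<theta>1" using \<theta>1 by simp
    have "((\<lambda>\<theta>. \<sigma> * \<phi> \<theta>) has_real_derivative \<sigma> * \<phi>' \<theta>1) (at \<theta>1)"
      using d1[of \<theta>1] t \<theta>1 by (intro DERIV_cmult) auto
    then have "\<sigma> * \<phi>' \<theta>1 = 0"
    proof (rule DERIV_local_min[of _ _ _ "min \<theta>1 (pi/2 - \<theta>1)"])
      show "0 < min \<theta>1 (pi/2 - \<theta>1)" using t \<theta>1 by simp
      show "\<forall>s. \<bar>\<theta>1 - s\<bar> < min \<theta>1 (pi/2 - \<theta>1) \<longrightarrow> \<sigma> * \<phi> \<theta>1 \<le> \<sigma> * \<phi> s"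
      proof (intro allI impI)
        fix s assume "\<bar>\<theta>1 - s\<bar> < min \<theta>1 (pi/2 - \<theta>1)"
        then have "0 \<le> s" "s \<le> pi/2" by auto
        from ext[OF this] show "\<sigma> * \<phi> \<theta>1 \<le> \<sigma> * \<phi> s" by (simp add: right_diff_distrib)
      qed
    qed
    then show ?thesis using False \<sigma> by (auto simp: \<psi>_def)
  qed (simp add: \<psi>_def)
  have f_sign: "\<sigma> * f y \<le> 0"
  proof (rule ccontr)
    assume neg: "\<not> ?thesis"
    have "continuous_on {0..pi/2} (\<lambda>\<theta>. \<sigma> * f (\<phi> \<theta>))" by (intro continuous_intros f\<phi>_cont)
    then obtain \<delta> where \<delta>: "\<delta> > 0" "\<And>\<theta>. \<theta> \<in> {0..pi/2} \<Longrightarrow> dist \<theta> \<theta>1 < \<delta> \<Longrightarrow>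
        dist (\<sigma> * f (\<phi> \<theta>)) (\<sigma> * f (\<phi> \<theta>1)) < \<sigma> * f y"
      unfolding continuous_on_iff using neg \<theta>1 by (metis atLeastAtMost_iff less_eq_real_def not_le)
    define \<theta>2 where "\<theta>2 = min (\<theta>1 + \<delta> / 2) ((\<theta>1 + pi/2) / 2)"
    have "\<theta>2 \<le> (\<theta>1 + pi/2) / 2" unfolding \<theta>2_def by (rule min.cobounded2)
    then have "\<theta>2 < pi/2" using \<theta>1 by (simp add: field_simps)
    then have \<theta>2: "\<theta>1 < \<theta>2" "\<theta>2 < pi/2" "\<theta>2 < \<theta>1 + \<delta>" using \<delta>(1) \<theta>1 by (auto simp: \<theta>2_def min_less_iff_disj)
    have f_pos: "0 < \<sigma> * f (\<phi> \<theta>)" if "\<theta>1 < \<theta>" "\<theta> \<le> \<theta>2" for \<theta>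
    proof -
      have "dist (\<sigma> * f (\<phi> \<theta>)) (\<sigma> * f (\<phi> \<theta>1)) < \<sigma> * f y"
        using that \<theta>1 \<theta>2 by (intro \<delta>(2)) (auto simp: dist_real_def)
      then show ?thesis unfolding y_def dist_real_def by linarith
    qed
    have flux_neg: "\<sigma> * flux \<theta> < 0" if \<theta>: "\<theta>1 < \<theta>" "\<theta> \<le> \<theta>2" for \<theta>
    proof -
      have "\<sigma> * flux \<theta> < \<sigma> * flux \<theta>1"
      proof (rule DERIV_neg_imp_decreasing_open[OF \<theta>(1)])
        show "\<exists>y. ((\<lambda>\<theta>. \<sigma> * flux \<theta>) has_real_derivative y) (at x) \<and> y < 0" if x: "\<theta>1 < x" "x < \<theta>" for x
        proof (intro exI conjI)
          show "((\<lambda>\<theta>. \<sigma> * flux \<theta>) has_real_derivative \<sigma> * - (cos x ^ (M + 1) * f (\<phi> x))) (at x)"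
            using x \<theta> \<theta>1 \<theta>2 by (intro DERIV_cmult flux_derivative) auto
          have "0 < cos x ^ (M + 1) * (\<sigma> * f (\<phi> x))"
            using f_pos[of x] cos_pos[of x] x \<theta> \<theta>1 \<theta>2
            by (intro mult_pos_pos[of "_ ^ _"] zero_less_power) auto
          then show "\<sigma> * - (cos x ^ (M + 1) * f (\<phi> x)) < 0" by (simp add: mult.left_commute)
        qed
        show "continuous_on {\<theta>1..\<theta>} (\<lambda>\<theta>. \<sigma> * flux \<theta>)"
          by (intro continuous_intros continuous_on_subset[OF flux_cont]) (use \<theta> \<theta>1 \<theta>2 in auto)
      qed
      then show ?thesis using \<psi>1 by (simp add: flux_def)
    qed
    have "\<sigma> * \<phi> \<theta>2 < \<sigma> * \<phi> \<theta>1"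
    proof (rule DERIV_neg_imp_decreasing_open[OF \<theta>2(1)])
      show "\<exists>y. ((\<lambda>\<theta>. \<sigma> * \<phi> \<theta>) has_real_derivative y) (at x) \<and> y < 0" if x: "\<theta>1 < x" "x < \<theta>2" for x
      proof (intro exI conjI)
        show "((\<lambda>\<theta>. \<sigma> * \<phi> \<theta>) has_real_derivative \<sigma> * \<phi>' x) (at x)"
          using x \<theta>1 \<theta>2 by (intro DERIV_cmult d1) auto
        have "cos x ^ (M + 1) * (\<sigma> * \<phi>' x) < 0"
          using flux_neg[of x] x \<theta>1 by (simp add: flux_def \<psi>_def mult.left_commute)
        then show "\<sigma> * \<phi>' x < 0"
          using cos_pos[of x] x \<theta>1 \<theta>2 by (simp add: mult_less_0_iff)
      qed
      show "continuous_on {\<theta>1..\<theta>2} (\<lambda>\<theta>. \<sigma> * \<phi> \<theta>)"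
        by (intro continuous_intros continuous_on_subset[OF cont]) (use \<theta>1 \<theta>2 in auto)
    qed
    then show False using ext[of \<theta>2] \<theta>1 \<theta>2 by (simp add: right_diff_distrib)
  qed
  define w where "w = (\<lambda>s. f s + n * (n - 2) / 4 * s)"
  have n2: "n > 2" using n M by simp
  have "compact (\<phi> ` {0..pi/2})" by (intro compact_continuous_image cont) simp
  then have "bounded (\<phi> ` {0..pi/2})" by (rule compact_imp_bounded)
  then obtain b where "\<forall>\<theta>\<in>{0..pi/2}. \<bar>\<phi> \<theta>\<bar> \<le> b" unfolding bounded_iff by auto
  then have b: "\<phi> \<theta> \<le> b" if "0 \<le> \<theta>" "\<theta> \<le> pi/2" for \<theta> using that by (meson abs_le_iff atLeastAtMost_iff)
  have "\<exists>x\<in>{0..pi/2}. \<forall>\<theta>\<in>{0..pi/2}. \<phi> x \<le> \<phi> \<theta>"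
    by (rule continuous_attains_inf) (use cont in auto)
  then obtain x0 where x0: "x0 \<in> {0..pi/2}" "\<And>\<theta>. \<theta> \<in> {0..pi/2} \<Longrightarrow> \<phi> x0 \<le> \<phi> \<theta>" by blast
  \<comment> \<open>Half the minimum, and the maximum bound plus 1, leave a margin on both sides, so
    that the antiderivative has a two-sided derivative at every value of \<phi>.\<close>
  define a where "a = \<phi> x0 / 2"
  have a: "a > 0" using pos x0(1) by (simp add: a_def)
  have range: "a < \<phi> \<theta>" "\<phi> \<theta> < b + 1" if "0 \<le> \<theta>" "\<theta> \<le> pi/2" for \<theta>
    using x0(2)[of \<theta>] b[of \<theta>] that a by (auto simp: a_def)
  have wc: "continuous_on {a..b+1} w" unfolding w_def
    by (intro continuous_intros continuous_on_subset[OF f_cont]) (use a in auto)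
  from antiderivative_continuous[OF wc] obtain g0 where
    g0: "\<And>x. x \<in> {a..b+1} \<Longrightarrow> (g0 has_vector_derivative w x) (at x within {a..b+1})" by blast
  have g0': "(g0 has_real_derivative w s) (at s)" if "a < s" "s < b + 1" for s
  proof -
    have "(g0 has_real_derivative w s) (at s within {a..b+1})"
      using g0[of s] that by (simp add: has_real_derivative_iff_has_vector_derivative)
    moreover have "at s within {a..b+1} = at s" using that by (intro at_within_interior) simp
    ultimately show ?thesis by simp
  qed
  \<comment> \<open>The constant of integration is chosen to make the defect \<open>D\<close> vanish
    at \<open>y\<close>; with strict monotonicity the sign of \<open>D (\<phi> \<theta>)\<close> is
    then that of \<open>\<phi> \<theta> - y\<close>.\<close>
  define g where "g = (\<lambda>s. g0 s - g0 y + (n - 2) / (2 * n) * y * w y)"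
  define D where "D = (\<lambda>s. g s - (n - 2) / (2 * n) * s * w s)"
  have g': "(g has_real_derivative w s) (at s)" if "a < s" "s < b + 1" for s
    unfolding g_def using g0'[OF that] by (auto intro!: derivative_eq_intros)
  have Dy: "D y = 0" by (simp add: D_def g_def)
  have D_mono: "D s < D t" if "a < s" "s < t" "t < b + 1" for s t
    unfolding D_def w_def
    by (rule pohozaev_defect_strict_mono[OF n2 _ that(2) _ dec])
       (use that a g' in \<open>auto simp: w_def\<close>)
  have yr: "a < y" "y < b + 1" unfolding y_def using range \<theta>1 by auto
  have D_sign: "0 \<le> \<sigma> * D (\<phi> \<theta>)" "\<phi> \<theta> \<noteq> y \<Longrightarrow> \<sigma> * D (\<phi> \<theta>) \<noteq> 0" if \<theta>: "0 \<le> \<theta>" "\<theta> \<le> pi/2" for \<theta>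
  proof -
    have e: "0 \<le> \<sigma> * (\<phi> \<theta> - y)" using ext[OF \<theta>] by (simp add: y_def)
    note r = range[OF \<theta>]
    show "0 \<le> \<sigma> * D (\<phi> \<theta>)"
      using \<sigma> e D_mono[OF r(1) _ yr(2)] D_mono[OF yr(1) _ r(2)] Dy
      by (cases "\<phi> \<theta>" y rule: linorder_cases) auto
    show "\<sigma> * D (\<phi> \<theta>) \<noteq> 0" if "\<phi> \<theta> \<noteq> y"
      using that \<sigma> D_mono[OF r(1) _ yr(2)] D_mono[OF yr(1) _ r(2)] Dy
      by (cases "\<phi> \<theta>" y rule: linorder_cases) auto
  qed
  define E where "E = (\<lambda>\<theta>. cos \<theta> ^ M * ((cos \<theta>)\<^sup>2 * ((\<psi> \<theta>)\<^sup>2 / 2 - \<gamma>\<^sup>2 / 2 * (\<phi> \<theta>)\<^sup>2 + g (\<phi> \<theta>))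
            - \<gamma> * (sin \<theta> * cos \<theta>) * (\<phi> \<theta> * \<psi> \<theta>)))"
  have E': "(E has_real_derivative - (n * sin \<theta> * cos \<theta> ^ (M + 1) * D (\<phi> \<theta>))) (at \<theta>)"
    if \<theta>: "0 < \<theta>" "\<theta> < pi/2" for \<theta>
  proof -
    have ev: "\<forall>\<^sub>F s in nhds \<theta>. \<psi> s = \<phi>' s"
    proof -
      have "\<forall>\<^sub>F s in nhds \<theta>. s \<in> - {0}" using \<theta> by (intro eventually_nhds_in_open) auto
      then show ?thesis by eventually_elim (auto simp: \<psi>_def)
    qed
    have "(\<psi> has_real_derivative \<phi>'' \<theta>) (at \<theta>)"
      using d2[of \<theta>] \<theta> DERIV_cong_ev[OF refl ev refl] by simp
    moreover have "(\<phi> has_real_derivative \<psi> \<theta>) (at \<theta>)" using d1[of \<theta>] \<theta> by (simp add: \<psi>_def)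
    ultimately show ?thesis
      using pohozaev_energy_derivative[of M \<theta> \<phi> \<psi> "\<phi>'' \<theta>" g f] M cos_pos[of \<theta>] \<theta>
        g'[of "\<phi> \<theta>"] range[of \<theta>] ode[OF \<theta>]
      unfolding E_def D_def w_def n \<gamma> by (simp add: \<psi>_def)
  qed
  have gc: "continuous_on {0..pi/2} (\<lambda>\<theta>. g (\<phi> \<theta>))"
  proof (rule continuous_on_compose2[OF _ cont])
    show "continuous_on {a<..<b+1} g"
      by (intro continuous_at_imp_continuous_on ballI DERIV_isCont[OF g']) auto
    show "\<phi> ` {0..pi/2} \<subseteq> {a<..<b+1}" using range by auto
  qed
  have E_cont: "continuous_on {0..pi/2} E"
    unfolding E_def by (intro continuous_intros gc \<psi>_cont cont) auto
  have E_mono: "\<sigma> * E t \<le> \<sigma> * E s" if st: "\<theta>1 \<le> s" "s \<le> t" "t \<le> pi/2" for s t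
  proof (cases "s = t")
    case False
    then have lt: "s < t" using st by simp
    show ?thesis
    proof (rule DERIV_nonpos_imp_decreasing_open[OF less_imp_le[OF lt]])
      show "\<exists>y. ((\<lambda>\<theta>. \<sigma> * E \<theta>) has_real_derivative y) (at x) \<and> y \<le> 0" if x: "s < x" "x < t" for x
      proof (intro exI conjI)
        have x': "0 < x" "x < pi/2" using x st \<theta>1 by auto
        show "((\<lambda>\<theta>. \<sigma> * E \<theta>) has_real_derivative \<sigma> * - (n * sin x * cos x ^ (M + 1) * D (\<phi> x))) (at x)"
          by (intro DERIV_cmult E' x')
        have "0 \<le> n * sin x * cos x ^ (M + 1)"
          using x' cos_pos[of x] sin_pos[of x] n2 by (intro mult_nonneg_nonneg zero_le_power) auto
        moreover have "0 \<le> \<sigma> * D (\<phi> x)" using x' by (intro D_sign(1)) auto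
        ultimately have "0 \<le> (n * sin x * cos x ^ (M + 1)) * (\<sigma> * D (\<phi> x))"
          by (rule mult_nonneg_nonneg)
        then show "\<sigma> * - (n * sin x * cos x ^ (M + 1) * D (\<phi> x)) \<le> 0" by (simp add: mult.left_commute)
      qed
      show "continuous_on {s..t} (\<lambda>\<theta>. \<sigma> * E \<theta>)"
        by (intro continuous_intros continuous_on_subset[OF E_cont]) (use st \<theta>1 in auto)
    qed
  qed simp
  have E_pole: "E (pi/2) = 0" using M by (simp add: E_def)
  \<comment> \<open>With \<open>\<psi> \<theta>1 = 0\<close> the quadratic term of the energy
    cancels the linear part of the nonlinearity in \<open>g y\<close>, since
    \<open>(n - 2) / (2 * n) * (n * (n - 2) / 4) = \<gamma>\<^sup>2 / 2\<close>. A nonnegative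
    multiple of \<open>f y\<close> remains.\<close>
  have E1: "\<sigma> * E \<theta>1 \<le> 0"
  proof -
    have "g y = (n - 2) / (2 * n) * y * w y" by (simp add: g_def)
    also have "\<dots> = (n - 2) / (2 * n) * y * f y + \<gamma>\<^sup>2 / 2 * y\<^sup>2"
    proof -
      have "(n - 2) / (2 * n) * (n * (n - 2) / 4) = \<gamma>\<^sup>2 / 2"
        using n2 by (simp add: n \<gamma> field_simps power2_eq_square)
      then have "(n - 2) / (2 * n) * y * (n * (n - 2) / 4 * y) = \<gamma>\<^sup>2 / 2 * y\<^sup>2"
        by (metis (no_types, opaque_lifting) mult.assoc mult.left_commute power2_eq_square)
      then show ?thesis by (simp add: w_def distrib_left)
    qed
    finally have "E \<theta>1 = cos \<theta>1 ^ M * ((cos \<theta>1)\<^sup>2 * ((n - 2) / (2 * n) * y * f y))"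
      unfolding E_def \<psi>1 y_def[symmetric] by simp
    then have "\<sigma> * E \<theta>1 = (cos \<theta>1 ^ M * (cos \<theta>1)\<^sup>2 * ((n - 2) / (2 * n) * y)) * (\<sigma> * f y)" by simp
    moreover have "0 \<le> cos \<theta>1 ^ M * (cos \<theta>1)\<^sup>2 * ((n - 2) / (2 * n) * y)"
      using cos_pos[OF \<theta>1] n2 y by (intro mult_nonneg_nonneg zero_le_power) auto
    ultimately show ?thesis using f_sign by (simp only: mult_nonneg_nonpos)
  qed
  have E_zero: "E \<theta> = 0" if "\<theta>1 \<le> \<theta>" "\<theta> \<le> pi/2" for \<theta>
  proof -
    have "\<sigma> * E \<theta> \<le> 0" using E_mono[OF order_refl that] E1 by linarith
    moreover have "0 \<le> \<sigma> * E \<theta>" using E_mono[OF that order_refl] E_pole by simp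
    ultimately have "\<sigma> * E \<theta> = 0" by simp
    then show ?thesis using \<sigma> by auto
  qed
  have const: "\<phi> \<theta> = y" if \<theta>: "\<theta>1 < \<theta>" "\<theta> < pi/2" for \<theta>
  proof (rule ccontr)
    assume "\<phi> \<theta> \<noteq> y"
    then have Dn: "D (\<phi> \<theta>) \<noteq> 0" using D_sign(2)[of \<theta>] \<theta> \<theta>1 by auto
    have \<theta>0: "0 < \<theta>" using \<theta> \<theta>1 by simp
    have "\<forall>\<^sub>F s in nhds \<theta>. s \<in> {\<theta>1<..<pi/2}" using \<theta> by (intro eventually_nhds_in_open) auto
    then have ev: "\<forall>\<^sub>F s in nhds \<theta>. E s = 0" by eventually_elim (use E_zero in auto)
    have "(E has_real_derivative 0) (at \<theta>)" unfolding DERIV_cong_ev[OF refl ev refl] by simp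
    from DERIV_unique[OF this E'[OF \<theta>0 \<theta>(2)]]
    have "n * sin \<theta> * cos \<theta> ^ (M + 1) * D (\<phi> \<theta>) = 0" by simp
    then show False using Dn n2 sin_pos[of \<theta>] cos_pos[of \<theta>] \<theta>0 \<theta> by auto
  qed
  have "(\<phi> \<longlongrightarrow> \<phi> (pi/2)) (at (pi/2) within {0..pi/2})" using cont by (auto simp: continuous_on_def)
  then have lim: "(\<phi> \<longlongrightarrow> \<phi> (pi/2)) (at_left (pi/2))" by (simp add: at_within_Icc_at_left)
  have "\<forall>\<^sub>F s in at_left (pi/2). s \<in> {\<theta>1<..<pi/2}" by (rule eventually_at_left_real[OF \<theta>1(2)])
  then have "\<forall>\<^sub>F s in at_left (pi/2). \<phi> s = y" by eventually_elim (use const in auto)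
  then have "(\<phi> \<longlongrightarrow> y) (at_left (pi/2))" by (rule tendsto_eventually)
  with lim have "\<phi> (pi/2) = y" by (rule tendsto_unique[rotated]) simp
  then show ?thesis by (simp add: y_def)
qed

theorem profile_constant:
  assumes "0 \<le> \<theta>" "\<theta> \<le> pi/2"
  shows "\<phi> \<theta> = \<phi> (pi/2)"
proof -
  have "\<exists>x\<in>{0..pi/2}. \<forall>\<theta>\<in>{0..pi/2}. \<phi> x \<le> \<phi> \<theta>"
    by (rule continuous_attains_inf) (use cont in auto)
  then obtain x where x: "0 \<le> x" "x \<le> pi/2" "\<And>\<theta>. 0 \<le> \<theta> \<Longrightarrow> \<theta> \<le> pi/2 \<Longrightarrow> \<phi> x \<le> \<phi> \<theta>" by auto
  have "\<exists>x\<in>{0..pi/2}. \<forall>\<theta>\<in>{0..pi/2}. \<phi> \<theta> \<le> \<phi> x"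
    by (rule continuous_attains_sup) (use cont in auto)
  then obtain z where z: "0 \<le> z" "z \<le> pi/2" "\<And>\<theta>. 0 \<le> \<theta> \<Longrightarrow> \<theta> \<le> pi/2 \<Longrightarrow> \<phi> \<theta> \<le> \<phi> z" by auto
  have "\<phi> (pi/2) = \<phi> x"
  proof (cases "x = pi/2")
    case False
    show ?thesis by (rule extremal_value_at_pole[of 1]) (use False x in auto)
  qed (simp only:)
  moreover have "\<phi> (pi/2) = \<phi> z"
  proof (cases "z = pi/2")
    case False
    show ?thesis by (rule extremal_value_at_pole[of "-1"]) (use False z in auto)
  qed (simp only:)
  ultimately show ?thesis using x(3)[OF assms] z(3)[OF assms] by simp
qed

end

section \<open>Proof of the theorem\<close>

lemma lap_at_unique:
  assumes "lap_at F x g L" "lap_at F x g' L'"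
  shows "L = L'"
proof -
  have "L - L' \<le> 0" using lap_at_local_max[OF lap_at_diff[OF assms]] by simp
  moreover have "L' - L \<le> 0" using lap_at_local_max[OF lap_at_diff[OF assms(2,1)]] by simp
  ultimately show ?thesis by simp
qed

text \<open>For q = \<bar>x\<bar> + x \<bullet> e the squared gradient is 2 q / \<bar>x\<bar> and
  the Laplacian is 2 (\<gamma> + 1) / \<bar>x\<bar>; in the chain rule for the power -\<gamma> the
  two terms cancel.\<close>

lemma lap_at_conformal_factor:
  fixes e x :: "'a::euclidean_space"
  assumes e: "norm e = 1" and \<gamma>: "2 * \<gamma> = real DIM('a) - 3" and x: "0 < norm x + x \<bullet> e"
  shows "lap_at (\<lambda>x. (norm x + x \<bullet> e) powr (-\<gamma>)) x
    ((- \<gamma> * (norm x + x \<bullet> e) powr (-\<gamma> - 1)) *\<^sub>R ((1 / norm x) *\<^sub>R x + e)) 0"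
proof -
  define r q where "r = norm x" and "q = norm x + x \<bullet> e"
  have x0: "x \<noteq> 0" using x by auto
  have r: "r > 0" using x0 by (simp add: r_def)
  have q: "q > 0" using x by (simp add: q_def)
  have ee: "e \<bullet> e = 1" using e by (simp add: norm_eq_1)
  have "lap_at (\<lambda>x. (\<lambda>s. s powr (-\<gamma>)) (norm x + x \<bullet> e)) x
    ((- \<gamma> * q powr (-\<gamma> - 1)) *\<^sub>R ((1 / norm x) *\<^sub>R x + e))
    ((- \<gamma> * ((- \<gamma> - 1) * q powr (- \<gamma> - 1 - 1))) * (((1 / norm x) *\<^sub>R x + e) \<bullet> ((1 / norm x) *\<^sub>R x + e))
      + (- \<gamma> * q powr (-\<gamma> - 1)) * ((real DIM('a) - 1) / norm x + 0))"
    unfolding q_def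
  proof (rule lap_at_compose[OF lap_at_add[OF lap_at_norm[OF x0] lap_at_inner]])
    have "\<forall>\<^sub>F s in nhds q. s \<in> {0<..}" using q by (intro eventually_nhds_in_open) auto
    then show "\<forall>\<^sub>F s in nhds (norm x + x \<bullet> e). ((\<lambda>s. s powr - \<gamma>) has_real_derivative - \<gamma> * s powr (- \<gamma> - 1)) (at s)"
      unfolding q_def[symmetric] by eventually_elim (rule has_real_derivative_powr, simp)
    show "((\<lambda>s. - \<gamma> * s powr (- \<gamma> - 1)) has_real_derivative
        - \<gamma> * ((- \<gamma> - 1) * (norm x + x \<bullet> e) powr (- \<gamma> - 1 - 1))) (at (norm x + x \<bullet> e))"
      by (intro DERIV_cmult has_real_derivative_powr x)
  qed
  moreover have "((1 / norm x) *\<^sub>R x + e) \<bullet> ((1 / norm x) *\<^sub>R x + e) = 2 * q / r"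
  proof -
    have "((1 / norm x) *\<^sub>R x + e) \<bullet> ((1 / norm x) *\<^sub>R x + e) = (1 / r)\<^sup>2 * r\<^sup>2 + 2 * (1 / r) * (x \<bullet> e) + 1"
      unfolding r_def power2_norm_eq_inner
      by (simp add: inner_add_left inner_add_right ee inner_commute power2_eq_square algebra_simps)
    also have "\<dots> = 2 * q / r" using r by (simp add: q_def r_def field_simps)
    finally show ?thesis .
  qed
  moreover have "(- \<gamma> * ((- \<gamma> - 1) * q powr (- \<gamma> - 1 - 1))) * (2 * q / r)
      + (- \<gamma> * q powr (-\<gamma> - 1)) * ((real DIM('a) - 1) / norm x + 0) = 0"
  proof -
    have "q powr (- \<gamma> - 1) = q powr ((- \<gamma> - 1 - 1) + 1)" by (rule arg_cong[of _ _ "\<lambda>s. q powr s"]) simp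
    also have "\<dots> = q powr (- \<gamma> - 1 - 1) * q" using q by (subst powr_add) simp
    finally have "(- \<gamma> * ((- \<gamma> - 1) * q powr (- \<gamma> - 1 - 1))) * (2 * q / r)
      = \<gamma> * (\<gamma> + 1) * 2 * q powr (- \<gamma> - 1) / r" by (simp add: algebra_simps add_divide_distrib)
    moreover have "(- \<gamma> * q powr (-\<gamma> - 1)) * ((real DIM('a) - 1) / norm x + 0)
      = - (\<gamma> * (\<gamma> + 1) * 2 * q powr (- \<gamma> - 1) / r)"
    proof -
      have "real DIM('a) - 1 = 2 * (\<gamma> + 1)" using \<gamma> by simp
      then show ?thesis by (simp add: r_def)
    qed
    ultimately show ?thesis by simp
  qed
  ultimately show ?thesis by (simp add: q_def)
qed

section \<open>Parallels of the equator as level sets of the height\<close>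

lemma ex_other_index:
  assumes "4 \<le> CARD('m::finite)"
  shows "\<exists>i::'m. i \<noteq> e"
proof (rule ccontr)
  assume "\<not> ?thesis"
  then have "(UNIV :: 'm set) = {e}" by auto
  then have "CARD('m) = card {e}" by (simp only:)
  then show False using assms by simp
qed

text \<open>The nearest equatorial point is the normalised horizontal part of \<open>x\<close>;
  \<open>arccos\<close> is decreasing, so the Cauchy-Schwarz bound on \<open>x \<bullet> z\<close>
  identifies the infimum.\<close>

lemma dist_bdry_eq:
  fixes e :: "'m::finite"
  assumes dim: "4 \<le> CARD('m)" and x: "x \<in> chemi e"
  shows "dist_bdry e x = arccos (sqrt (1 - (x $ e)\<^sup>2))"
proof -
  let ?a = "axis e (1::real) :: real^'m"
  define s where "s = x $ e"
  define c where "c = sqrt (1 - s\<^sup>2)"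
  have nx: "norm x = 1" "x \<bullet> x = 1" using x by (auto simp: chemi_def norm_eq_1)
  have xa: "x \<bullet> ?a = s" by (simp add: inner_axis s_def)
  have aa: "?a \<bullet> ?a = 1" by (simp add: inner_axis)
  define v where "v = x - s *\<^sub>R ?a"
  have va: "v \<bullet> ?a = 0" by (simp add: v_def inner_diff_left xa aa)
  have "v \<bullet> v = 1 - s\<^sup>2"
    by (simp add: v_def inner_diff_left inner_diff_right nx xa aa inner_commute power2_eq_square)
  then have cv: "c = norm v" by (simp add: c_def norm_eq_sqrt_inner)
  have "0 \<le> c" using cv by simp
  moreover have "c \<le> 1" by (simp add: c_def)
  ultimately have c01: "0 \<le> c" "c \<le> 1" .
  have upper: "x \<bullet> z \<le> c" if z: "z \<in> equator e" for z
  proof -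
    have "x \<bullet> z = v \<bullet> z" using z by (simp add: v_def inner_diff_left inner_axis' equator_def)
    also have "\<dots> \<le> norm v * norm z" by (rule norm_cauchy_schwarz)
    finally show ?thesis using z cv by (simp add: equator_def)
  qed
  have "\<exists>z\<in>equator e. x \<bullet> z = c"
  proof (cases "v = 0")
    case True
    \<comment> \<open>At the pole the horizontal part vanishes and all equatorial points are equally
      distant, so any other coordinate axis serves.\<close>
    obtain i where i: "i \<noteq> e" using ex_other_index[OF dim] by blast
    have "axis i (1::real) $ e = 0" using i by (simp add: axis_def)
    then have "axis i 1 \<in> equator e" by (simp add: equator_def)
    moreover have "x \<bullet> axis i 1 = c"
    proof -
      have "x = s *\<^sub>R ?a" using True by (simp add: v_def)
      then have "x \<bullet> axis i 1 = s * (?a \<bullet> axis i 1)" by (metis inner_scaleR_left)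
      then have "x \<bullet> axis i 1 = 0" using i by (simp add: inner_axis_axis)
      then show ?thesis using cv True by simp
    qed
    ultimately show ?thesis by blast
  next
    case False
    let ?z = "(1 / norm v) *\<^sub>R v"
    have "?z \<in> equator e" using False va by (simp add: equator_def inner_axis)
    moreover have "x \<bullet> ?z = c"
    proof -
      have "x \<bullet> v = v \<bullet> v" using va by (simp add: v_def inner_diff_left inner_diff_right inner_commute xa aa)
      then show ?thesis using False cv by (simp add: power2_norm_eq_inner[symmetric] power2_eq_square)
    qed
    ultimately show ?thesis by blast
  qed
  then obtain z0 where z0: "z0 \<in> equator e" "x \<bullet> z0 = c" by blast
  have "Inf (sdist x ` equator e) = arccos c"
  proof (rule cInf_eq_minimum)
    show "arccos c \<in> sdist x ` equator e" using z0 by (force simp: sdist_def)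
    show "arccos c \<le> d" if d: "d \<in> sdist x ` equator e" for d
    proof -
      obtain z where z: "z \<in> equator e" "d = arccos (x \<bullet> z)" using d by (auto simp: sdist_def)
      have "\<bar>x \<bullet> z\<bar> \<le> norm x * norm z" by (rule Cauchy_Schwarz_ineq2)
      then have "-1 \<le> x \<bullet> z" using nx z by (simp add: equator_def abs_le_iff)
      then show ?thesis using upper[OF z(1)] c01 z(2) by (simp add: arccos_le_arccos)
    qed
  qed
  then show ?thesis by (simp add: dist_bdry_def c_def s_def)
qed

lemma parallel_set_height:
  fixes e :: "'m::finite"
  assumes "4 \<le> CARD('m)" "x \<in> parallel_set e r" "y \<in> parallel_set e r"
  shows "x $ e = y $ e"
proof -
  have xc: "x \<in> chemi e" "y \<in> chemi e" using assms by (auto simp: parallel_set_def)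
  have b: "0 \<le> w $ e \<and> (w $ e)\<^sup>2 \<le> 1" if "w \<in> chemi e" for w
    using that component_le_norm_cart[of w e] by (auto simp: chemi_def abs_square_le_1)
  have "arccos (sqrt (1 - (x $ e)\<^sup>2)) = arccos (sqrt (1 - (y $ e)\<^sup>2))"
    using dist_bdry_eq[OF assms(1)] assms by (auto simp: parallel_set_def)
  then have "sqrt (1 - (x $ e)\<^sup>2) = sqrt (1 - (y $ e)\<^sup>2)"
    using b[OF xc(1)] b[OF xc(2)] by (subst (asm) arccos_eq_iff) auto
  then have "(x $ e)\<^sup>2 = (y $ e)\<^sup>2" by simp
  then show ?thesis using b[OF xc(1)] b[OF xc(2)] power2_eq_iff_nonneg by blast
qed

context sphere_solution begin

lemma normalize_mem: "0 \<le> x \<bullet> ax \<Longrightarrow> x \<noteq> 0 \<Longrightarrow> x /\<^sub>R norm x \<in> chemi e"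
  by (simp add: chemi_def inner_ax)

lemma F_eq: "F x = u (x /\<^sub>R norm x)"
  by (simp add: F_def hom0_def)

lemma \<gamma>_dim: "2 * \<gamma> = real DIM(real^'m) - 3"
  using n by (simp add: \<gamma>)

lemma \<gamma>_pos: "\<gamma> > 0" using n_ge by (simp add: \<gamma>)

text \<open>The powers of the norm match because \<gamma> (n + 2) / (n - 2) = \<gamma> + 2 and
  \<gamma> n / (n - 2) = \<gamma> + 1, the homogeneities of the interior and boundary equations.
  Thus the hypotheses on \<open>h\<^sub>1\<close> and \<open>k\<^sub>1\<close> become exactly those
  on \<open>h\<close> and \<open>k\<close>.\<close>

lemma conformal_solution_U:
  assumes pos: "\<And>x. x \<in> chemi e \<Longrightarrow> 0 < u x"
    and f_cont: "continuous_on {0..} f"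
    and dec: "\<And>s t. 0 < s \<Longrightarrow> s < t \<Longrightarrow>
        t powr (-(n+2)/(n-2)) * (f t + n*(n-2)/4 * t) < s powr (-(n+2)/(n-2)) * (f s + n*(n-2)/4 * s)"
    and noninc: "\<And>s t. 0 < s \<Longrightarrow> s \<le> t \<Longrightarrow>
        t powr (-n/(n-2)) * b t \<le> s powr (-n/(n-2)) * b s"
    and nonneg: "\<And>t. 0 < t \<Longrightarrow> t powr (-n/(n-2)) * b t \<ge> 0"
  shows "conformal_solution ax U GU AU \<gamma> (\<lambda>t. t powr (-(n+2)/(n-2)) * (f t + n*(n-2)/4 * t))
     (\<lambda>t. t powr (-n/(n-2)) * b t) ((n+2)/(n-2)) (n/(n-2))"
proof -
  have F_pos: "0 < F x" if "0 \<le> x \<bullet> ax" "x \<noteq> 0" for x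
    using pos normalize_mem[OF that] by (simp add: F_eq)
  have UF: "norm x powr \<gamma> * U x = F x" if "x \<noteq> 0" for x
  proof -
    have "norm x powr \<gamma> * norm x powr (-\<gamma>) = 1" using that by (simp add: powr_add[symmetric])
    then show ?thesis by (simp add: U_def mult.assoc[symmetric])
  qed
  have U_powr: "F x powr (- c) * U x powr c = norm x powr (- (\<gamma> * c))" if "0 \<le> x \<bullet> ax" "x \<noteq> 0" for x c
  proof -
    have "U x powr c = norm x powr (- (\<gamma> * c)) * F x powr c"
      using F_pos[OF that] by (simp add: U_def powr_mult powr_powr)
    moreover have "F x powr (- c) * F x powr c = 1" using F_pos[OF that] by (simp add: powr_add[symmetric])
    ultimately show ?thesis by simp
  qed
  have n0: "n - 2 > 0" using n_ge by simp
  show ?thesis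
  proof (intro conformal_solution.intro U.homogeneous_halfspace_axioms conformal_solution_axioms.intro)
    show "norm ax = 1" by simp
    show "4 \<le> DIM(real^'m)" using dim by simp
    show "2 * \<gamma> = real DIM(real^'m) - 3" by (rule \<gamma>_dim)
    show "1 \<le> (n+2)/(n-2)" "1 \<le> n/(n-2)" using n0 by simp_all
    show "continuous_on {x. 0 \<le> x \<bullet> ax \<and> x \<noteq> 0} U" by (rule U_cont)
    show "0 < U x" if "0 \<le> x \<bullet> ax" "x \<noteq> 0" for x
      using F_pos[OF that] that by (simp add: U_def)
    show "U (c *\<^sub>R x) = c powr - \<gamma> * U x" if "x \<noteq> 0" "0 < c" for x c
      using U_hom_all[OF that(2,1)] .
    show "(\<Sum>i\<in>Basis. AU x i \<bullet> i) = - ((norm x powr \<gamma> * U x) powr (-(n+2)/(n-2)) *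
        (f (norm x powr \<gamma> * U x) + n*(n-2)/4 * (norm x powr \<gamma> * U x)) * U x powr ((n+2)/(n-2)))"
      if x: "0 < x \<bullet> ax" for x
    proof -
      have x0: "x \<noteq> 0" using x by auto
      have "F x powr (- ((n+2)/(n-2))) * U x powr ((n+2)/(n-2)) = norm x powr (- \<gamma> - 2)"
      proof -
        have "- (\<gamma> * ((n+2)/(n-2))) = - \<gamma> - 2" using n0 by (simp add: \<gamma> field_simps)
        then show ?thesis using U_powr[of x "(n+2)/(n-2)"] x x0 by simp
      qed
      then have "(F x powr (-(n+2)/(n-2)) * w) * U x powr ((n+2)/(n-2)) = norm x powr (- \<gamma> - 2) * w" for w
        unfolding minus_divide_left by (metis mult.assoc mult.commute)
      then show ?thesis unfolding trace_AU[OF x] UF[OF x0] by metis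
    qed
    show "((\<lambda>s. U (z + s *\<^sub>R ax)) has_real_derivative
      - ((norm z powr \<gamma> * U z) powr (-n/(n-2)) * b (norm z powr \<gamma> * U z) * U z powr (n/(n-2)))) (at_right 0)"
      if z: "z \<bullet> ax = 0" "z \<noteq> 0" for z
    proof -
      have "F z powr (- (n/(n-2))) * U z powr (n/(n-2)) = norm z powr (- \<gamma> - 1)"
      proof -
        have "- (\<gamma> * (n/(n-2))) = - \<gamma> - 1" using n0 by (simp add: \<gamma> field_simps)
        then show ?thesis using U_powr[of z "n/(n-2)"] z by simp
      qed
      then have "(F z powr (-n/(n-2)) * w) * U z powr (n/(n-2)) = norm z powr (- \<gamma> - 1) * w" for w
        unfolding minus_divide_left by (metis mult.assoc mult.commute)
      then show ?thesis using U_bdry[OF z] unfolding UF[OF z(2)] by metis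
    qed
    show "continuous_on {0<..} (\<lambda>t. t powr (-(n+2)/(n-2)) * (f t + n*(n-2)/4 * t))"
      by (intro continuous_intros continuous_on_subset[OF f_cont]) auto
  qed (use dec noninc nonneg in auto)
qed

lemma u_axially_symmetric:
  assumes "conformal_solution ax U GU AU \<gamma> h k P Q"
    and "x \<in> chemi e" "y \<in> chemi e" "x $ e = y $ e"
  shows "u x = u y"
proof -
  interpret C: conformal_solution ax U GU AU \<gamma> h k P Q by fact
  show ?thesis using C.axially_symmetric[of x y] assms(2-4)
    by (simp add: chemi_def inner_ax U_sphere)
qed

text \<open>If \<open>U\<close> is positive inside, Hopf's lemma at an equatorial zero would give
  \<open>- b 0 > 0\<close>. If it vanishes inside, continuity along vertical lines gives the
  equator.\<close>

lemma nonneg_vanishes_or_positive: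
  assumes nonneg: "\<And>x. x \<in> chemi e \<Longrightarrow> 0 \<le> u x"
    and f_nonneg: "\<And>t. 0 \<le> t \<Longrightarrow> 0 \<le> f t + n * (n - 2) / 4 * t"
    and b0: "0 \<le> b 0"
  shows "(\<forall>x\<in>chemi e. u x = 0) \<or> (\<forall>x\<in>chemi e. 0 < u x)"
proof -
  have F_nonneg: "0 \<le> F x" if "0 \<le> x \<bullet> ax" "x \<noteq> 0" for x
    using nonneg normalize_mem[OF that] by (simp add: F_eq)
  have super: "superharmonic_on {x. 0 < x \<bullet> ax} U"
    unfolding superharmonic_on_def
  proof
    fix x assume "x \<in> {x. 0 < x \<bullet> ax}"
    then have x: "0 < x \<bullet> ax" by simp
    then have x0: "x \<noteq> 0" by auto
    have "0 \<le> norm x powr (-\<gamma> - 2) * (f (F x) + n * (n - 2) / 4 * F x)"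
      using f_nonneg[OF F_nonneg[of x]] x x0 by (intro mult_nonneg_nonneg) auto
    then show "\<exists>g L. lap_at U x g L \<and> L \<le> 0" using U_lap0[OF x] by (meson neg_le_0_iff_le)
  qed
  have U_nonneg: "0 \<le> U x" if "0 < x \<bullet> ax" for x
  proof -
    have "x \<noteq> 0" using that by auto
    then show ?thesis using F_nonneg[of x] that by (simp add: U_def)
  qed
  from strong_minimum_principle_halfspace[OF ax(1) super U_nonneg]
  show ?thesis
  proof
    assume zero: "\<forall>x. 0 < x \<bullet> ax \<longrightarrow> U x = 0"
    have "u x = 0" if x: "x \<in> chemi e" for x
    proof -
      have xn: "norm x = 1" "0 \<le> x \<bullet> ax" "x \<noteq> 0" using x by (auto simp: chemi_def inner_ax)
      have "((\<lambda>s. U (x + s *\<^sub>R ax)) \<longlongrightarrow> U (x + 0 *\<^sub>R ax)) (at 0 within {0..1})"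
      proof -
        have sub: "(\<lambda>s. x + s *\<^sub>R ax) ` {0..1} \<subseteq> {x. 0 \<le> x \<bullet> ax \<and> x \<noteq> 0}"
        proof safe
          fix s :: real assume s: "s \<in> {0..1}"
          have eq: "(x + s *\<^sub>R ax) \<bullet> ax = x \<bullet> ax + s" using ax(2) by (simp add: inner_add_left)
          then show "0 \<le> (x + s *\<^sub>R ax) \<bullet> ax" using s xn by simp
          assume z: "x + s *\<^sub>R ax = 0"
          then have "x \<bullet> ax + s = 0" using eq by simp
          then have "s = 0" using s xn(2) by auto
          then show False using z xn by simp
        qed
        have "continuous_on {0..1} (\<lambda>s. U (x + s *\<^sub>R ax))"
          by (rule continuous_on_compose2[OF U_cont _ sub]) (intro continuous_intros)
        then show ?thesis unfolding continuous_on_def by (rule bspec) simp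
      qed
      then have lim: "((\<lambda>s. U (x + s *\<^sub>R ax)) \<longlongrightarrow> U x) (at_right 0)" by (simp add: at_within_Icc_at_right)
      have "\<forall>\<^sub>F s in at_right 0. s \<in> {0::real<..<1}" by (rule eventually_at_right_real) simp
      then have "\<forall>\<^sub>F s in at_right 0. U (x + s *\<^sub>R ax) = 0"
      proof eventually_elim
        case (elim s)
        have "0 < (x + s *\<^sub>R ax) \<bullet> ax" using elim xn(2) ax(2) by (simp add: inner_add_left)
        then show ?case using zero by blast
      qed
      then have "((\<lambda>s. U (x + s *\<^sub>R ax)) \<longlongrightarrow> 0) (at_right 0)" by (rule tendsto_eventually)
      with lim have "U x = 0" by (rule tendsto_unique[rotated]) simp
      then show ?thesis using U_sphere[OF xn(1)] by simp
    qed
    then show ?thesis by blast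
  next
    assume U_pos: "\<forall>x. 0 < x \<bullet> ax \<longrightarrow> 0 < U x"
    have "0 < u x" if x: "x \<in> chemi e" for x
    proof (rule ccontr)
      assume "\<not> 0 < u x"
      then have ux: "u x = 0" using nonneg[OF x] by simp
      have xn: "norm x = 1" "0 \<le> x \<bullet> ax" "x \<noteq> 0" using x by (auto simp: chemi_def inner_ax)
      have "\<not> 0 < x \<bullet> ax" using U_pos ux U_sphere[OF xn(1)] by auto
      then have xe: "x \<bullet> ax = 0" using xn by simp
      have "- (norm x powr (-\<gamma> - 1) * b (F x)) > 0"
      proof (rule hopf_boundary_derivative[OF ax(1) zero_less_one, rotated -1])
        show "((\<lambda>s. U (x + s *\<^sub>R ax)) has_real_derivative - (norm x powr (-\<gamma> - 1) * b (F x))) (at_right 0)"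
          by (rule U_bdry[OF xe xn(3)])
        show "continuous_on (cball (x + 1 *\<^sub>R ax) 1) U"
          by (rule continuous_on_subset[OF U_cont])
             (use tangent_ball(2,3)[OF ax(1) xe zero_less_one] xn in blast)
        show "superharmonic_on (ball (x + 1 *\<^sub>R ax) 1) U"
          by (rule superharmonic_on_subset[OF super])
             (use tangent_ball(1)[OF ax(1) xe zero_less_one] in blast)
        show "0 < U y" if "y \<in> ball (x + 1 *\<^sub>R ax) 1" for y
          using U_pos tangent_ball(1)[OF ax(1) xe zero_less_one that] by blast
        show "U x = 0" using ux U_sphere[OF xn(1)] by simp
      qed
      then show False using ux F_sphere[OF xn(1)] b0 xn by simp
    qed
    then show ?thesis by blast
  qed
qed

text \<open>The function \<open>(norm x + x \<bullet> ax) powr (-\<gamma>)\<close> is the constant function on the Euclidean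
  ball, transplanted by stereographic projection.\<close>

lemma no_positive_solution:
  assumes pos: "\<And>x. x \<in> chemi e \<Longrightarrow> 0 < u x"
    and f_nonneg: "\<And>t. 0 \<le> t \<Longrightarrow> 0 \<le> f t + n * (n - 2) / 4 * t"
    and dec: "\<And>s t. 0 < s \<Longrightarrow> s < t \<Longrightarrow>
        t powr (-(n+2)/(n-2)) * (f t + n*(n-2)/4 * t) < s powr (-(n+2)/(n-2)) * (f s + n*(n-2)/4 * s)"
    and b_ge: "\<And>t. 0 < t \<Longrightarrow> (n - 2) / 2 * t \<le> b t"
  shows False
proof -
  let ?C = "{x. 0 \<le> x \<bullet> ax \<and> x \<noteq> 0}"
  define \<Psi> where "\<Psi> = (\<lambda>x. (norm x + x \<bullet> ax) powr (-\<gamma>))"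
  have q_pos: "0 < norm x + x \<bullet> ax" if "x \<in> ?C" for x using that by (auto simp: add_pos_nonneg)
  have \<Psi>_pos: "0 < \<Psi> x" if "x \<in> ?C" for x using q_pos[OF that] by (simp add: \<Psi>_def)
  have \<Psi>_cont: "continuous_on ?C \<Psi>"
    unfolding \<Psi>_def by (intro continuous_intros) (use q_pos in force)
  have \<Psi>_hom: "\<Psi> (c *\<^sub>R x) = c powr (-\<gamma>) * \<Psi> x" if "x \<in> ?C" "c > 0" for x c
  proof -
    have "norm (c *\<^sub>R x) + (c *\<^sub>R x) \<bullet> ax = c * (norm x + x \<bullet> ax)" using that by (simp add: distrib_left)
    then show ?thesis using that q_pos[OF that(1)] by (simp add: \<Psi>_def powr_mult)
  qed
  have chemi_sub: "chemi e \<subseteq> ?C" by (auto simp: chemi_def inner_ax)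
  have "closed {x::real^'m. 0 \<le> x $ e}" by (intro closed_Collect_le continuous_intros)
  moreover have "chemi e = sphere 0 1 \<inter> {x. 0 \<le> x $ e}" by (auto simp: chemi_def)
  ultimately have compact: "compact (chemi e)" by (simp add: compact_Int_closed)
  have ax_mem: "ax \<in> chemi e" by (simp add: chemi_def)
  \<comment> \<open>The minimum \<open>m\<close> of the quotient is the largest multiple of the
    harmonic comparison function that stays below \<open>U\<close>, so the difference touches
    0.\<close>
  have "\<exists>y\<in>chemi e. \<forall>x\<in>chemi e. U y / \<Psi> y \<le> U x / \<Psi> x"
  proof (rule continuous_attains_inf[OF compact])
    show "chemi e \<noteq> {}" using ax_mem by blast
    show "continuous_on (chemi e) (\<lambda>x. U x / \<Psi> x)"
      by (intro continuous_on_divide continuous_on_subset[OF U_cont chemi_sub]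
           continuous_on_subset[OF \<Psi>_cont chemi_sub]) (use \<Psi>_pos chemi_sub in force)
  qed
  then obtain y where y: "y \<in> chemi e" "\<And>x. x \<in> chemi e \<Longrightarrow> U y / \<Psi> y \<le> U x / \<Psi> x" by blast
  define m where "m = U y / \<Psi> y"
  have yn: "norm y = 1" "0 \<le> y \<bullet> ax" "y \<noteq> 0" using y(1) by (auto simp: chemi_def inner_ax)
  have m: "m > 0" unfolding m_def using pos[OF y(1)] \<Psi>_pos[of y] U_sphere[OF yn(1)] yn by simp
  define W where "W = (\<lambda>x. U x - m * \<Psi> x)"
  have Wy: "W y = 0" using \<Psi>_pos[of y] yn by (simp add: W_def m_def)
  have W_nonneg: "0 \<le> W x" if x: "x \<in> ?C" for x
  proof -
    define w where "w = x /\<^sub>R norm x"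
    have w: "w \<in> chemi e" unfolding w_def using normalize_mem x by auto
    have nx: "0 < norm x" using x by auto
    have xw: "x = norm x *\<^sub>R w" using nx by (simp add: w_def)
    have "m * \<Psi> w \<le> U w" using y(2)[OF w] \<Psi>_pos[of w] w chemi_sub unfolding m_def[symmetric]
      by (simp add: pos_le_divide_eq subset_iff)
    then have "norm x powr (-\<gamma>) * (m * \<Psi> w) \<le> norm x powr (-\<gamma>) * U w" by (intro mult_left_mono) auto
    moreover have "U x = norm x powr (-\<gamma>) * U w" using U_hom_all[OF nx, of w] xw w chemi_sub by auto
    moreover have "\<Psi> x = norm x powr (-\<gamma>) * \<Psi> w" using \<Psi>_hom[OF _ nx, of w] xw w chemi_sub by auto
    ultimately show ?thesis by (simp add: W_def mult.left_commute)
  qed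
  have \<Psi>_lap: "lap_at \<Psi> x ((- \<gamma> * (norm x + x \<bullet> ax) powr (-\<gamma> - 1)) *\<^sub>R ((1 / norm x) *\<^sub>R x + ax)) 0"
    if "x \<in> ?C" for x
    unfolding \<Psi>_def by (rule lap_at_conformal_factor[OF ax(1) \<gamma>_dim q_pos[OF that]])
  have F_pos: "0 < F x" if "x \<in> ?C" for x
    using pos normalize_mem[of x] that by (simp add: F_eq)
  have super: "superharmonic_on {x. 0 < x \<bullet> ax} W"
    unfolding superharmonic_on_def
  proof
    fix x assume "x \<in> {x. 0 < x \<bullet> ax}"
    then have x: "0 < x \<bullet> ax" by simp
    then have xC: "x \<in> ?C" by auto
    have "0 \<le> norm x powr (-\<gamma> - 2) * (f (F x) + n * (n - 2) / 4 * F x)"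
      using f_nonneg[OF less_imp_le[OF F_pos[OF xC]]] by (intro mult_nonneg_nonneg) auto
    then show "\<exists>g L. lap_at W x g L \<and> L \<le> 0"
      using lap_at_diff[OF U_lap0[OF x] lap_at_cmult[OF \<Psi>_lap[OF xC], of m]]
      unfolding W_def[symmetric] by (intro exI conjI) auto
  qed
  have W_nonneg': "0 \<le> W x" if "0 < x \<bullet> ax" for x using W_nonneg[of x] that by fastforce
  from strong_minimum_principle_halfspace[OF ax(1) super W_nonneg']
  show False
  proof
    assume zero: "\<forall>x. 0 < x \<bullet> ax \<longrightarrow> W x = 0"
    have f0: "f (F x) + n * (n - 2) / 4 * F x = 0" if x: "0 < x \<bullet> ax" for x
    proof -
      have xC: "x \<in> ?C" using x by auto
      have "\<forall>\<^sub>F y in nhds x. U y = m * \<Psi> y"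
        using F.ev_H[OF x] by eventually_elim (use zero in \<open>auto simp: W_def\<close>)
      from lap_at_unique[OF U_lap0[OF x] lap_at_cong[OF lap_at_cmult[OF \<Psi>_lap[OF xC], of m] this]]
      have "norm x powr (-\<gamma> - 2) * (f (F x) + n * (n - 2) / 4 * F x) = 0" by simp
      then show ?thesis using xC by auto
    qed
    obtain i where i: "i \<noteq> e" using ex_other_index[OF dim] by blast
    \<comment> \<open>If \<open>U\<close> equals \<open>m * \<Psi>\<close>, it is harmonic and
      \<open>f t + n * (n - 2) / 4 * t\<close> vanishes at every value attained. Latitude \<pi>/6
      and the pole supply two different values, contradicting strict decrease.\<close>
    define v where "v = cos (pi/6) *\<^sub>R axis i 1 + sin (pi/6) *\<^sub>R ax"
    have ia: "axis i 1 \<bullet> ax = 0" using i by (simp add: inner_axis_axis)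
    have va: "v \<bullet> ax = 1/2" by (simp add: v_def inner_add_left ia sin_30)
    have "v \<bullet> v = (cos (pi/6))\<^sup>2 + (sin (pi/6))\<^sup>2"
      using i by (simp add: v_def inner_add_left inner_add_right inner_axis_axis power2_eq_square)
    then have nv: "norm v = 1" by (simp add: norm_eq_1)
    have Fv: "F v = m * (3/2) powr (-\<gamma>)"
      using zero[rule_format, of v] va nv by (simp add: W_def \<Psi>_def U_sphere F_sphere)
    have Fa: "F ax = m * 2 powr (-\<gamma>)"
      using zero[rule_format, of ax] ax by (simp add: W_def \<Psi>_def U_sphere F_sphere)
    have "2 powr (-\<gamma>) < (3/2) powr (-\<gamma>)" using \<gamma>_pos by (intro powr_less_mono2_neg) auto
    then have "F ax < F v" using Fv Fa m by simp
    moreover have "0 < F ax" using F_pos[of ax] by (simp add: inner_ax)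
    ultimately show False using dec[of "F ax" "F v"] f0[of v] f0[of ax] va ax(2) by simp
  next
    assume W_pos: "\<forall>x. 0 < x \<bullet> ax \<longrightarrow> 0 < W x"
    have "\<not> 0 < y \<bullet> ax" using W_pos Wy by auto
    then have ye: "y \<bullet> ax = 0" using yn by simp
    have yC: "y \<in> ?C" using yn by auto
    have \<Psi>y: "\<Psi> y = 1" using yn ye by (simp add: \<Psi>_def)
    have d\<Psi>: "((\<lambda>s. \<Psi> (y + s *\<^sub>R ax)) has_real_derivative - \<gamma>) (at_right 0)"
      using lap_at_line_derivative[OF \<Psi>_lap[OF yC], of ax "{0<..}"] yn ye ax(2)
      by (simp add: inner_add_left)
    have dU: "((\<lambda>s. U (y + s *\<^sub>R ax)) has_real_derivative - b (u y)) (at_right 0)"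
      using U_bdry[OF ye yn(3)] yn F_sphere[OF yn(1)] by simp
    \<comment> \<open>On the equator the comparison function is 1 with slope -\<gamma>, so
      \<open>m = u y\<close> and Hopf's lemma yields
      \<open>b (u y) < (n - 2) / 2 * u y\<close>.\<close>
    have "- b (u y) - m * (- \<gamma>) > 0"
    proof (rule hopf_boundary_derivative[OF ax(1) zero_less_one, rotated -1])
      show "((\<lambda>s. W (y + s *\<^sub>R ax)) has_real_derivative - b (u y) - m * (- \<gamma>)) (at_right 0)"
        unfolding W_def by (intro DERIV_diff DERIV_cmult dU d\<Psi>)
      have sub: "cball (y + 1 *\<^sub>R ax) 1 \<subseteq> ?C"
        using tangent_ball(2,3)[OF ax(1) ye zero_less_one] yn by blast
      show "continuous_on (cball (y + 1 *\<^sub>R ax) 1) W" unfolding W_def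
        by (intro continuous_intros continuous_on_subset[OF U_cont sub] continuous_on_subset[OF \<Psi>_cont sub])
      show "superharmonic_on (ball (y + 1 *\<^sub>R ax) 1) W"
        by (rule superharmonic_on_subset[OF super])
           (use tangent_ball(1)[OF ax(1) ye zero_less_one] in blast)
      show "0 < W x" if "x \<in> ball (y + 1 *\<^sub>R ax) 1" for x
        using W_pos tangent_ball(1)[OF ax(1) ye zero_less_one that] by blast
      show "W y = 0" by (rule Wy)
    qed
    moreover have "m = u y" using \<Psi>y U_sphere[OF yn(1)] by (simp add: m_def)
    ultimately show False using b_ge[OF pos[OF y(1)]] by (simp add: \<gamma> mult.commute)
  qed
qed

end

section \<open>Reduction to the latitude profile\<close>

context sphere_solution begin

lemma F_axially_symmetric:
  assumes sym: "\<And>x y. x \<in> chemi e \<Longrightarrow> y \<in> chemi e \<Longrightarrow> x $ e = y $ e \<Longrightarrow> u x = u y"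
    and x: "0 < x \<bullet> ax" and eq: "x \<bullet> ax = y \<bullet> ax" "norm x = norm y"
  shows "F x = F y"
proof -
  have "x \<noteq> 0" "y \<noteq> 0" using x eq by auto
  then show ?thesis unfolding F_eq using x eq
    by (intro sym normalize_mem) (auto simp: inner_ax)
qed

text \<open>Invariance under the rotations in the plane of two equatorial axes, differentiated once.\<close>

lemma gradient_rotation:
  assumes sym: "\<And>x y. x \<in> chemi e \<Longrightarrow> y \<in> chemi e \<Longrightarrow> x $ e = y $ e \<Longrightarrow> u x = u y"
    and y: "0 < y \<bullet> ax" and ij: "i \<noteq> e" "j \<noteq> e" "i \<noteq> j"
  shows "(y \<bullet> axis j 1) * (GF y \<bullet> axis i 1) = (y \<bullet> axis i 1) * (GF y \<bullet> axis j 1)"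
proof -
  define v w :: "real^'m" where "v = axis i 1" and "w = axis j 1"
  have vw: "v \<bullet> v = 1" "w \<bullet> w = 1" "v \<bullet> w = 0" "w \<bullet> v = 0" "v \<bullet> ax = 0" "w \<bullet> ax = 0"
    using ij by (auto simp: v_def w_def inner_axis_axis)
  \<comment> \<open>\<open>c \<tau>\<close> below is \<open>y\<close> rotated by \<tau> in the plane
    of \<open>v\<close> and \<open>w\<close>, written as a correction to \<open>y\<close> so that
    the other coordinates need not be expanded.\<close>
  define p q where "p = y \<bullet> v" and "q = y \<bullet> w"
  define \<alpha> \<beta> where "\<alpha> = (\<lambda>\<tau>. (cos \<tau> - 1) * p - sin \<tau> * q)" and "\<beta> = (\<lambda>\<tau>. sin \<tau> * p + (cos \<tau> - 1) * q)"
  define c where "c = (\<lambda>\<tau>. y + \<alpha> \<tau> *\<^sub>R v + \<beta> \<tau> *\<^sub>R w)"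
  have "F (c \<tau>) = F y" for \<tau>
  proof (rule F_axially_symmetric[OF sym, symmetric])
    show "0 < y \<bullet> ax" by (rule y)
    show "y \<bullet> ax = c \<tau> \<bullet> ax" by (simp add: c_def inner_add_left vw)
    have "c \<tau> \<bullet> c \<tau> = y \<bullet> y + 2 * (\<alpha> \<tau> * p + \<beta> \<tau> * q) + (\<alpha> \<tau>)\<^sup>2 + (\<beta> \<tau>)\<^sup>2"
      by (simp add: c_def inner_add_left inner_add_right vw inner_commute[of v y] inner_commute[of w y]
          p_def q_def power2_eq_square algebra_simps)
    moreover have "2 * (\<alpha> \<tau> * p + \<beta> \<tau> * q) + (\<alpha> \<tau>)\<^sup>2 + (\<beta> \<tau>)\<^sup>2
        = ((cos \<tau>)\<^sup>2 + (sin \<tau>)\<^sup>2 - 1) * (p\<^sup>2 + q\<^sup>2)"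
    proof -
      have "2 * (((k - 1) * p - s * q) * p + (s * p + (k - 1) * q) * q)
          + ((k - 1) * p - s * q)\<^sup>2 + (s * p + (k - 1) * q)\<^sup>2 = (k\<^sup>2 + s\<^sup>2 - 1) * (p\<^sup>2 + q\<^sup>2)" for k s
        by (simp add: algebra_simps power2_eq_square)
      then show ?thesis unfolding \<alpha>_def \<beta>_def .
    qed
    ultimately show "norm y = norm (c \<tau>)" by (simp add: norm_eq_sqrt_inner)
  qed
  then have "((\<lambda>\<tau>. F (c \<tau>)) has_derivative (\<lambda>_. 0)) (at 0)" by simp
  moreover have "((\<lambda>\<tau>. F (c \<tau>)) has_derivative (\<lambda>h. GF y \<bullet> ((- h * q) *\<^sub>R v + (h * p) *\<^sub>R w))) (at 0)"
  proof -
    have 1: "(c has_derivative (\<lambda>h. (- h * q) *\<^sub>R v + (h * p) *\<^sub>R w)) (at 0)"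
      unfolding c_def \<alpha>_def \<beta>_def by (auto intro!: derivative_eq_intros)
    have "c 0 = y" by (simp add: c_def \<alpha>_def \<beta>_def)
    then have 2: "(F has_derivative (\<lambda>h. GF y \<bullet> h)) (at (c 0))" using F.grad[OF y] by simp
    show ?thesis by (rule has_derivative_compose[OF 1 2])
  qed
  ultimately have "(\<lambda>h. GF y \<bullet> ((- h * q) *\<^sub>R v + (h * p) *\<^sub>R w)) = (\<lambda>_. 0)"
    by (rule has_derivative_unique[symmetric])
  then have "GF y \<bullet> ((- 1 * q) *\<^sub>R v + (1 * p) *\<^sub>R w) = 0" by metis
  then show ?thesis by (simp add: inner_add_right inner_diff_right p_def q_def v_def w_def)
qed

text \<open>Differentiating the gradient identity in the direction of axis \<open>j\<close>, at a
  point where that coordinate vanishes, isolates one diagonal Hessian entry. These entries are the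
  curvature terms of the parallels in the spherical Laplacian.\<close>

lemma hessian_rotation:
  assumes sym: "\<And>x y. x \<in> chemi e \<Longrightarrow> y \<in> chemi e \<Longrightarrow> x $ e = y $ e \<Longrightarrow> u x = u y"
    and x: "0 < x \<bullet> ax" "x \<bullet> axis j 1 = 0" and ij: "i \<noteq> e" "j \<noteq> e" "i \<noteq> j"
  shows "(x \<bullet> axis i 1) * (AF x (axis j 1) \<bullet> axis j 1) = GF x \<bullet> axis i 1"
proof -
  define v w :: "real^'m" where "v = axis i 1" and "w = axis j 1"
  have vw: "w \<bullet> w = 1" "w \<bullet> v = 0" using ij by (auto simp: v_def w_def inner_axis_axis)
  note d = F.hess[OF x(1)]
  have rot: "(y \<bullet> w) * (GF y \<bullet> v) = (y \<bullet> v) * (GF y \<bullet> w)" if "0 < y \<bullet> ax" for y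
    unfolding v_def w_def by (rule gradient_rotation[OF sym that ij])
  have "((\<lambda>y. (y \<bullet> w) * (GF y \<bullet> v)) has_derivative
      (\<lambda>h. (x \<bullet> w) * (AF x h \<bullet> v) + (h \<bullet> w) * (GF x \<bullet> v))) (at x)"
    using d by (auto intro!: derivative_eq_intros)
  moreover have "\<forall>\<^sub>F y in at x. (y \<bullet> w) * (GF y \<bullet> v) = (y \<bullet> v) * (GF y \<bullet> w)"
    unfolding eventually_at_filter
    using F.ev_H[OF x(1)] by eventually_elim (simp add: rot)
  ultimately have "((\<lambda>y. (y \<bullet> v) * (GF y \<bullet> w)) has_derivative
      (\<lambda>h. (x \<bullet> w) * (AF x h \<bullet> v) + (h \<bullet> w) * (GF x \<bullet> v))) (at x)"
    by (rule has_derivative_transform_eventually) (use rot[OF x(1)] in auto)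
  moreover have "((\<lambda>y. (y \<bullet> v) * (GF y \<bullet> w)) has_derivative
      (\<lambda>h. (x \<bullet> v) * (AF x h \<bullet> w) + (h \<bullet> v) * (GF x \<bullet> w))) (at x)"
    using d by (auto intro!: derivative_eq_intros)
  ultimately have "(\<lambda>h. (x \<bullet> w) * (AF x h \<bullet> v) + (h \<bullet> w) * (GF x \<bullet> v))
      = (\<lambda>h. (x \<bullet> v) * (AF x h \<bullet> w) + (h \<bullet> v) * (GF x \<bullet> w))"
    by (rule has_derivative_unique)
  from fun_cong[OF this, of w] show ?thesis
    using x(2) vw by (simp add: v_def w_def)
qed

text \<open>The trace of the Hessian along one meridian splits: the plane of the meridian
  contributes the second derivative of the profile, and each of the n - 1 remaining axes contributes
  -tan \<theta> times the first.\<close>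

lemma neumann_zero_constant:
  assumes sym: "\<And>x y. x \<in> chemi e \<Longrightarrow> y \<in> chemi e \<Longrightarrow> x $ e = y $ e \<Longrightarrow> u x = u y"
    and pos: "\<And>x. x \<in> chemi e \<Longrightarrow> 0 < u x"
    and f_cont: "continuous_on {0..} f"
    and dec: "\<And>s t. 0 < s \<Longrightarrow> s < t \<Longrightarrow>
        t powr (-(n+2)/(n-2)) * (f t + n*(n-2)/4 * t) < s powr (-(n+2)/(n-2)) * (f s + n*(n-2)/4 * s)"
    and z0: "z0 \<in> equator e" "b (u z0) = 0" and x: "x \<in> hemi e"
  shows "u x = u ax"
proof -
  obtain i where i: "i \<noteq> e" using ex_other_index[OF dim] by blast
  define z :: "real^'m" where "z = axis i 1"
  have zz: "z \<bullet> z = 1" "z \<bullet> ax = 0" "ax \<bullet> z = 0" using i by (auto simp: z_def inner_axis_axis)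
  have "z $ e = 0" using i by (simp add: z_def axis_def)
  then have ze: "z \<in> equator e" using zz by (simp add: equator_def norm_eq_1)
  define c c' where "c = (\<lambda>\<theta>. cos \<theta> *\<^sub>R z + sin \<theta> *\<^sub>R ax)" and "c' = (\<lambda>\<theta>. (- sin \<theta>) *\<^sub>R z + cos \<theta> *\<^sub>R ax)"
  have cn: "norm (c \<theta>) = 1" for \<theta>
    using sin_cos_squared_add[of \<theta>]
    by (simp add: c_def norm_eq_1 inner_add_left inner_add_right zz ax(2) power2_eq_square)
  have ca: "c \<theta> \<bullet> ax = sin \<theta>" for \<theta> by (simp add: c_def inner_add_left zz ax(2))
  have ce: "c \<theta> $ e = sin \<theta>" for \<theta> using ca[of \<theta>] by (simp add: inner_ax)
  have cz: "c \<theta> \<bullet> z = cos \<theta>" for \<theta> by (simp add: c_def inner_add_left zz)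
  have dc: "(c has_vector_derivative c' \<theta>) (at \<theta>)" for \<theta>
    unfolding c_def c'_def by (auto intro!: derivative_eq_intros)
  have dc': "(c' has_vector_derivative - c \<theta>) (at \<theta>)" for \<theta>
    unfolding c_def c'_def by (auto intro!: derivative_eq_intros)
  define \<phi> \<phi>' \<phi>'' where "\<phi> = (\<lambda>\<theta>. F (c \<theta>))" and "\<phi>' = (\<lambda>\<theta>. GF (c \<theta>) \<bullet> c' \<theta>)"
    and "\<phi>'' = (\<lambda>\<theta>. AF (c \<theta>) (c' \<theta>) \<bullet> c' \<theta>)"
  have \<phi>u: "\<phi> \<theta> = u (c \<theta>)" for \<theta> by (simp add: \<phi>_def F_sphere[OF cn])
  have c_chemi: "c \<theta> \<in> chemi e" if "0 \<le> \<theta>" "\<theta> \<le> pi/2" for \<theta>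
  proof -
    have "0 \<le> sin \<theta>" using that pi_gt_zero by (intro sin_ge_zero) linarith+
    then show ?thesis using cn ce by (simp add: chemi_def)
  qed
  have sin_pos: "0 < sin \<theta>" if "0 < \<theta>" "\<theta> \<le> pi/2" for \<theta>
    using that pi_gt_zero by (intro sin_gt_zero) linarith+
  interpret R: radial_profile "CARD('m) - 3" n \<gamma> f \<phi> \<phi>' \<phi>''
  proof
    show "1 \<le> CARD('m) - 3" using dim by simp
    show "n = real (CARD('m) - 3) + 2" "\<gamma> = real (CARD('m) - 3) / 2" using dim by (simp_all add: n \<gamma>)
    show "continuous_on {0..pi/2} \<phi>"
      unfolding \<phi>_def
    proof (rule continuous_on_compose2[OF F_cont])
      show "continuous_on {0..pi/2} c" unfolding c_def by (intro continuous_intros)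
      show "c ` {0..pi/2} \<subseteq> {x. 0 \<le> x \<bullet> ax \<and> x \<noteq> 0}"
        using c_chemi by (force simp: chemi_def inner_ax)
    qed
    show "0 < \<phi> \<theta>" if "0 \<le> \<theta>" "\<theta> \<le> pi/2" for \<theta> unfolding \<phi>u by (rule pos[OF c_chemi[OF that]])
    show "(\<phi> has_real_derivative \<phi>' \<theta>) (at \<theta>)" if \<theta>: "0 < \<theta>" "\<theta> \<le> pi/2" for \<theta>
    proof -
      have H: "0 < c \<theta> \<bullet> ax" using sin_pos[OF \<theta>] ca by simp
      have "(\<phi> has_derivative (\<lambda>h. GF (c \<theta>) \<bullet> (h *\<^sub>R c' \<theta>))) (at \<theta>)"
        unfolding \<phi>_def by (rule has_derivative_compose[OF dc[unfolded has_vector_derivative_def] F.grad[OF H]])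
      then show ?thesis unfolding \<phi>'_def by (rule has_derivative_imp_has_field_derivative) simp
    qed
    show "(\<phi>' has_real_derivative \<phi>'' \<theta>) (at \<theta>)" if \<theta>: "0 < \<theta>" "\<theta> \<le> pi/2" for \<theta>
    proof -
      have H: "0 < c \<theta> \<bullet> ax" using sin_pos[OF \<theta>] ca by simp
      have dG: "((\<lambda>\<theta>. GF (c \<theta>)) has_derivative (\<lambda>h. AF (c \<theta>) (h *\<^sub>R c' \<theta>))) (at \<theta>)"
        by (rule has_derivative_compose[OF dc[unfolded has_vector_derivative_def] F.hess[OF H]])
      have "(\<phi>' has_derivative (\<lambda>h. GF (c \<theta>) \<bullet> (h *\<^sub>R - c \<theta>) + AF (c \<theta>) (h *\<^sub>R c' \<theta>) \<bullet> c' \<theta>)) (at \<theta>)"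
        unfolding \<phi>'_def by (rule has_derivative_inner[OF dG dc'[unfolded has_vector_derivative_def]])
      moreover have "GF (c \<theta>) \<bullet> c \<theta> = 0" using F.euler[OF H] by simp
      moreover have "AF (c \<theta>) (h *\<^sub>R c' \<theta>) = h *\<^sub>R AF (c \<theta>) (c' \<theta>)" for h
        by (rule linear_cmul[OF F.hess_linear[OF H]])
      ultimately show ?thesis unfolding \<phi>''_def
        by (intro has_derivative_imp_has_field_derivative) auto
    qed
    show "cos \<theta> * \<phi>'' \<theta> = (n - 1) * sin \<theta> * \<phi>' \<theta> - cos \<theta> * f (\<phi> \<theta>)" if \<theta>: "0 < \<theta>" "\<theta> < pi/2" for \<theta>
    proof -
      define y C S where "y = c \<theta>" and "C = cos \<theta>" and "S = sin \<theta>"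
      have H: "0 < y \<bullet> ax" using sin_pos[of \<theta>] \<theta> ca by (simp add: y_def)
      have lin: "linear (AF y)" by (rule F.hess_linear[OF H])
      have y_eq: "y = C *\<^sub>R z + S *\<^sub>R ax" by (simp add: y_def c_def C_def S_def)
      have c'_eq: "c' \<theta> = (- S) *\<^sub>R z + C *\<^sub>R ax" by (simp add: c'_def C_def S_def)
      have CS: "C * C + S * S = 1" using sin_cos_squared_add[of \<theta>] by (simp add: C_def S_def power2_eq_square)
      have Gy: "C * (GF y \<bullet> z) + S * (GF y \<bullet> ax) = 0"
        using F.euler[OF H] by (simp add: y_eq inner_add_right)
      have \<phi>': "\<phi>' \<theta> = - S * (GF y \<bullet> z) + C * (GF y \<bullet> ax)"
        by (simp add: \<phi>'_def y_def[symmetric] c'_eq inner_add_right inner_diff_right)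
      \<comment> \<open>The gradient at \<open>y\<close> has no radial part, so within the meridian
        plane it is the multiple \<open>\<phi>' \<theta>\<close> of the unit tangent
        \<open>c' \<theta>\<close>.\<close>
      have Gz: "GF y \<bullet> z = - S * \<phi>' \<theta>"
      proof -
        have "- S * \<phi>' \<theta> = (C * C + S * S) * (GF y \<bullet> z) - C * (C * (GF y \<bullet> z) + S * (GF y \<bullet> ax))"
          unfolding \<phi>' by (simp add: algebra_simps)
        then show ?thesis using CS Gy by simp
      qed
      define zz' za az aa where "zz' = AF y z \<bullet> z" and "za = AF y z \<bullet> ax" and "az = AF y ax \<bullet> z" and "aa = AF y ax \<bullet> ax"
      have bilinear: "AF y (a *\<^sub>R z + d *\<^sub>R ax) \<bullet> (a *\<^sub>R z + d *\<^sub>R ax)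
          = a * a * zz' + a * d * za + d * a * az + d * d * aa" for a d
        by (simp add: linear_add[OF lin] linear_cmul[OF lin] inner_add_left inner_add_right
            zz'_def za_def az_def aa_def algebra_simps)
      \<comment> \<open>The radial second derivative of a function of degree 0 vanishes, so the
        trace over the plane of \<open>y\<close> and the tangent is the tangential entry
        \<open>\<phi>'' \<theta>\<close> alone.\<close>
      have "AF y y \<bullet> y = 0" using F.hess_inner_self[OF H, of y] F.euler[OF H] by simp
      then have yy: "C * C * zz' + C * S * za + S * C * az + S * S * aa = 0"
        using bilinear[of C S] unfolding y_eq[symmetric] by simp
      have \<phi>''e: "\<phi>'' \<theta> = S * S * zz' - S * C * za - C * S * az + C * C * aa"
        using bilinear[of "- S" C] unfolding \<phi>''_def y_def[symmetric] c'_eq by simp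
      have tr2: "zz' + aa = \<phi>'' \<theta>"
      proof -
        have "zz' + aa = (C * C + S * S) * zz' + (C * C + S * S) * aa" using CS by simp
        also have "\<dots> = (C * C * zz' + C * S * za + S * C * az + S * S * aa) + \<phi>'' \<theta>"
          unfolding \<phi>''e by (simp add: algebra_simps)
        finally show ?thesis using yy by simp
      qed
      have other: "C * (AF y (axis j 1) \<bullet> axis j 1) = - S * \<phi>' \<theta>" if j: "j \<in> - {i, e}" for j
      proof -
        have ij: "j \<noteq> e" "i \<noteq> j" using j by auto
        have yj: "y \<bullet> axis j 1 = 0" using j by (auto simp: y_eq z_def inner_add_left inner_axis_axis)
        have "(y \<bullet> axis i 1) * (AF y (axis j 1) \<bullet> axis j 1) = GF y \<bullet> axis i 1"
          by (rule hessian_rotation[OF sym H yj i ij])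
        then show ?thesis using Gz cz[of \<theta>] by (simp add: y_def z_def C_def)
      qed
      have "(\<Sum>j\<in>Basis. AF y j \<bullet> j) = (\<Sum>j\<in>UNIV. AF y (axis j 1) \<bullet> axis j 1)" by (rule sum_Basis_axis)
      also have "\<dots> = (\<Sum>j\<in>{i, e}. AF y (axis j 1) \<bullet> axis j 1) + (\<Sum>j\<in>- {i, e}. AF y (axis j 1) \<bullet> axis j 1)"
        by (subst sum.union_disjoint[symmetric]) (auto simp: Un_commute Compl_partition2)
      also have "(\<Sum>j\<in>{i, e}. AF y (axis j 1) \<bullet> axis j 1) = \<phi>'' \<theta>"
        using i tr2 by (simp add: zz'_def aa_def z_def)
      finally have "C * (\<Sum>j\<in>Basis. AF y j \<bullet> j)
          = C * \<phi>'' \<theta> + (\<Sum>j\<in>- {i, e}. C * (AF y (axis j 1) \<bullet> axis j 1))"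
        by (simp add: distrib_left sum_distrib_left)
      also have "(\<Sum>j\<in>- {i, e}. C * (AF y (axis j 1) \<bullet> axis j 1)) = (\<Sum>j\<in>- {i, e}. - S * \<phi>' \<theta>)"
        using other by (intro sum.cong) auto
      also have "\<dots> = real (card (- {i, e})) * (- S * \<phi>' \<theta>)" by simp
      also have "real (card (- {i, e})) = n - 1"
        using i dim by (simp add: Compl_eq_Diff_UNIV card_Diff_subset n of_nat_diff)
      also have "(\<Sum>j\<in>Basis. AF y j \<bullet> j) = - f (\<phi> \<theta>)"
        using trace_AF[OF H] cn[of \<theta>] by (simp add: y_def \<phi>_def)
      finally show ?thesis by (simp add: C_def S_def algebra_simps)
    qed
    show "(\<phi> has_real_derivative 0) (at_right 0)"
    proof -
      \<comment> \<open>Symmetry transports the vanishing of \<open>b\<close> from the given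
        equatorial point to the start of the chosen meridian.\<close>
      have zc: "z0 \<in> chemi e" "z \<in> chemi e" "z0 $ e = z $ e" using z0 ze by (auto simp: equator_def chemi_def)
      then have "u z = u z0" using sym by metis
      then have "b (u z) = 0" using z0 by simp
      moreover have "((\<lambda>\<theta>. u (cos \<theta> *\<^sub>R z + sin \<theta> *\<^sub>R ax)) has_real_derivative - b (u z)) (at_right 0)"
        using sol ze by (auto simp: is_solution_def)
      moreover have "\<phi> = (\<lambda>\<theta>. u (cos \<theta> *\<^sub>R z + sin \<theta> *\<^sub>R ax))" using \<phi>u by (auto simp: c_def)
      ultimately show ?thesis by simp
    qed
    show "continuous_on {0<..} f" by (rule continuous_on_subset[OF f_cont]) auto
    show "t powr (-(n+2)/(n-2)) * (f t + n*(n-2)/4 * t) < s powr (-(n+2)/(n-2)) * (f s + n*(n-2)/4 * s)"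
      if "0 < s" "s < t" for s t using dec[OF that] .
  qed
  have xs: "0 < x $ e" "x $ e \<le> 1" "x \<in> chemi e"
    using x component_le_norm_cart[of x e] by (auto simp: hemi_def chemi_def)
  define \<theta> where "\<theta> = arcsin (x $ e)"
  have \<theta>: "0 \<le> \<theta>" "\<theta> \<le> pi/2" "sin \<theta> = x $ e"
    using xs arcsin_lbound[of "x $ e"] arcsin_ubound[of "x $ e"] arcsin_nonneg by (auto simp: \<theta>_def)
  have "u x = u (c \<theta>)" using \<theta> xs ce by (intro sym c_chemi) auto
  also have "\<dots> = u (c (pi/2))" using R.profile_constant[OF \<theta>(1,2)] \<phi>u by simp
  also have "c (pi/2) = ax" by (simp add: c_def)
  finally show ?thesis .
qed

end

theorem theorem1p1:
  fixes f b :: "real \<Rightarrow> real" and e :: "'m::finite"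
  defines "n \<equiv> real (CARD('m)) - 1"
  assumes dim: "CARD('m) \<ge> 4"
    and f_cont: "continuous_on {0..} f" and b_cont: "continuous_on {0..} b"
    and h1_dec: "\<And>s t. 0 < s \<Longrightarrow> s < t \<Longrightarrow>
        t powr (-(n+2)/(n-2)) * (f t + n*(n-2)/4 * t)
          < s powr (-(n+2)/(n-2)) * (f s + n*(n-2)/4 * s)"
    and k1_noninc: "\<And>s t. 0 < s \<Longrightarrow> s \<le> t \<Longrightarrow>
        t powr (-n/(n-2)) * b t \<le> s powr (-n/(n-2)) * b s"
    and k1_nonneg: "\<And>t. 0 < t \<Longrightarrow> t powr (-n/(n-2)) * b t \<ge> 0"
  shows
    "(\<forall>u. is_solution f b e u \<and> (\<forall>x\<in>chemi e. u x > 0) \<longrightarrow>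
        (\<forall>r\<in>{0..pi/2}. \<forall>x\<in>parallel_set e r. \<forall>y\<in>parallel_set e r. u x = u y) \<and>
        ((\<exists>z\<in>equator e. b (u z) = 0) \<longrightarrow> (\<forall>x\<in>hemi e. \<forall>y\<in>hemi e. u x = u y)))
   \<and> ((\<forall>t\<ge>0. f t + n*(n-2)/4 * t \<ge> 0) \<longrightarrow>
        (\<forall>u. is_solution f b e u \<and> (\<forall>x\<in>chemi e. u x \<ge> 0) \<longrightarrow>
            ((\<forall>x\<in>chemi e. u x = 0) \<or> (\<forall>x\<in>chemi e. u x > 0)))
        \<and> ((\<forall>t>0. b t \<ge> (n-2)/2 * t) \<longrightarrow>
            \<not> (\<exists>u. is_solution f b e u \<and> (\<forall>x\<in>chemi e. u x > 0))))"
proof -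
  have solution: "sphere_solution f b e u n ((n - 2) / 2)" if "is_solution f b e u" for u
    using that dim by unfold_locales (auto simp: n_def)
  have sym: "u x = u y"
    if u: "is_solution f b e u" "\<forall>x\<in>chemi e. u x > 0" and "x \<in> chemi e" "y \<in> chemi e" "x $ e = y $ e" for u x y
  proof -
    interpret S: sphere_solution f b e u n "(n - 2) / 2" by (rule solution[OF u(1)])
    show ?thesis
      by (rule S.u_axially_symmetric[OF S.conformal_solution_U[OF _ f_cont h1_dec k1_noninc k1_nonneg]])
         (use that in auto)
  qed
  have const: "u x = u y"
    if u: "is_solution f b e u" "\<forall>x\<in>chemi e. u x > 0" and z: "z \<in> equator e" "b (u z) = 0"
      and "x \<in> hemi e" "y \<in> hemi e" for u x y z
  proof -
    interpret S: sphere_solution f b e u n "(n - 2) / 2" by (rule solution[OF u(1)])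
    have "u w = u (axis e 1)" if "w \<in> hemi e" for w
      by (rule S.neumann_zero_constant[OF sym[OF u] _ f_cont h1_dec z that]) (use u in auto)
    from this[OF \<open>x \<in> hemi e\<close>] this[OF \<open>y \<in> hemi e\<close>] show ?thesis by simp
  qed
  \<comment> \<open>Nonnegativity of \<open>b\<close> on positive arguments extends to 0 by
    continuity; the value at 0 is what an equatorial zero of \<open>u\<close> meets.\<close>
  have b0: "0 \<le> b 0"
  proof -
    have "(b \<longlongrightarrow> b 0) (at 0 within {0..1})"
      using continuous_on_subset[OF b_cont, of "{0..1}"] by (auto simp: continuous_on_def)
    then have lim: "(b \<longlongrightarrow> b 0) (at_right 0)" by (simp add: at_within_Icc_at_right)
    have "\<forall>\<^sub>F t in at_right 0. t \<in> {0::real<..<1}" by (rule eventually_at_right_real) simp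
    then have "\<forall>\<^sub>F t in at_right 0. 0 \<le> b t"
    proof eventually_elim
      case (elim t)
      then show ?case using k1_nonneg[of t] by (simp add: zero_le_mult_iff)
    qed
    from tendsto_lowerbound[OF lim this] show ?thesis by simp
  qed
  show ?thesis
  proof (intro conjI allI impI; (elim conjE)?)
    fix u assume u: "is_solution f b e u" "\<forall>x\<in>chemi e. u x > 0"
    show "\<forall>r\<in>{0..pi/2}. \<forall>x\<in>parallel_set e r. \<forall>y\<in>parallel_set e r. u x = u y"
    proof (intro ballI)
      fix r x y assume xy: "x \<in> parallel_set e r" "y \<in> parallel_set e r"
      show "u x = u y"
        by (rule sym[OF u _ _ parallel_set_height[OF dim xy]]) (use xy in \<open>auto simp: parallel_set_def\<close>)
    qed
    show "\<forall>x\<in>hemi e. \<forall>y\<in>hemi e. u x = u y" if "\<exists>z\<in>equator e. b (u z) = 0"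
      using const[OF u] that by blast
  next
    fix u assume f0: "\<forall>t\<ge>0. f t + n*(n-2)/4 * t \<ge> 0"
      and u: "is_solution f b e u" "\<forall>x\<in>chemi e. u x \<ge> 0"
    interpret S: sphere_solution f b e u n "(n - 2) / 2" by (rule solution[OF u(1)])
    show "(\<forall>x\<in>chemi e. u x = 0) \<or> (\<forall>x\<in>chemi e. u x > 0)"
      by (rule S.nonneg_vanishes_or_positive) (use u f0 b0 in auto)
  next
    assume f0: "\<forall>t\<ge>0. f t + n*(n-2)/4 * t \<ge> 0" and b_ge: "\<forall>t>0. b t \<ge> (n-2)/2 * t"
    show "\<not> (\<exists>u. is_solution f b e u \<and> (\<forall>x\<in>chemi e. u x > 0))"
    proof
      assume "\<exists>u. is_solution f b e u \<and> (\<forall>x\<in>chemi e. u x > 0)"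
      then obtain u where u: "is_solution f b e u" "\<forall>x\<in>chemi e. u x > 0" by blast
      interpret S: sphere_solution f b e u n "(n - 2) / 2" by (rule solution[OF u(1)])
      show False by (rule S.no_positive_solution) (use u f0 b_ge h1_dec in auto)
    qed
  qed
qed

end
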